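(* Let $E_2=\operatorname{Ext}_{E(2)_*}(\mathbb{F}_2,(A/\!/E(2))_* )$ be the $E_2$-page of the Adams spectral sequence for $BP\langle 2\rangle\wedge BP\langle 2\rangle$, regarded as a module over $\operatorname{Ext}_{E(2)_*}(\mathbb{F}_2,\mathbb{F}_2)=\mathbb{F}_2[v_0,v_1,v_2]$. Then $E_2$ admits a decomposition as a direct sum of $\mathbb{F}_2[v_0,v_1,v_2]$-modules $$E_2\cong \mathcal{C}\oplus V,$$ where $\mathcal{C}$ is $v_2$-torsion free and is concentrated in even $(t-s)$-degree, and $V$ is concentrated in Adams filtration $s=0$.
   Context: Everything is at the prime 2; spectra are 2-complete and homology is with $\mathbb{F}_2$ coefficients. $A$ is the mod 2 Steenrod algebra and $A_*=\mathbb{F}_2[\zeta_1,\zeta_2,\dots]$ its dual, where $\zeta_k$ is the conjugate of Milnor's generator $\xi_k$, $|\zeta_k|=2^k-1$, $\zeta_0=1$, and the coproduct is $\psi(\zeta_n)=\sum_{i+j=n}\zeta_j\otimes\zeta_i^{2^j}$. $E(n)\subset A$ denotes the exterior sub-Hopf algebra generated by the Milnor primitives $Q_0,\dots,Q_n$; its dual is the quotient Hopf algebra $E(n)_*=E(\zeta_1,\dots,\zeta_{n+1})$ of $A_*$ (exterior on primitive generators). $BP\langle 2\rangle$ is the second truncated Brown–Peterson spectrum at 2; $H_*BP\langle 2\rangle\cong (A/\!/E(2))_*=\mathbb{F}_2[\zeta_1^2,\zeta_2^2,\zeta_3^2,\zeta_4,\zeta_5,\dots]\subset A_*$, an $E(2)_*$-comodule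 via $\psi$ followed by the projection $A_*\to E(2)_*$ on the left factor. By a change of rings, the $E_2$-page of the Adams spectral sequence $\operatorname{Ext}^{s,t}_{A_*}(\mathbb{F}_2,H_*(BP\langle 2\rangle\wedge BP\langle 2\rangle))\Rightarrow \pi_{t-s}(BP\langle 2\rangle\wedge BP\langle 2\rangle)$ is $\operatorname{Ext}_{E(2)_*}^{s,t}(\mathbb{F}_2,(A/\!/E(2))_* )$ (Ext of comodules); $s$ is the Adams filtration. The element $v_i\in\operatorname{Ext}^{1,2^{i+1}-1}_{E(2)_*}(\mathbb{F}_2,\mathbb{F}_2)$ is represented by $[\zeta_{i+1}]$ in the cobar complex. *)

theory Defs
  imports Complex_Main "HOL-Library.Poly_Mapping" "HOL-Library.Product_Plus" "HOL-Library.Z2"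
begin

section \<open>Linear algebra over the field with two elements\<close>

text \<open>
  The \<open>\<bbbF>\<^sub>2\<close>-vector space with basis \<open>X\<close> is the space \<open>X \<Rightarrow>\<^sub>0 bit\<close> of finitely supported
  functions; the tensor product of the spaces with bases \<open>X\<close> and \<open>Y\<close> is the one with basis \<open>X \<times> Y\<close>.
  Since every nonzero coefficient is 1, the linear extension of a map on the basis is
  a sum over the support.
\<close>

definition lin :: "('a \<Rightarrow> 'b::comm_monoid_add) \<Rightarrow> ('a \<Rightarrow>\<^sub>0 bit) \<Rightarrow> 'b" where
  "lin f x = (\<Sum>a\<in>Poly_Mapping.keys x. f a)"

definition restr :: "('a \<Rightarrow> bool) \<Rightarrow> ('a \<Rightarrow>\<^sub>0 bit) \<Rightarrow> ('a \<Rightarrow>\<^sub>0 bit)" where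
  "restr P = lin (\<lambda>a. if P a then Poly_Mapping.single a 1 else 0)"

definition tensor :: "('a \<Rightarrow>\<^sub>0 bit) \<Rightarrow> ('b \<Rightarrow>\<^sub>0 bit) \<Rightarrow> ('a \<times> 'b \<Rightarrow>\<^sub>0 bit)" where
  "tensor x y = lin (\<lambda>a. lin (\<lambda>b. Poly_Mapping.single (a, b) 1) y) x"

lemma f2_add_self [simp]: "x + x = (0 :: 'a \<Rightarrow>\<^sub>0 bit)"
  by (rule poly_mapping_eqI) (simp add: lookup_add)

lemma f2_uminus [simp]: "- x = (x :: 'a \<Rightarrow>\<^sub>0 bit)"
  by (metis f2_add_self minus_unique)

lemma f2_minus [simp]: "x - y = x + (y :: 'a \<Rightarrow>\<^sub>0 bit)"
  by (metis f2_uminus diff_conv_add_uminus)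

lemma lin_zero [simp]: "lin f 0 = 0"
  by (simp add: lin_def)

lemma lin_single [simp]: "lin f (Poly_Mapping.single a 1) = f a"
  by (simp add: lin_def)

lemma lin_superset:
  assumes "finite S" "Poly_Mapping.keys x \<subseteq> S"
  shows "lin f x = (\<Sum>a\<in>S. if Poly_Mapping.lookup x a = 1 then f a else 0)"
  unfolding lin_def
  by (rule sum.mono_neutral_cong_left) (use assms in \<open>auto simp: in_keys_iff\<close>)

lemma lin_add_gen:
  fixes f :: "'a \<Rightarrow> 'b::comm_monoid_add"
  assumes "\<And>y::'b. y + y = 0"
  shows "lin f (x + y) = lin f x + lin f y"
proof -
  let ?S = "Poly_Mapping.keys x \<union> Poly_Mapping.keys y"
  have fin: "finite ?S" by simp
  have k: "Poly_Mapping.keys (x + y) \<subseteq> ?S" by (rule keys_add)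
  have "(if Poly_Mapping.lookup (x + y) a = 1 then f a else 0) =
        (if Poly_Mapping.lookup x a = 1 then f a else 0) +
        (if Poly_Mapping.lookup y a = 1 then f a else 0)" for a
    by (cases "Poly_Mapping.lookup x a"; cases "Poly_Mapping.lookup y a")
      (simp_all add: lookup_add assms)
  then show ?thesis
    by (simp add: lin_superset[OF fin k] lin_superset[OF fin, of x] lin_superset[OF fin, of y]
        sum.distrib)
qed

lemma lin_add [simp]: "lin f (x + y) = lin f x + (lin f y :: 'b \<Rightarrow>\<^sub>0 bit)"
  by (rule lin_add_gen) simp

lemma lin_id: "lin (\<lambda>a. Poly_Mapping.single a 1) x = x"
proof (rule poly_mapping_eqI)
  fix k
  show "Poly_Mapping.lookup (lin (\<lambda>a. Poly_Mapping.single a 1) x) k = Poly_Mapping.lookup x k"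
    unfolding lin_def
    by (cases "k \<in> Poly_Mapping.keys x")
      (auto simp: lookup_sum lookup_single when_def in_keys_iff)
qed

lemma f2_induct [case_names zero single add]:
  assumes "P 0" "\<And>a. P (Poly_Mapping.single a 1)" "\<And>x y. P x \<Longrightarrow> P y \<Longrightarrow> P (x + y)"
  shows "P (x :: 'a \<Rightarrow>\<^sub>0 bit)"
proof -
  have "P (\<Sum>a\<in>S. Poly_Mapping.single a 1)" if "finite S" for S
    using that by induction (use assms in auto)
  from this[of "Poly_Mapping.keys x"] show ?thesis
    using lin_id[of x] by (simp add: lin_def)
qed

lemma lin_sum: "finite I \<Longrightarrow> lin f (\<Sum>i\<in>I. g i) = (\<Sum>i\<in>I. (lin f (g i) :: 'b \<Rightarrow>\<^sub>0 bit))"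
  by (induction I rule: finite_induct) auto

section \<open>The dual Steenrod algebra and its quotient \<open>E(2)\<^sub>*\<close>\<close>

text \<open>
  A monomial is its exponent function; the variable with index \<open>k\<close> is \<open>\<zeta>\<^bsub>k+1\<^esub>\<close>, so that
  \<open>A\<^sub>* = \<bbbF>\<^sub>2[\<zeta>\<^sub>1, \<zeta>\<^sub>2, \<dots>]\<close> is the monoid algebra \<open>mono \<Rightarrow>\<^sub>0 bit\<close>, and likewise \<open>A\<^sub>* \<otimes> A\<^sub>*\<close> is the
  monoid algebra of \<open>mono \<times> mono\<close>.
\<close>

type_synonym mono = "nat \<Rightarrow>\<^sub>0 nat"
type_synonym dual_steenrod = "mono \<Rightarrow>\<^sub>0 bit"
type_synonym dual_steenrod2 = "mono \<times> mono \<Rightarrow>\<^sub>0 bit"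

definition zeta_mono :: "nat \<Rightarrow> mono" where
  "zeta_mono n = (case n of 0 \<Rightarrow> 0 | Suc k \<Rightarrow> Poly_Mapping.single k 1)"

definition zeta :: "nat \<Rightarrow> dual_steenrod" where
  "zeta n = Poly_Mapping.single (zeta_mono n) 1"

definition mono_degree :: "mono \<Rightarrow> nat" where
  "mono_degree m = (\<Sum>k\<in>Poly_Mapping.keys m. Poly_Mapping.lookup m k * (2 ^ Suc k - 1))"

definition psi_zeta :: "nat \<Rightarrow> dual_steenrod2" where
  "psi_zeta n = (\<Sum>j\<le>n. tensor (zeta j) (zeta (n - j) ^ (2 ^ j)))"

definition psi_mono :: "mono \<Rightarrow> dual_steenrod2" where
  "psi_mono m = (\<Prod>k\<in>Poly_Mapping.keys m. psi_zeta (Suc k) ^ Poly_Mapping.lookup m k)"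

definition psi :: "dual_steenrod \<Rightarrow> dual_steenrod2" where
  "psi = lin psi_mono"

text \<open>
  \<open>E(2)\<^sub>*\<close> is the quotient of \<open>A\<^sub>*\<close> by the monomial ideal \<open>(\<zeta>\<^sub>1\<^sup>2, \<zeta>\<^sub>2\<^sup>2, \<zeta>\<^sub>3\<^sup>2, \<zeta>\<^sub>4, \<zeta>\<^sub>5, \<dots>)\<close>. It has as basis
  the monomials outside the ideal, and in these coordinates the projection \<open>A\<^sub>* \<rightarrow> E(2)\<^sub>*\<close> discards
  all other monomials.
\<close>

definition E2_mono :: "mono \<Rightarrow> bool" where
  "E2_mono m \<longleftrightarrow> (\<forall>k. Poly_Mapping.lookup m k \<le> (if k < 3 then 1 else 0))"

text \<open>
  The reduced coproduct of the coaugmentation coideal, with basis the \<open>E2_mono\<close>s other than 1: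
  push \<open>\<psi>\<close> forward along \<open>A\<^sub>* \<otimes> A\<^sub>* \<rightarrow> E(2)\<^sub>* \<otimes> E(2)\<^sub>*\<close> and drop the terms having a factor 1.
\<close>

definition red_coproduct :: "mono \<Rightarrow> dual_steenrod2" where
  "red_coproduct a =
     restr (\<lambda>(b, c). E2_mono b \<and> b \<noteq> 0 \<and> E2_mono c \<and> c \<noteq> 0) (psi (Poly_Mapping.single a 1))"

text \<open>
  \<open>(A//E(2))\<^sub>* = \<bbbF>\<^sub>2[\<zeta>\<^sub>1\<^sup>2, \<zeta>\<^sub>2\<^sup>2, \<zeta>\<^sub>3\<^sup>2, \<zeta>\<^sub>4, \<zeta>\<^sub>5, \<dots>]\<close> is spanned by the following monomials. Its reduced
  coaction is \<open>\<psi>\<close> followed by the projection to \<open>E(2)\<^sub>*\<close> on the left factor, less the term \<open>1 \<otimes> m\<close>.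
\<close>

definition AE2_mono :: "mono \<Rightarrow> bool" where
  "AE2_mono m \<longleftrightarrow> (\<forall>k<3. even (Poly_Mapping.lookup m k))"

definition red_coaction :: "mono \<Rightarrow> dual_steenrod2" where
  "red_coaction m = restr (\<lambda>(a, n). E2_mono a \<and> a \<noteq> 0) (psi (Poly_Mapping.single m 1))"

section \<open>The cobar complex\<close>

text \<open>
  The pair \<open>([a\<^sub>1, \<dots>, a\<^sub>s], m)\<close> stands for \<open>[a\<^sub>1|\<dots>|a\<^sub>s]m\<close>. The reduced (normalized) cobar complex
  of the left comodule \<open>(A//E(2))\<^sub>*\<close> is the span \<open>cobar_cochains\<close> of those with \<open>a\<^sub>i \<noteq> 1\<close> in the basis of
  \<open>E(2)\<^sub>*\<close> and \<open>m\<close> in the basis of \<open>(A//E(2))\<^sub>*\<close>, and its differential is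
  \<open>d [a\<^sub>1|\<dots>|a\<^sub>s]m = (\<Sum>i. [a\<^sub>1|\<dots>|a\<^sub>i'|a\<^sub>i''|\<dots>|a\<^sub>s]m) + [a\<^sub>1|\<dots>|a\<^sub>s|m']m''\<close>,
  with reduced coproduct and coaction. All cohomological degrees \<open>s\<close> are summed up in one space.
\<close>

type_synonym cobar = "mono list \<times> mono \<Rightarrow>\<^sub>0 bit"

definition cobar_cochains :: "cobar set" where
  "cobar_cochains =
     {x. \<forall>(as, m)\<in>Poly_Mapping.keys x. (\<forall>a\<in>set as. E2_mono a \<and> a \<noteq> 0) \<and> AE2_mono m}"

definition cobar_prefix :: "mono \<Rightarrow> cobar \<Rightarrow> cobar" where
  "cobar_prefix a = lin (\<lambda>(as, m). Poly_Mapping.single (a # as, m) 1)"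

fun cobar_d_basis :: "mono list \<Rightarrow> mono \<Rightarrow> cobar" where
  "cobar_d_basis [] m = lin (\<lambda>(a, n). Poly_Mapping.single ([a], n) 1) (red_coaction m)"
| "cobar_d_basis (a # as) m =
     lin (\<lambda>(b, c). Poly_Mapping.single (b # c # as, m) 1) (red_coproduct a)
     + cobar_prefix a (cobar_d_basis as m)"

definition cobar_d :: "cobar \<Rightarrow> cobar" where
  "cobar_d = lin (\<lambda>(as, m). cobar_d_basis as m)"

lemma cobar_d_add [simp]: "cobar_d (x + y) = cobar_d x + cobar_d y"
  by (simp add: cobar_d_def)

lemma cobar_d_zero [simp]: "cobar_d 0 = 0"
  by (simp add: cobar_d_def)

lemma cobar_prefix_add [simp]: "cobar_prefix a (x + y) = cobar_prefix a x + cobar_prefix a y"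
  by (simp add: cobar_prefix_def)

lemma cobar_prefix_zero [simp]: "cobar_prefix a 0 = 0"
  by (simp add: cobar_prefix_def)

lemma cobar_cochains_zero [simp]: "0 \<in> cobar_cochains"
  by (simp add: cobar_cochains_def)

lemma cobar_cochains_add [simp]:
  "x \<in> cobar_cochains \<Longrightarrow> y \<in> cobar_cochains \<Longrightarrow> x + y \<in> cobar_cochains"
  using keys_add[of x y] unfolding cobar_cochains_def by blast

lemma keys_cobar_prefix:
  "Poly_Mapping.keys (cobar_prefix a x) \<subseteq> (\<lambda>(as, m). (a # as, m)) ` Poly_Mapping.keys x"
  unfolding cobar_prefix_def lin_def
  by (rule order_trans[OF keys_sum]) auto

lemma cobar_cochains_prefix:
  assumes "E2_mono a" "a \<noteq> 0" "x \<in> cobar_cochains"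
  shows "cobar_prefix a x \<in> cobar_cochains"
  using keys_cobar_prefix[of a x] assms unfolding cobar_cochains_def by fastforce

lemma lin_fun_add: "lin (\<lambda>a. f a + g a) p = lin f p + lin g p"
  by (simp add: lin_def sum.distrib)

lemma cobar_d_prefix:
  "cobar_d (cobar_prefix a x) =
     lin (\<lambda>(b, c). cobar_prefix b (cobar_prefix c x)) (red_coproduct a) + cobar_prefix a (cobar_d x)"
proof (induction x rule: f2_induct)
  case zero
  show ?case by (simp add: lin_def case_prod_beta)
next
  case (single p)
  show ?case
    by (cases p) (simp add: cobar_d_def cobar_prefix_def)
next
  case (add x y)
  then show ?case
    by (simp add: case_prod_beta lin_fun_add algebra_simps)
qed

section \<open>The \<open>E\<^sub>2\<close>-page as a bigraded module over \<open>\<bbbF>\<^sub>2[v\<^sub>0, v\<^sub>1, v\<^sub>2]\<close>\<close>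

definition E2_rel :: "cobar \<Rightarrow> cobar \<Rightarrow> bool" where
  "E2_rel x y \<longleftrightarrow> x \<in> cobar_cochains \<and> y \<in> cobar_cochains \<and> cobar_d x = 0 \<and> cobar_d y = 0 \<and>
     (\<exists>z\<in>cobar_cochains. x - y = cobar_d z)"

lemma E2_relI:
  "x \<in> cobar_cochains \<Longrightarrow> y \<in> cobar_cochains \<Longrightarrow> cobar_d x = 0 \<Longrightarrow> cobar_d y = 0 \<Longrightarrow>
   z \<in> cobar_cochains \<Longrightarrow> x + y = cobar_d z \<Longrightarrow> E2_rel x y"
  unfolding E2_rel_def f2_minus by blast

lemma E2_relE:
  assumes "E2_rel x y"
  obtains z where "x \<in> cobar_cochains" "y \<in> cobar_cochains" "cobar_d x = 0" "cobar_d y = 0"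
    "z \<in> cobar_cochains" "x + y = cobar_d z"
  using assms unfolding E2_rel_def f2_minus by blast

lemma E2_rel_refl: "x \<in> cobar_cochains \<Longrightarrow> cobar_d x = 0 \<Longrightarrow> E2_rel x x"
  by (rule E2_relI[of _ _ 0]) simp_all

lemma E2_rel_add:
  assumes "E2_rel x y" "E2_rel x' y'"
  shows "E2_rel (x + x') (y + y')"
  using assms(1)
proof (rule E2_relE)
  fix p
  assume p: "x \<in> cobar_cochains" "y \<in> cobar_cochains" "cobar_d x = 0" "cobar_d y = 0"
    "p \<in> cobar_cochains" "x + y = cobar_d p"
  from assms(2) show ?thesis
  proof (rule E2_relE)
    fix q
    assume q: "x' \<in> cobar_cochains" "y' \<in> cobar_cochains" "cobar_d x' = 0" "cobar_d y' = 0"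
      "q \<in> cobar_cochains" "x' + y' = cobar_d q"
    have "(x + x') + (y + y') = (x + y) + (x' + y')" by (simp only: ac_simps)
    also have "\<dots> = cobar_d (p + q)" by (simp only: p(6) q(6) cobar_d_add)
    finally show ?thesis
      by (rule E2_relI[rotated 5]) (simp_all add: p(1-5) q(1-5))
  qed
qed

lemma E2_rel_sym: "E2_rel x y \<Longrightarrow> E2_rel y x"
  by (erule E2_relE, rule E2_relI) (simp_all add: add.commute)

lemma E2_rel_trans:
  assumes "E2_rel x y" "E2_rel y z"
  shows "E2_rel x z"
  using assms(1)
proof (rule E2_relE)
  fix p
  assume p: "x \<in> cobar_cochains" "y \<in> cobar_cochains" "cobar_d x = 0" "cobar_d y = 0"
    "p \<in> cobar_cochains" "x + y = cobar_d p"
  from assms(2) show ?thesis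
  proof (rule E2_relE)
    fix q
    assume q: "y \<in> cobar_cochains" "z \<in> cobar_cochains" "cobar_d y = 0" "cobar_d z = 0"
      "q \<in> cobar_cochains" "y + z = cobar_d q"
    have "x + z = (x + z) + (y + y)" by (simp only: f2_add_self add_0_right)
    also have "\<dots> = (x + y) + (y + z)" by (simp only: ac_simps)
    also have "\<dots> = cobar_d (p + q)" by (simp only: p(6) q(6) cobar_d_add)
    finally show ?thesis
      by (rule E2_relI[rotated 5]) (simp_all add: p(1-5) q(1-5))
  qed
qed

text \<open>\<open>Ext\<^bsub>E(2)\<^sub>*\<^esub>(\<bbbF>\<^sub>2, (A//E(2))\<^sub>*)\<close>: cocycles modulo coboundaries, all bidegrees together.\<close>

quotient_type E2_page = cobar / partial: E2_rel
proof (rule part_equivpI)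
  show "\<exists>x. E2_rel x x" using E2_rel_refl[of 0] by (auto intro: exI[of _ 0])
  show "symp E2_rel" by (rule sympI) (rule E2_rel_sym)
  show "transp E2_rel" by (rule transpI) (rule E2_rel_trans)
qed

instantiation E2_page :: ab_group_add
begin

lift_definition zero_E2_page :: E2_page is 0 by (rule E2_rel_refl) simp_all
lift_definition plus_E2_page :: "E2_page \<Rightarrow> E2_page \<Rightarrow> E2_page" is "(+)" by (rule E2_rel_add)
lift_definition minus_E2_page :: "E2_page \<Rightarrow> E2_page \<Rightarrow> E2_page" is "(-)"
  unfolding f2_minus by (rule E2_rel_add)
lift_definition uminus_E2_page :: "E2_page \<Rightarrow> E2_page" is uminus unfolding f2_uminus .

instance
proof
  fix a b c :: E2_page
  show "a + b + c = a + (b + c)"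
    by transfer (unfold add.assoc, intro E2_rel_add)
  show "a + b = b + a"
    by transfer (subst add.commute, rule E2_rel_add)
  show "0 + a = a" by transfer (unfold add_0_left)
  show "- a + a = 0"
    by transfer (unfold f2_uminus f2_add_self, rule E2_rel_refl, simp_all)
  show "a - b = a + - b"
    by transfer (unfold f2_minus f2_uminus, rule E2_rel_add)
qed

end

lemma E2_page_add_self: "x + x = (0 :: E2_page)"
  by transfer (unfold f2_add_self, rule E2_rel_refl, simp_all)

lemma zeta_mono_0 [simp]: "zeta_mono 0 = 0"
  by (simp add: zeta_mono_def)

lemma lookup_zeta_mono: "Poly_Mapping.lookup (zeta_mono n) k = (if n = Suc k then 1 else 0)"
  by (cases n) (auto simp: zeta_mono_def lookup_single when_def)

lemma zeta_mono_eq_0 [simp]: "zeta_mono n = 0 \<longleftrightarrow> n = 0"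
  using lookup_zeta_mono[of n "n - 1"] by (cases n) auto

lemma E2_mono_zeta: "n \<le> 3 \<Longrightarrow> E2_mono (zeta_mono n)"
  by (auto simp: E2_mono_def lookup_zeta_mono)

lemma single_power:
  "Poly_Mapping.single (m :: mono) (1 :: bit) ^ N = Poly_Mapping.single (\<Sum>i<N. m) 1"
  by (induction N) (simp_all add: mult_single add.commute del: sum_constant)

lemma psi_zeta_eq:
  "psi_zeta n = (\<Sum>j\<le>n. Poly_Mapping.single (zeta_mono j, \<Sum>i<(2::nat) ^ j. zeta_mono (n - j)) 1)"
  by (simp add: psi_zeta_def zeta_def single_power tensor_def del: sum_constant)

lemma restr_single:
  "restr P (Poly_Mapping.single a 1) = (if P a then Poly_Mapping.single a 1 else 0)"
  by (simp add: restr_def)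

lemma not_E2_mono_psi:
  assumes "0 < j" "j < n"
  shows "\<not> E2_mono ((\<Sum>i<(2::nat) ^ j. zeta_mono (n - j)) + r)"
proof -
  obtain k where k: "n - j = Suc k" using assms by (cases "n - j") auto
  have "(2::nat) \<le> 2 ^ j"
    using assms power_increasing[of 1 j "2::nat"] by simp
  then have "2 \<le> Poly_Mapping.lookup ((\<Sum>i<(2::nat) ^ j. zeta_mono (n - j)) + r) k"
    unfolding lookup_add lookup_sum k by (simp add: lookup_zeta_mono)
  moreover have "Poly_Mapping.lookup m k \<le> 1" if "E2_mono m" for m
    using that unfolding E2_mono_def by (metis (full_types) le_trans zero_le_one le_refl)
  ultimately show ?thesis by fastforce
qed

lemma psi_single: "psi (Poly_Mapping.single m 1) = psi_mono m"
  by (simp add: psi_def)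

lemma psi_mono_zeta: "psi_mono (zeta_mono (Suc i)) = psi_zeta (Suc i)"
  by (simp add: psi_mono_def zeta_mono_def)

lemma psi_mono_zeta2:
  assumes "i \<noteq> j"
  shows "psi_mono (zeta_mono (Suc i) + zeta_mono (Suc j)) = psi_zeta (Suc i) * psi_zeta (Suc j)"
proof -
  have "Poly_Mapping.keys (zeta_mono (Suc i) + zeta_mono (Suc j)) = {i, j}"
    using assms by (auto simp: in_keys_iff lookup_add lookup_zeta_mono split: if_splits)
  then show ?thesis
    using assms by (simp add: psi_mono_def lookup_add lookup_zeta_mono)
qed

lemma red_coproduct_zeta: "red_coproduct (zeta_mono (Suc i)) = 0"
proof -
  have "red_coproduct (zeta_mono (Suc i)) =
    (\<Sum>j\<le>Suc i. restr (\<lambda>(b, c). E2_mono b \<and> b \<noteq> 0 \<and> E2_mono c \<and> c \<noteq> 0)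
       (Poly_Mapping.single (zeta_mono j, \<Sum>k<(2::nat) ^ j. zeta_mono (Suc i - j)) 1))"
    unfolding red_coproduct_def psi_single psi_mono_zeta psi_zeta_eq restr_def
    by (rule lin_sum) simp
  also have "\<dots> = 0"
  proof (rule sum.neutral, rule ballI)
    fix j assume "j \<in> {..Suc i}"
    then consider "j = 0" | "0 < j" "j < Suc i" | "j = Suc i" by fastforce
    then show "restr (\<lambda>(b, c). E2_mono b \<and> b \<noteq> 0 \<and> E2_mono c \<and> c \<noteq> 0)
       (Poly_Mapping.single (zeta_mono j, \<Sum>k<(2::nat) ^ j. zeta_mono (Suc i - j)) 1) = 0"
    proof cases
      case 2
      then show ?thesis using not_E2_mono_psi[of j "Suc i" 0] by (simp add: restr_single del: sum_constant)
    qed (simp_all add: restr_single)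
  qed
  finally show ?thesis .
qed

lemma red_coproduct_zeta2:
  assumes "i \<noteq> j" "i < 3" "j < 3"
  shows "red_coproduct (zeta_mono (Suc i) + zeta_mono (Suc j)) =
    Poly_Mapping.single (zeta_mono (Suc i), zeta_mono (Suc j)) 1
    + Poly_Mapping.single (zeta_mono (Suc j), zeta_mono (Suc i)) 1"
proof -
  define P where "P = (\<lambda>(b, c). E2_mono b \<and> b \<noteq> 0 \<and> E2_mono c \<and> c \<noteq> 0)"
  define L where "L = (\<lambda>(a, b). zeta_mono a + zeta_mono b)"
  define R where "R = (\<lambda>(a, b). (\<Sum>k<(2::nat) ^ a. zeta_mono (Suc i - a))
                         + (\<Sum>k<(2::nat) ^ b. zeta_mono (Suc j - b)))"
  let ?f = "\<lambda>p. restr P (Poly_Mapping.single (L p, R p) (1::bit))"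
  have "psi_zeta (Suc i) * psi_zeta (Suc j) =
    (\<Sum>p\<in>{..Suc i} \<times> {..Suc j}. Poly_Mapping.single (L p, R p) 1)"
    unfolding psi_zeta_eq sum_product sum.cartesian_product
    by (rule sum.cong) (auto simp: mult_single L_def R_def simp del: sum_constant)
  then have "red_coproduct (zeta_mono (Suc i) + zeta_mono (Suc j)) =
    restr P (\<Sum>p\<in>{..Suc i} \<times> {..Suc j}. Poly_Mapping.single (L p, R p) 1)"
    unfolding red_coproduct_def psi_single psi_mono_zeta2[OF assms(1)] P_def by simp
  also have "\<dots> = (\<Sum>p\<in>{..Suc i} \<times> {..Suc j}. ?f p)"
    unfolding restr_def by (rule lin_sum) simp
  also have "\<dots> = (\<Sum>p\<in>{(Suc i, 0), (0, Suc j)}. ?f p)"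
  proof (rule sum.mono_neutral_right)
    show "\<forall>p\<in>{..Suc i} \<times> {..Suc j} - {(Suc i, 0), (0, Suc j)}. ?f p = 0"
    proof
      fix p assume p: "p \<in> {..Suc i} \<times> {..Suc j} - {(Suc i, 0), (0, Suc j)}"
      obtain a b where ab: "p = (a, b)" by (cases p)
      have "\<not> P (L p, R p)"
      proof -
        consider "0 < a" "a < Suc i" | "0 < b" "b < Suc j"
          | "a = 0" "b = 0" | "a = Suc i" "b = Suc j"
          using p unfolding ab by fastforce
        then show ?thesis
        proof cases
          case 1
          then show ?thesis
            using not_E2_mono_psi[of a "Suc i"] by (simp add: P_def R_def ab del: sum_constant)
        next
          case 2
          then show ?thesis
            using not_E2_mono_psi[of b "Suc j"] by (simp add: P_def R_def ab add.commute del: sum_constant)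
        qed (simp_all add: P_def L_def R_def ab)
      qed
      then show "?f p = 0" by (simp add: restr_single)
    qed
  qed auto
  also have "\<dots> = Poly_Mapping.single (zeta_mono (Suc i), zeta_mono (Suc j)) 1
    + Poly_Mapping.single (zeta_mono (Suc j), zeta_mono (Suc i)) 1"
    using assms by (simp add: restr_single P_def L_def R_def E2_mono_zeta)
  finally show ?thesis .
qed

lemma cobar_d_prefix_zeta:
  "cobar_d (cobar_prefix (zeta_mono (Suc i)) x) = cobar_prefix (zeta_mono (Suc i)) (cobar_d x)"
  by (simp add: cobar_d_prefix red_coproduct_zeta)

text \<open>
  The class \<open>v\<^sub>i\<close> of \<open>[\<zeta>\<^bsub>i+1\<^esub>]\<close> acts by juxtaposition,
  \<open>v\<^sub>i \<cdot> [a\<^sub>1|\<dots>|a\<^sub>s]m = [\<zeta>\<^bsub>i+1\<^esub>|a\<^sub>1|\<dots>|a\<^sub>s]m\<close>. Only \<open>i < 3\<close> is meaningful.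
\<close>

lift_definition v_mult :: "nat \<Rightarrow> E2_page \<Rightarrow> E2_page" is
  "\<lambda>i x. if i < 3 then cobar_prefix (zeta_mono (Suc i)) x else 0"
proof -
  fix i x y assume "E2_rel x y"
  then show "E2_rel (if i < 3 then cobar_prefix (zeta_mono (Suc i)) x else 0)
               (if i < 3 then cobar_prefix (zeta_mono (Suc i)) y else 0)"
  proof (rule E2_relE)
    fix z
    assume z: "x \<in> cobar_cochains" "y \<in> cobar_cochains" "cobar_d x = 0" "cobar_d y = 0"
      "z \<in> cobar_cochains" "x + y = cobar_d z"
    show ?thesis
    proof (cases "i < 3")
      case True
      then have E: "E2_mono (zeta_mono (Suc i))" by (intro E2_mono_zeta) simp
      have "E2_rel (cobar_prefix (zeta_mono (Suc i)) x) (cobar_prefix (zeta_mono (Suc i)) y)"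
      proof (rule E2_relI)
        show "cobar_prefix (zeta_mono (Suc i)) x + cobar_prefix (zeta_mono (Suc i)) y =
          cobar_d (cobar_prefix (zeta_mono (Suc i)) z)"
          by (simp only: cobar_d_prefix_zeta z(6)[symmetric] cobar_prefix_add)
      qed (use E z(1-5) in \<open>simp_all add: cobar_cochains_prefix cobar_d_prefix_zeta\<close>)
      then show ?thesis using True by simp
    qed (simp add: E2_rel_refl)
  qed
qed

lemma v_mult_add: "v_mult i (x + y) = v_mult i x + v_mult i y"
proof transfer
  fix i x y assume "E2_rel x x" "E2_rel y y"
  then have c: "x \<in> cobar_cochains" "y \<in> cobar_cochains" "cobar_d x = 0" "cobar_d y = 0"
    by (auto elim: E2_relE)
  have "E2_mono (zeta_mono (Suc i))" if "i < 3" using that by (intro E2_mono_zeta) simp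
  then show "E2_rel (if i < 3 then cobar_prefix (zeta_mono (Suc i)) (x + y) else 0)
     ((if i < 3 then cobar_prefix (zeta_mono (Suc i)) x else 0)
      + (if i < 3 then cobar_prefix (zeta_mono (Suc i)) y else 0))"
    using c by (auto intro!: E2_rel_refl cobar_cochains_add cobar_cochains_prefix
        simp: cobar_d_prefix_zeta)
qed

lemma v_mult_commute: "v_mult i (v_mult j x) = v_mult j (v_mult i x)"
proof (cases "i \<noteq> j \<and> i < 3 \<and> j < 3")
  case False
  have z: "v_mult k y = 0" if "\<not> k < 3" for k y
    using that by transfer (simp add: E2_rel_refl)
  have "v_mult k 0 = 0" for k
    using v_mult_add[of k 0 0] by simp
  then show ?thesis using False z by auto
next
  case True
  then show ?thesis
  proof transfer
    fix i j x assume ij: "i \<noteq> j \<and> i < 3 \<and> j < (3::nat)" and "E2_rel x x"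
    then have c: "x \<in> cobar_cochains" "cobar_d x = 0" by (auto elim: E2_relE)
    let ?i = "zeta_mono (Suc i)" and ?j = "zeta_mono (Suc j)"
    have E: "E2_mono ?i" "E2_mono ?j" using ij by (auto intro: E2_mono_zeta)
    have Eij: "E2_mono (?i + ?j)" "?i + ?j \<noteq> 0"
      using ij by (auto simp: E2_mono_def lookup_add lookup_zeta_mono
          dest!: arg_cong[of _ _ "\<lambda>m. Poly_Mapping.lookup m i"])
    have "E2_rel (cobar_prefix ?i (cobar_prefix ?j x)) (cobar_prefix ?j (cobar_prefix ?i x))"
    proof (rule E2_relI)
      show "cobar_prefix (?i + ?j) x \<in> cobar_cochains"
        using Eij c by (rule_tac cobar_cochains_prefix)
      show "cobar_prefix ?i (cobar_prefix ?j x) + cobar_prefix ?j (cobar_prefix ?i x) =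
        cobar_d (cobar_prefix (?i + ?j) x)"
        using ij c by (simp add: cobar_d_prefix red_coproduct_zeta2)
    qed (use E c in \<open>simp_all add: cobar_cochains_prefix cobar_d_prefix_zeta\<close>)
    then show "E2_rel
       (if i < 3 then cobar_prefix ?i (if j < 3 then cobar_prefix ?j x else 0) else 0)
       (if j < 3 then cobar_prefix ?j (if i < 3 then cobar_prefix ?i x else 0) else 0)"
      using ij by simp
  qed
qed

text \<open>
  \<open>\<bbbF>\<^sub>2[v\<^sub>0, v\<^sub>1, v\<^sub>2]\<close> is the monoid algebra of the exponents \<open>(a, b, c)\<close> of \<open>v\<^sub>0\<^sup>a v\<^sub>1\<^sup>b v\<^sub>2\<^sup>c\<close>.
\<close>

type_synonym v_poly = "nat \<times> nat \<times> nat \<Rightarrow>\<^sub>0 bit"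

definition v2 :: v_poly where
  "v2 = Poly_Mapping.single (0, 0, 1) 1"

definition E2_scale :: "v_poly \<Rightarrow> E2_page \<Rightarrow> E2_page" where
  "E2_scale p x = lin (\<lambda>(a, b, c). (v_mult 0 ^^ a) ((v_mult 1 ^^ b) ((v_mult 2 ^^ c) x))) p"

lemma v_pow_add: "(v_mult i ^^ n) (x + y) = (v_mult i ^^ n) x + (v_mult i ^^ n) y"
  by (induction n) (simp_all add: v_mult_add)

lemma v_pow_commute: "(v_mult i ^^ n) ((v_mult j ^^ m) x) = (v_mult j ^^ m) ((v_mult i ^^ n) x)"
proof -
  have 1: "v_mult i ((v_mult j ^^ m) x) = (v_mult j ^^ m) (v_mult i x)" for x
    by (induction m) (simp_all add: v_mult_commute[of i j])
  show ?thesis by (induction n) (simp_all add: 1)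
qed

lemma E2_scale_add_left: "E2_scale (p + q) x = E2_scale p x + E2_scale q x"
  unfolding E2_scale_def by (rule lin_add_gen) (rule E2_page_add_self)

lemma E2_scale_add_right: "E2_scale p (x + y) = E2_scale p x + E2_scale p y"
  by (simp add: E2_scale_def lin_def case_prod_beta v_pow_add sum.distrib)

lemma E2_scale_zero [simp]: "E2_scale 0 x = 0"
  by (simp add: E2_scale_def)

lemma E2_scale_zero_right [simp]: "E2_scale p 0 = 0"
  using E2_scale_add_right[of p 0 0] by simp

lemma E2_scale_single [simp]: "E2_scale (Poly_Mapping.single (a, b, c) 1) x =
    (v_mult 0 ^^ a) ((v_mult 1 ^^ b) ((v_mult 2 ^^ c) x))"
  by (simp add: E2_scale_def)

lemma E2_scale_scale_single:
  "E2_scale (Poly_Mapping.single (a, b, c) 1) (E2_scale (Poly_Mapping.single (a', b', c') 1) x) =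
   E2_scale (Poly_Mapping.single (a, b, c) 1 * Poly_Mapping.single (a', b', c') 1) x"
  unfolding mult_single plus_prod_def fst_conv snd_conv mult_1_left E2_scale_single
    funpow_add o_apply
  by (simp only: v_pow_commute[where i = 2 and j = 0] v_pow_commute[where i = 1 and j = 0]
      v_pow_commute[where i = 2 and j = 1])

lemma E2_scale_scale: "E2_scale p (E2_scale q x) = E2_scale (p * q) x"
proof (induction p rule: f2_induct)
  case (single u)
  show ?case
  proof (induction q rule: f2_induct)
    case (single w)
    show ?case
      by (cases u; cases w) (simp only: E2_scale_scale_single)
  qed (simp_all add: distrib_left E2_scale_add_left E2_scale_add_right)
qed (simp_all add: distrib_right E2_scale_add_left)

lemma E2_scale_one: "E2_scale 1 x = x"
  using E2_scale_single[of 0 0 0 x] by (simp flip: single_one add: zero_prod_def)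

interpretation E2: module E2_scale
  by standard
    (simp_all add: E2_scale_add_left E2_scale_add_right E2_scale_scale E2_scale_one)

text \<open>
  \<open>E2_bidegree s t\<close> is \<open>Ext\<^sup>s\<^sup>,\<^sup>t\<close>: the classes of cocycles in cohomological degree \<open>s\<close> (the Adams
  filtration) and internal degree \<open>t\<close>.
\<close>

definition E2_bidegree :: "nat \<Rightarrow> nat \<Rightarrow> E2_page set" where
  "E2_bidegree s t =
     {abs_E2_page x | x. x \<in> cobar_cochains \<and> cobar_d x = 0 \<and>
        (\<forall>(as, m)\<in>Poly_Mapping.keys x.
           length as = s \<and> sum_list (map mono_degree as) + mono_degree m = t)}"

definition bigraded_submodule :: "E2_page set \<Rightarrow> bool" where
  "bigraded_submodule C \<longleftrightarrow> E2.subspace C \<and> C = E2.span (\<Union>s t. C \<inter> E2_bidegree s t)"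

definition v2_torsion_free :: "E2_page set \<Rightarrow> bool" where
  "v2_torsion_free C \<longleftrightarrow> (\<forall>x\<in>C. \<forall>n. E2_scale (v2 ^ n) x = 0 \<longrightarrow> x = 0)"

end

theory Submission
  imports Defs
begin

text \<open>
  The \<open>E(2)\<^sub>*\<close>-coaction on \<open>M = (A//E(2))\<^sub>*\<close> amounts to three commuting operators \<open>Q\<^sub>0, Q\<^sub>1, Q\<^sub>2\<close> of square
  zero. They are derivations that kill squares, and \<open>Q\<^sub>i \<zeta>\<^sub>n\<close> is \<open>\<zeta>\<^bsub>n-i-1\<^esub>\<close> raised to the power
  \<open>2\<^sup>i\<^sup>+\<^sup>1\<close> for \<open>n \<ge> 4\<close>. The Ext groups are the homology of \<open>M[v\<^sub>0, v\<^sub>1, v\<^sub>2]\<close> under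
  \<open>d = v\<^sub>0 Q\<^sub>0 + v\<^sub>1 Q\<^sub>1 + v\<^sub>2 Q\<^sub>2\<close>, and this is a Koszul complex: over the ring \<open>R\<close> of polynomials in the
  squares \<open>\<zeta>\<^sub>k\<^sup>2\<close>, the module \<open>M\<close> is exterior on \<open>\<zeta>\<^sub>4, \<zeta>\<^sub>5, \<dots>\<close>, and \<open>d\<close> contracts with the elements
  \<open>\<Sum>i. v\<^sub>i Q\<^sub>i \<zeta>\<^sub>n\<close> of \<open>R[v\<^sub>0, v\<^sub>1, v\<^sub>2]\<close>. All generators \<open>v\<^sub>i\<close> and \<open>\<zeta>\<^sub>k\<^sup>2\<close> have even \<open>t - s\<close> and
  \<open>\<zeta>\<^sub>n\<close> has odd degree, so the parity of \<open>t - s\<close> is that of the exterior degree.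

  The theorem follows from two facts: multiplication by \<open>v\<^sub>2\<close> is injective on the part of positive
  filtration (\<open>v2_injective\<close>), and classes of odd \<open>t - s\<close> are \<open>v\<^sub>2\<close>-power torsion
  (\<open>odd_v2_torsion\<close>). Indeed, take for \<open>V\<close> the kernel of \<open>v\<^sub>2\<close> in filtration 0. It is killed by
  every \<open>v\<^sub>i\<close>, because \<open>v\<^sub>i V\<close> lies in filtration 1 and is killed by \<open>v\<^sub>2\<close>. Take for \<open>C\<close> the sum of
  a homogeneous vector space complement of \<open>V\<close> in filtration 0 and of everything in positive
  filtration; this is a submodule since every \<open>v\<^sub>i\<close> raises the filtration. It has no \<open>v\<^sub>2\<close>-torsion,
  hence no classes of odd \<open>t - s\<close>.

  The two facts are proved by adjoining \<open>v\<^sub>0\<close>, \<open>v\<^sub>1\<close>, \<open>v\<^sub>2\<close> one after the other. For one operator \<open>Q\<^sub>r\<close>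
  the Koszul complex is that of powers of distinct variables, which is exact in positive exterior
  degree. The explicit contracting homotopy shows that after adjoining \<open>v\<^sub>r\<close> the homology in positive
  exterior degree is \<open>v\<^sub>r\<close>-power torsion (\<open>koszul_torsion\<close>): the errors that the operators \<open>Q\<^sub>i\<close> with
  \<open>i < r\<close> cause have smaller total exponent. On the other hand, the long exact sequence of
  reduction modulo \<open>v\<^sub>r\<close> shows that \<open>v\<^sub>r\<close> is injective in positive filtration if, before \<open>v\<^sub>r\<close> is
  adjoined, the homology vanishes in positive filtration and positive exterior degree
  (\<open>times_v_cancel\<close>). Both together give that vanishing for the next step
  (\<open>positive_acyclic\<close>). With no \<open>v\<close> at all there is no positive filtration to begin with.

  What remains is the passage from the cobar complex to the Koszul complex. Sending \<open>[a\<^sub>1|\<dots>|a\<^sub>s]m\<close> to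
  the product of the \<open>v\<close>s if each \<open>a\<^sub>i\<close> is some \<open>\<zeta>\<^sub>k\<close>, and to 0 otherwise, is a chain map. Only
  its injectivity in homology matters (\<open>to_koszul_boundary\<close>). For trivial coefficients a discrete
  Morse matching on words contracts its kernel (\<open>v_words_kernel_acyclic\<close>); the coaction is a
  perturbation that lowers the exterior degree.
\<close>

section \<open>Linear algebra over the field with two elements\<close>

abbreviation bas :: "'a \<Rightarrow> ('a \<Rightarrow>\<^sub>0 bit)" where
  "bas a \<equiv> Poly_Mapping.single a 1"

definition supp :: "('a \<Rightarrow> bool) \<Rightarrow> ('a \<Rightarrow>\<^sub>0 bit) \<Rightarrow> bool" where
  "supp P x \<longleftrightarrow> (\<forall>a\<in>Poly_Mapping.keys x. P a)"

lemma supp_zero [simp]: "supp P 0"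
  by (simp add: supp_def)

lemma supp_bas [simp]: "supp P (bas a) \<longleftrightarrow> P a"
  by (simp add: supp_def)

lemma supp_add: "supp P x \<Longrightarrow> supp P y \<Longrightarrow> supp P (x + y)"
  using keys_add[of x y] by (auto simp: supp_def)

lemma supp_mono: "supp P x \<Longrightarrow> (\<And>a. P a \<Longrightarrow> Q a) \<Longrightarrow> supp Q x"
  by (auto simp: supp_def)

lemma supp_conj: "supp P x \<Longrightarrow> supp Q x \<Longrightarrow> supp (\<lambda>a. P a \<and> Q a) x"
  by (auto simp: supp_def)

lemma supp_sum: "(\<And>i. i \<in> I \<Longrightarrow> supp P (f i)) \<Longrightarrow> supp P (sum f I)"
  by (induction I rule: infinite_finite_induct) (auto intro: supp_add)

lemma supp_lin: "(\<And>a. a \<in> Poly_Mapping.keys x \<Longrightarrow> supp P (f a)) \<Longrightarrow> supp P (lin f x)"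
  unfolding lin_def by (rule supp_sum)

lemma supp_False: "supp (\<lambda>a. False) x \<longleftrightarrow> x = 0"
  by (simp add: supp_def)

lemma lin_cong: "(\<And>a. a \<in> Poly_Mapping.keys x \<Longrightarrow> f a = g a) \<Longrightarrow> lin f x = lin g x"
  by (simp add: lin_def)

lemma lin_const_zero [simp]: "lin (\<lambda>_. 0) x = 0"
  by (simp add: lin_def)

lemma additive_lin:
  fixes F :: "('a \<Rightarrow>\<^sub>0 bit) \<Rightarrow> ('b \<Rightarrow>\<^sub>0 bit)"
  assumes "\<And>x y. F (x + y) = F x + (F y :: 'b \<Rightarrow>\<^sub>0 bit)"
  shows "F (lin f x) = lin (\<lambda>a. F (f a)) x"
proof -
  interpret additive F by standard (rule assms)
  show ?thesis by (simp add: lin_def sum)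
qed

lemma additive_zero:
  fixes F :: "('a \<Rightarrow>\<^sub>0 bit) \<Rightarrow> ('b \<Rightarrow>\<^sub>0 bit)"
  assumes "\<And>x y. F (x + y) = F x + F y"
  shows "F 0 = 0"
  by (metis assms f2_add_self)

lemma lin_lin: "lin f (lin g x) = lin (\<lambda>a. (lin f (g a) :: 'b \<Rightarrow>\<^sub>0 bit)) x"
  by (rule additive_lin) simp

text \<open>
  This and its variants are how identities between the operators below are checked on basis elements;
  the condition \<open>P\<close> allows identities that hold on part of the basis only.
\<close>

lemma additive_eqI:
  assumes "\<And>x y. F (x + y) = F x + (F y :: 'b \<Rightarrow>\<^sub>0 bit)" "\<And>x y. G (x + y) = G x + G y"
    and "supp P x" "\<And>a. P a \<Longrightarrow> F (bas a) = G (bas a)"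
  shows "F x = G x"
proof -
  have "F (lin bas x) = lin (\<lambda>a. F (bas a)) x" "G (lin bas x) = lin (\<lambda>a. G (bas a)) x"
    by (rule additive_lin, fact)+
  moreover have "lin (\<lambda>a. F (bas a)) x = lin (\<lambda>a. G (bas a)) x"
    using assms(3,4) by (intro lin_cong) (auto simp: supp_def)
  ultimately show ?thesis by (simp add: lin_id)
qed

lemma additive_eqI_all:
  assumes "\<And>x y. F (x + y) = F x + (F y :: 'b \<Rightarrow>\<^sub>0 bit)" "\<And>x y. G (x + y) = G x + G y"
    and "\<And>a. F (bas a) = G (bas a)"
  shows "F x = G x"
  by (rule additive_eqI[where P = "\<lambda>_. True"]) (use assms in \<open>auto simp: supp_def\<close>)

lemma supp_additive:
  assumes "\<And>x y. F (x + y) = F x + (F y :: 'b \<Rightarrow>\<^sub>0 bit)" "supp P x"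
    and "\<And>a. P a \<Longrightarrow> supp Q (F (bas a))"
  shows "supp Q (F x)"
proof -
  have "F (lin bas x) = lin (\<lambda>a. F (bas a)) x"
    by (rule additive_lin, fact)
  then show ?thesis
    using assms(2,3) by (auto simp: lin_id supp_def[of P] intro!: supp_lin)
qed

lemma restr_add [simp]: "restr P (x + y) = restr P x + restr P y"
  by (simp add: restr_def)

lemma restr_zero [simp]: "restr P 0 = 0"
  by (simp add: restr_def)

lemma lookup_restr: "Poly_Mapping.lookup (restr P x) a = (if P a then Poly_Mapping.lookup x a else 0)"
  by (induction x rule: f2_induct) (auto simp: lookup_add restr_single lookup_single when_def)

lemma supp_restr: "supp P (restr P x)"
  by (auto simp: supp_def in_keys_iff lookup_restr split: if_splits)

lemma supp_restr_both: "supp Q x \<Longrightarrow> supp (\<lambda>a. P a \<and> Q a) (restr P x)"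
  by (auto simp: supp_def in_keys_iff lookup_restr split: if_splits)

lemma restr_ident: "supp P x \<Longrightarrow> restr P x = x"
  by (rule poly_mapping_eqI) (metis in_keys_iff lookup_restr supp_def)

lemma restr_eq_zero: "supp (\<lambda>a. \<not> P a) x \<Longrightarrow> restr P x = 0"
  by (rule poly_mapping_eqI) (auto simp: lookup_restr supp_def in_keys_iff)

lemma restr_split: "restr P x + restr (\<lambda>a. \<not> P a) x = x"
  by (rule poly_mapping_eqI) (simp add: lookup_restr lookup_add)

text \<open>
  All gradings enter through this lemma: homogeneous components are restrictions, and the maps below
  are homogeneous, so they commute with taking components up to a shift.
\<close>

lemma restr_additive:
  assumes F: "\<And>x y. F (x + y) = F x + (F y :: 'b \<Rightarrow>\<^sub>0 bit)" and "supp R x"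
    and "\<And>a. R a \<Longrightarrow> P a \<Longrightarrow> supp P' (F (bas a))"
    and "\<And>a. R a \<Longrightarrow> \<not> P a \<Longrightarrow> supp (\<lambda>b. \<not> P' b) (F (bas a))"
  shows "restr P' (F x) = F (restr P x)"
proof (rule additive_eqI[where P = R and F = "\<lambda>x. restr P' (F x)" and G = "\<lambda>x. F (restr P x)" and x = x])
  fix a assume "R a"
  then show "restr P' (F (bas a)) = F (restr P (bas a))"
    using assms(3)[of a] assms(4)[of a]
    by (cases "P a") (simp_all add: restr_single restr_ident restr_eq_zero additive_zero[OF F])
qed (use assms in auto)

lemma f2_eq_iff: "x + y = 0 \<longleftrightarrow> x = (y :: 'a \<Rightarrow>\<^sub>0 bit)"
  by (metis f2_uminus eq_neg_iff_add_eq_0)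

lemma f2_add_cancel [simp]: "x + (x + y) = (y :: 'a \<Rightarrow>\<^sub>0 bit)"
  by (simp flip: add.assoc)

lemma f2_eq_swap: "x = y + z \<Longrightarrow> y = x + (z :: 'a \<Rightarrow>\<^sub>0 bit)"
  by (simp add: add.assoc)

section \<open>The cobar complex of \<open>E(2)\<^sub>*\<close>\<close>

text \<open>
  The letters are the seven nontrivial monomials of \<open>E(2)\<^sub>*\<close>, named by the indices of their factors,
  in decreasing order, where the index \<open>i\<close> stands for \<open>\<zeta>\<^bsub>i+1\<^esub>\<close>: \<open>L20\<close> is \<open>\<zeta>\<^sub>3 \<zeta>\<^sub>1\<close>.
\<close>

datatype letter = L0 | L1 | L2 | L10 | L20 | L21 | L210

type_synonym word = "letter list"

text \<open>
  The reduced coproduct of a letter: since the \<open>\<zeta>\<close>s are primitive in \<open>E(2)\<^sub>*\<close>, it distributes the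
  factors over two nonempty parts in all ways.
\<close>

fun splits :: "letter \<Rightarrow> (letter \<times> letter) list" where
  "splits L10 = [(L1, L0), (L0, L1)]"
| "splits L20 = [(L2, L0), (L0, L2)]"
| "splits L21 = [(L2, L1), (L1, L2)]"
| "splits L210 = [(L2, L10), (L21, L0), (L1, L20), (L0, L21), (L10, L2), (L20, L1)]"
| "splits _ = []"

definition cons :: "letter \<Rightarrow> (word \<Rightarrow>\<^sub>0 bit) \<Rightarrow> (word \<Rightarrow>\<^sub>0 bit)" where
  "cons a = lin (\<lambda>w. bas (a # w))"

definition cons_split :: "letter \<Rightarrow> (word \<Rightarrow>\<^sub>0 bit) \<Rightarrow> (word \<Rightarrow>\<^sub>0 bit)" where
  "cons_split a x = (\<Sum>(b, c)\<leftarrow>splits a. cons b (cons c x))"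

fun d_word :: "word \<Rightarrow> (word \<Rightarrow>\<^sub>0 bit)" where
  "d_word [] = 0"
| "d_word (a # w) = cons_split a (bas w) + cons a (d_word w)"

definition d_words :: "(word \<Rightarrow>\<^sub>0 bit) \<Rightarrow> (word \<Rightarrow>\<^sub>0 bit)" where
  "d_words = lin d_word"

lemma cons_add [simp]: "cons a (x + y) = cons a x + cons a y"
  by (simp add: cons_def)

lemma cons_zero [simp]: "cons a 0 = 0"
  by (simp add: cons_def)

lemma cons_bas [simp]: "cons a (bas w) = bas (a # w)"
  by (simp add: cons_def)

lemma cons_split_add [simp]: "cons_split a (x + y) = cons_split a x + cons_split a y"
  by (cases a) (simp_all add: cons_split_def ac_simps)

lemma cons_split_zero [simp]: "cons_split a 0 = 0"
  by (rule additive_zero[of "cons_split a"]) simp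

lemma supp_cons_split:
  "supp (\<lambda>u. \<exists>c c'. (c, c') \<in> set (splits a) \<and> u = c # c' # w) (cons_split a (bas w))"
  by (cases a) (auto simp: cons_split_def intro!: supp_add)

lemma d_words_add [simp]: "d_words (x + y) = d_words x + d_words y"
  by (simp add: d_words_def)

lemma d_words_zero [simp]: "d_words 0 = 0"
  by (simp add: d_words_def)

lemma d_words_bas [simp]: "d_words (bas w) = d_word w"
  by (simp add: d_words_def)

lemma d_words_cons: "d_words (cons a x) = cons_split a x + cons a (d_words x)"
  by (rule additive_eqI_all[where F = "\<lambda>x. d_words (cons a x)" and x = x])
    (simp_all add: ac_simps)

lemma d_words_cons_split: "d_words (cons_split a x) = cons_split a (d_words x)"
  by (cases a) (simp_all add: cons_split_def d_words_cons ac_simps)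

text \<open>
  The reduced coproduct is coassociative, so in \<open>d_words_cons_split\<close> the two ways to split a letter
  into three cancel.
\<close>

lemma d_words_d_words: "d_words (d_words x) = 0"
proof -
  have "d_words (d_word w) = 0" for w
    by (induction w) (simp_all add: d_words_cons d_words_cons_split ac_simps)
  then show ?thesis
    by (intro additive_eqI_all[where F = "\<lambda>x. d_words (d_words x)" and G = "\<lambda>_. 0" and x = x]) simp_all
qed

subsection \<open>A discrete Morse matching\<close>

fun greatest :: "letter \<Rightarrow> nat" where
  "greatest L0 = 0" | "greatest L1 = 1" | "greatest L10 = 1" | "greatest _ = 2"

definition generator :: "letter \<Rightarrow> bool" where
  "generator a \<longleftrightarrow> a \<in> {L0, L1, L2}"

text \<open>
  The product of two letters \<open>a\<close>, \<open>b\<close> such that \<open>a\<close> is a generator greater than all factors of \<open>b\<close>. On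
  other arguments the value is arbitrary.
\<close>

fun merge :: "letter \<Rightarrow> letter \<Rightarrow> letter" where
  "merge L1 _ = L10"
| "merge _ L0 = L20"
| "merge _ L1 = L21"
| "merge _ _ = L210"

text \<open>
  Read a word from the left for the first defect: either a letter that is not a generator, or a
  generator greater than all factors of the next letter. Splitting the greatest factor off the former
  gives the latter, so words with a defect come in pairs that differ by this split. The map merges the
  second kind back into the first. The words without a defect are the nondecreasing words in the
  generators.
\<close>

fun merge_word :: "word \<Rightarrow> (word \<Rightarrow>\<^sub>0 bit)" where
  "merge_word (a # b # w) =
     (if \<not> generator a then 0
      else if greatest b < greatest a then bas (merge a b # w)
      else cons a (merge_word (b # w)))"
| "merge_word _ = 0"

fun critical :: "word \<Rightarrow> bool" where
  "critical (a # b # w) \<longleftrightarrow> generator a \<and> greatest a \<le> greatest b \<and> critical (b # w)"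
| "critical [a] \<longleftrightarrow> generator a"
| "critical [] \<longleftrightarrow> True"

definition merge_words :: "(word \<Rightarrow>\<^sub>0 bit) \<Rightarrow> (word \<Rightarrow>\<^sub>0 bit)" where
  "merge_words = lin merge_word"

lemma merge_words_add [simp]: "merge_words (x + y) = merge_words x + merge_words y"
  by (simp add: merge_words_def)

lemma merge_words_zero [simp]: "merge_words 0 = 0"
  by (simp add: merge_words_def)

lemma merge_words_bas [simp]: "merge_words (bas w) = merge_word w"
  by (simp add: merge_words_def)

fun letter_size :: "letter \<Rightarrow> nat" where
  "letter_size L210 = 3"
| "letter_size L10 = 2" | "letter_size L20 = 2" | "letter_size L21 = 2"
| "letter_size _ = 1"

text \<open>
  Writing each letter as its factors in decreasing order turns a word into a sequence of digits 0, 1, 2.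
  \<open>letter_val\<close> and \<open>word_val\<close> read this sequence in base 3. Splits that cut a letter into an initial
  and a final segment preserve the sequence; all others make it smaller.
\<close>

fun letter_val :: "letter \<Rightarrow> nat" where
  "letter_val L0 = 0" | "letter_val L1 = 1" | "letter_val L2 = 2"
| "letter_val L10 = 3" | "letter_val L20 = 6" | "letter_val L21 = 7" | "letter_val L210 = 21"

fun word_size :: "word \<Rightarrow> nat" where
  "word_size [] = 0"
| "word_size (a # w) = letter_size a + word_size w"

fun word_val :: "word \<Rightarrow> nat" where
  "word_val [] = 0"
| "word_val (a # w) = letter_val a * 3 ^ word_size w + word_val w"

definition same_val :: "word \<Rightarrow> (word \<Rightarrow>\<^sub>0 bit) \<Rightarrow> bool" where
  "same_val w = supp (\<lambda>u. word_size u = word_size w \<and> word_val u = word_val w)"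

definition less_val :: "word \<Rightarrow> (word \<Rightarrow>\<^sub>0 bit) \<Rightarrow> bool" where
  "less_val w = supp (\<lambda>u. word_size u = word_size w \<and> word_val u < word_val w)"

lemma less_val_zero [simp]: "less_val w 0"
  by (simp add: less_val_def)

lemma less_val_add: "less_val w x \<Longrightarrow> less_val w y \<Longrightarrow> less_val w (x + y)"
  unfolding less_val_def by (rule supp_add)

lemma less_val_cons: "less_val w x \<Longrightarrow> less_val (a # w) (cons a x)"
  unfolding less_val_def cons_def by (rule supp_lin) (auto simp: supp_def)

lemma same_val_cons: "same_val w x \<Longrightarrow> same_val (a # w) (cons a x)"
  unfolding same_val_def cons_def by (rule supp_lin) (auto simp: supp_def)

lemma same_less_val:
  "same_val u x \<Longrightarrow> word_size u = word_size w \<Longrightarrow> word_val u < word_val w \<Longrightarrow> less_val w x"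
  unfolding same_val_def less_val_def by (erule supp_mono) auto

lemma merge_val:
  assumes "generator a" "greatest b < greatest a"
  shows "letter_size (merge a b) = letter_size a + letter_size b"
    "letter_val (merge a b) = letter_val a * 3 ^ letter_size b + letter_val b"
  using assms by (cases a; cases b; simp add: generator_def)+

lemma same_val_merge_word: "same_val w (merge_word w)"
proof (induction w rule: merge_word.induct)
  case (1 a b w)
  then show ?case
    using same_val_cons[of "b # w" "merge_word (b # w)" a]
    by (simp add: same_val_def merge_val algebra_simps power_add)
qed (simp_all add: same_val_def)

lemma split_val:
  assumes "(b, c) \<in> set (splits a)"
  shows "letter_size b + letter_size c = letter_size a"
    and "greatest b < greatest a \<Longrightarrow> letter_val b * 3 ^ letter_size c + letter_val c < letter_val a"
    and "generator b \<Longrightarrow> greatest b \<le> greatest c \<Longrightarrow> letter_val b * 3 ^ letter_size c + letter_val c < letter_val a"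
  using assms by (cases a; auto simp: generator_def)+


lemma less_val_split:
  assumes "(b, c) \<in> set (splits a)" "greatest b < greatest a \<or> generator b \<and> greatest b \<le> greatest c"
    and "same_val (b # c # w) x"
  shows "less_val (a # w) x"
proof (rule same_less_val[OF assms(3)])
  have "letter_val b * 3 ^ letter_size c + letter_val c < letter_val a"
    using split_val(2,3)[OF assms(1)] assms(2) by blast
  then have "(letter_val b * 3 ^ letter_size c + letter_val c) * 3 ^ word_size w
      < letter_val a * 3 ^ word_size w"
    by simp
  then show "word_val (b # c # w) < word_val (a # w)"
    by (simp add: algebra_simps power_add)
  show "word_size (b # c # w) = word_size (a # w)"
    using split_val(1)[OF assms(1)] by simp
qed


lemma less_val_split_bas:
  assumes "(b, c) \<in> set (splits a)" "greatest b < greatest a \<or> generator b \<and> greatest b \<le> greatest c"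
  shows "less_val (a # w) (bas (b # c # w))"
  by (rule less_val_split[OF assms]) (simp add: same_val_def)

lemma less_val_split_merge:
  assumes "(b, c) \<in> set (splits a)" "greatest b < greatest a \<or> generator b \<and> greatest b \<le> greatest c"
  shows "less_val (a # w) (cons b (merge_word (c # w)))"
  by (rule less_val_split[OF assms]) (intro same_val_cons same_val_merge_word)

lemma merge_word_not_generator [simp]: "\<not> generator a \<Longrightarrow> merge_word (a # w) = 0"
  by (cases w) simp_all

lemma merge_words_cons_not_generator: "\<not> generator a \<Longrightarrow> merge_words (cons a x) = 0"
  by (rule additive_eqI_all[where F = "\<lambda>x. merge_words (cons a x)" and G = "\<lambda>_. 0" and x = x])
    simp_all

lemma merge_words_cons_descent:
  "generator a \<Longrightarrow> greatest b < greatest a \<Longrightarrow> merge_words (cons a (cons b x)) = cons (merge a b) x"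
  by (rule additive_eqI_all[where F = "\<lambda>x. merge_words (cons a (cons b x))" and x = x]) simp_all

lemma merge_words_cons_ascent:
  "generator a \<Longrightarrow> greatest a \<le> greatest b \<Longrightarrow>
     merge_words (cons a (cons b x)) = cons a (merge_words (cons b x))"
  by (rule additive_eqI_all[where F = "\<lambda>x. merge_words (cons a (cons b x))" and x = x]) simp_all

lemma cons_split_generator [simp]: "generator a \<Longrightarrow> cons_split a x = 0"
  by (auto simp: generator_def cons_split_def)

lemma critical_merge: "critical w \<Longrightarrow> merge_word w = 0"
  by (induction w rule: critical.induct) auto

lemma critical_d_word: "critical w \<Longrightarrow> d_word w = 0"
  by (induction w rule: critical.induct) auto

text \<open>
  If merging does not commute with prefixing \<open>a\<close>, then the first part \<open>c\<close> of the split lost the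
  greatest factor of \<open>b\<close>, so the digit sequence has become smaller already.
\<close>

lemma less_val_merge_split:
  assumes "generator a" "greatest a \<le> greatest b" "(c, c') \<in> set (splits b)"
  shows "less_val (a # b # w)
    (cons a (merge_word (c # c' # w)) + merge_word (a # c # c' # w))"
proof (cases "greatest c < greatest a")
  case True
  then have "less_val (a # b # w) (cons a (bas (c # c' # w)))"
    using less_val_split_bas[OF assms(3)] assms(2) by (intro less_val_cons) simp
  then have *: "word_size (a # c # c' # w) = word_size (a # b # w)"
    "word_val (a # c # c' # w) < word_val (a # b # w)"
    unfolding less_val_def by simp_all
  have "same_val (a # c # c' # w) (cons a (merge_word (c # c' # w)) + merge_word (a # c # c' # w))"
    unfolding same_val_def
    by (intro supp_add; fold same_val_def; intro same_val_cons same_val_merge_word)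
  then show ?thesis using * by (rule same_less_val)
qed (use assms in simp)

text \<open>
  The matching gives a contraction up to smaller terms, by induction along the word. In the case of a
  defect at the head, exactly one split is matched with the word itself; the others lower the value or
  cancel against the splits of the merged letter. Without a defect at the head, merging happens in the
  tail.
\<close>

lemma critical_or_less_val:
  assumes "\<not> critical w"
  shows "less_val w (bas w + d_words (merge_word w) + merge_words (d_word w))"
  using assms
proof (induction w rule: critical.induct)
  case (1 a b w)
  consider "\<not> generator a" | "generator a" "greatest b < greatest a"
    | "generator a" "greatest a \<le> greatest b" by fastforce
  then show ?case
  proof cases
    case 1
    have "less_val (a # v) (bas (a # v) + merge_words (cons_split a (bas v)))" for v
      using 1 by (cases a) (auto simp: generator_def cons_split_def
          intro!: less_val_add less_val_split_merge)
    with 1 show ?thesis by (simp add: merge_words_cons_not_generator)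
  next
    case 2
    let ?c = "merge a b"
    have "less_val (?c # w) (bas (a # b # w) + cons_split ?c (bas w)
        + merge_words (cons a (cons_split b (bas w))))"
      using 2 by (cases a; cases b) (auto simp: generator_def cons_split_def ac_simps
          intro!: less_val_add less_val_split_bas)
    moreover have "less_val (a # b # w) = less_val (?c # w)"
    proof -
      have "word_size (?c # w) = word_size (a # b # w)" "word_val (?c # w) = word_val (a # b # w)"
        using 2 by (simp_all add: merge_val distrib_right power_add)
      then show ?thesis by (simp only: less_val_def)
    qed
    ultimately have "less_val (a # b # w) (bas (a # b # w) + cons_split ?c (bas w)
        + merge_words (cons a (cons_split b (bas w))))" by (simp only:)
    with 2 show ?thesis by (simp add: d_words_cons merge_words_cons_descent ac_simps)
  next
    case 3
    let ?r = "\<lambda>x. cons a (merge_words x) + merge_words (cons a x)"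
    have "less_val (a # b # w) (?r (cons_split b (bas w)))"
      unfolding less_val_def
    proof (rule supp_additive[where F = ?r, OF _ supp_cons_split])
      fix u assume "\<exists>c c'. (c, c') \<in> set (splits b) \<and> u = c # c' # w"
      then obtain c c' where u: "(c, c') \<in> set (splits b)" "u = c # c' # w" by blast
      show "supp (\<lambda>v. word_size v = word_size (a # b # w) \<and> word_val v < word_val (a # b # w)) (?r (bas u))"
        using less_val_merge_split[OF 3 u(1), of w] by (simp add: u(2) less_val_def)
    qed (simp add: ac_simps)
    moreover have "less_val (a # b # w) (cons a (bas (b # w) + d_words (merge_word (b # w))
        + merge_words (d_word (b # w))))"
      using 1 3 by (intro less_val_cons) simp
    moreover have "bas (a # b # w) + d_words (merge_word (a # b # w)) + merge_words (d_word (a # b # w))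
      = cons a (bas (b # w) + d_words (merge_word (b # w)) + merge_words (d_word (b # w)))
        + ?r (cons_split b (bas w))"
      using 3 by (simp add: d_words_cons merge_words_cons_ascent ac_simps)
    ultimately show ?thesis
      by (metis less_val_add)
  qed
next
  case (2 a)
  then show ?case
    by (cases a) (auto simp: generator_def cons_split_def
          intro!: less_val_add less_val_split_merge)
qed simp


subsection \<open>Comparison with the polynomial ring\<close>

fun v_letter :: "letter \<Rightarrow> (mono \<Rightarrow>\<^sub>0 bit)" where
  "v_letter L0 = bas (Poly_Mapping.single 0 1)"
| "v_letter L1 = bas (Poly_Mapping.single 1 1)"
| "v_letter L2 = bas (Poly_Mapping.single 2 1)"
| "v_letter _ = 0"

fun v_word :: "word \<Rightarrow> (mono \<Rightarrow>\<^sub>0 bit)" where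
  "v_word [] = 1"
| "v_word (a # w) = v_letter a * v_word w"

definition v_words :: "(word \<Rightarrow>\<^sub>0 bit) \<Rightarrow> (mono \<Rightarrow>\<^sub>0 bit)" where
  "v_words = lin v_word"

lemma v_words_add [simp]: "v_words (x + y) = v_words x + v_words y"
  by (simp add: v_words_def)

lemma v_words_zero [simp]: "v_words 0 = 0"
  by (simp add: v_words_def)

lemma v_words_bas [simp]: "v_words (bas w) = v_word w"
  by (simp add: v_words_def)

lemma v_words_cons: "v_words (cons a x) = v_letter a * v_words x"
  by (rule additive_eqI_all[where F = "\<lambda>x. v_words (cons a x)" and x = x])
    (simp_all add: distrib_left)

text \<open>
  The two splits of a product of two generators have the same image since the \<open>v\<close>s commute; every split
  of a product of three has a part that is not a generator.
\<close>

lemma v_words_cons_split: "v_words (cons_split a x) = 0"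
  by (cases a) (simp_all add: cons_split_def v_words_cons ac_simps)

lemma v_words_d_words: "v_words (d_words x) = 0"
proof -
  have "v_words (d_word w) = 0" for w
    by (induction w) (simp_all add: v_words_cons v_words_cons_split)
  then show ?thesis
    by (intro additive_eqI_all[where F = "\<lambda>x. v_words (d_words x)" and G = "\<lambda>_. 0" and x = x]) simp_all
qed

lemma critical_cases:
  assumes "critical w"
  obtains i j k where "w = replicate i L0 @ replicate j L1 @ replicate k L2"
proof -
  from assms have "\<exists>i j k. w = replicate i L0 @ replicate j L1 @ replicate k L2"
  proof (induction w rule: critical.induct)
    case (1 a b w)
    then obtain i j k where w: "b # w = replicate i L0 @ replicate j L1 @ replicate k L2" by auto
    from 1(2) consider "a = L0" | "a = L1" "greatest b \<ge> 1" | "a = L2" "greatest b \<ge> 2"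
      by (auto simp: generator_def)
    then show ?case
    proof cases
      case 1
      then have "a # b # w = replicate (Suc i) L0 @ replicate j L1 @ replicate k L2" using w by simp
      then show ?thesis by blast
    next
      case 2
      then have "i = 0" using w by (cases i) auto
      with 2 w have "a # b # w = replicate 0 L0 @ replicate (Suc j) L1 @ replicate k L2" by simp
      then show ?thesis by blast
    next
      case 3
      then have "i = 0" using w by (cases i) auto
      moreover have "j = 0" using 3 w \<open>i = 0\<close> by (cases j) auto
      ultimately have "a # b # w = replicate 0 L0 @ replicate 0 L1 @ replicate (Suc k) L2"
        using 3 w by simp
      then show ?thesis by blast
    qed
  next
    case (2 a)
    then consider "a = L0" | "a = L1" | "a = L2" by (auto simp: generator_def)
    then show ?case
    proof cases
      case 1
      then have "[a] = replicate 1 L0 @ replicate 0 L1 @ replicate 0 L2" by simp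
      then show ?thesis by blast
    next
      case 2
      then have "[a] = replicate 0 L0 @ replicate 1 L1 @ replicate 0 L2" by simp
      then show ?thesis by blast
    next
      case 3
      then have "[a] = replicate 0 L0 @ replicate 0 L1 @ replicate 1 L2" by simp
      then show ?thesis by blast
    qed
  qed auto
  then show thesis using that by blast
qed

lemma v_word_append: "v_word (u @ w) = v_word u * v_word w"
  by (induction u) (simp_all add: ac_simps)

lemma v_word_replicate:
  "v_letter a = bas (Poly_Mapping.single i 1) \<Longrightarrow>
     v_word (replicate n a) = bas (Poly_Mapping.single i n)"
  by (induction n) (simp_all add: mult_single flip: single_add)

definition letter_counts :: "word \<Rightarrow> mono" where
  "letter_counts w = Poly_Mapping.single 0 (count_list w L0)
     + Poly_Mapping.single 1 (count_list w L1) + Poly_Mapping.single 2 (count_list w L2)"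

lemma count_list_replicate: "count_list (replicate n a) b = (if a = b then n else 0)"
  by (induction n) auto

lemma v_word_critical:
  assumes "critical w"
  shows "v_word w = bas (letter_counts w)"
  using assms
  by (elim critical_cases)
    (simp add: v_word_append v_word_replicate[of _ 0] v_word_replicate[of _ 1]
      v_word_replicate[of _ 2] mult_single letter_counts_def count_list_replicate ac_simps)

text \<open>
  A nondecreasing word is determined by the number of its letters of each kind.
\<close>

lemma inj_on_letter_counts: "inj_on letter_counts {w. critical w}"
proof (rule inj_onI, clarify)
  fix u w assume *: "critical u" "critical w" "letter_counts u = letter_counts w"
  have "Poly_Mapping.lookup (letter_counts x) 0 = count_list x L0"
    "Poly_Mapping.lookup (letter_counts x) 1 = count_list x L1"
    "Poly_Mapping.lookup (letter_counts x) 2 = count_list x L2" for x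
    by (simp_all add: letter_counts_def lookup_add lookup_single)
  with *(3) have "count_list u L0 = count_list w L0" "count_list u L1 = count_list w L1"
    "count_list u L2 = count_list w L2" by metis+
  with *(1,2) show "u = w"
    by (elim critical_cases) (simp add: count_list_replicate)
qed

lemma lin_inj_eq_zero:
  assumes "inj_on g A" "supp (\<lambda>a. a \<in> A) x" "lin (\<lambda>a. bas (g a)) x = 0"
  shows "x = 0"
proof (rule poly_mapping_eqI)
  fix a
  show "Poly_Mapping.lookup x a = Poly_Mapping.lookup 0 a"
  proof (cases "a \<in> Poly_Mapping.keys x")
    case True
    have "(0::bit) = Poly_Mapping.lookup (lin (\<lambda>a. bas (g a)) x) (g a)"
      by (simp add: assms(3))
    also have "\<dots> = (\<Sum>b\<in>Poly_Mapping.keys x. if b = a then 1 else 0)"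
      unfolding lin_def lookup_sum using True assms(1,2)
      by (intro sum.cong) (auto simp: lookup_single when_def supp_def inj_on_def)
    also have "\<dots> = 1" using True by simp
    finally show ?thesis by simp
  qed (simp add: in_keys_iff)
qed

lemma critical_v_words_eq_zero:
  assumes "supp critical x" "v_words x = 0"
  shows "x = 0"
proof (rule lin_inj_eq_zero[OF inj_on_letter_counts])
  have "v_words x = lin (\<lambda>w. bas (letter_counts w)) x"
    unfolding v_words_def using assms(1)
    by (intro lin_cong) (auto simp: supp_def v_word_critical)
  then show "lin (\<lambda>w. bas (letter_counts w)) x = 0" using assms(2) by simp
qed (use assms in \<open>simp add: supp_def\<close>)

lemma v_words_merge_words: "v_words (merge_words x) = 0"
proof -
  have "v_letter (merge a b) = 0" for a b by (cases a; cases b) simp_all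
  then have "v_words (merge_word w) = 0" for w
    by (induction w rule: merge_word.induct) (simp_all add: v_words_cons)
  then show ?thesis
    by (intro additive_eqI_all[where F = "\<lambda>x. v_words (merge_words x)" and G = "\<lambda>_. 0" and x = x])
      simp_all
qed

text \<open>
  Iterating \<open>1 + d h + h d\<close>, where \<open>h\<close> merges, moves a cocycle within its class to one that is
  supported on critical words, where the map to the polynomial ring is injective. That the primitive
  \<open>z\<close> lies in the kernel again is needed to control the perturbation by the coaction.
\<close>

lemma v_words_kernel_acyclic:
  assumes "d_words x = 0" "v_words x = 0"
  obtains z where "x = d_words z" "v_words z = 0"
proof -
  have "\<exists>z. x = d_words z \<and> v_words z = 0"
    if "supp (\<lambda>w. \<not> critical w \<longrightarrow> word_val w < n) x" "d_words x = 0" "v_words x = 0" for n x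
    using that
  proof (induction n arbitrary: x)
    case 0
    then have "x = 0" by (intro critical_v_words_eq_zero) (auto elim: supp_mono)
    then have "x = d_words 0 \<and> v_words 0 = 0" by simp
    then show ?case by blast
  next
    case (Suc n)
    let ?h = "\<lambda>x. x + d_words (merge_words x) + merge_words (d_words x)"
    have "supp (\<lambda>w. \<not> critical w \<longrightarrow> word_val w < n) (?h x)"
    proof (rule supp_additive[where F = ?h, OF _ Suc.prems(1)])
      fix w assume w: "\<not> critical w \<longrightarrow> word_val w < Suc n"
      show "supp (\<lambda>w. \<not> critical w \<longrightarrow> word_val w < n) (?h (bas w))"
      proof (cases "critical w")
        case True
        then show ?thesis by (simp add: critical_merge critical_d_word)
      next
        case False
        from critical_or_less_val[OF False] False w show ?thesis
          by (auto simp: less_val_def elim: supp_mono)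
      qed
    qed (simp add: ac_simps)
    then have "supp (\<lambda>w. \<not> critical w \<longrightarrow> word_val w < n) (x + d_words (merge_words x))"
      using Suc.prems by simp
    then have "\<exists>z. x + d_words (merge_words x) = d_words z \<and> v_words z = 0"
      using Suc.prems by (intro Suc.IH) (simp_all add: d_words_d_words v_words_d_words)
    then obtain z where z: "x + d_words (merge_words x) = d_words z" "v_words z = 0" by blast
    then have "x = d_words (z + merge_words x)"
      by (metis add.commute d_words_add f2_add_cancel)
    moreover have "v_words (z + merge_words x) = 0"
      using z(2) by (simp add: v_words_merge_words)
    ultimately show ?case by blast
  qed
  moreover obtain n where "supp (\<lambda>w. \<not> critical w \<longrightarrow> word_val w < n) x"
  proof
    show "supp (\<lambda>w. \<not> critical w \<longrightarrow> word_val w < Suc (\<Sum>w\<in>Poly_Mapping.keys x. word_val w)) x"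
      by (auto simp: supp_def less_Suc_eq_le intro!: member_le_sum)
  qed
  ultimately show thesis using assms that by blast
qed

section \<open>The Milnor primitives\<close>

text \<open>
  The index \<open>k\<close> stands for \<open>\<zeta>\<^bsub>k+1\<^esub>\<close>, so these are the exterior generators \<open>\<zeta>\<^sub>n\<close>, \<open>n \<ge> 4\<close>, that occur in
  \<open>m\<close>, and their number is the exterior degree. Up to the passage to the cobar complex of
  \<open>(A//E(2))\<^sub>*\<close>, coefficients are arbitrary monomials: the parities of the exponents of \<open>\<zeta>\<^sub>1, \<zeta>\<^sub>2, \<zeta>\<^sub>3\<close> are
  invariant under all operators, so the condition on them can be imposed at the end.
\<close>

definition odds :: "mono \<Rightarrow> nat set" where
  "odds m = {k. 3 \<le> k \<and> odd (Poly_Mapping.lookup m k)}"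

text \<open>
  Replaces one factor \<open>\<zeta>\<^sub>n\<close> by \<open>Q\<^sub>i \<zeta>\<^sub>n\<close>, for \<open>n = k + 1\<close>.
\<close>

definition lower :: "nat \<Rightarrow> nat \<Rightarrow> mono \<Rightarrow> mono" where
  "lower i k m = m - Poly_Mapping.single k 1 + Poly_Mapping.single (k - Suc i) (2 ^ Suc i)"

definition Q :: "nat \<Rightarrow> mono \<Rightarrow> dual_steenrod" where
  "Q i m = (\<Sum>k\<in>odds m. bas (lower i k m))"

definition exponent_sum :: "mono \<Rightarrow> nat" where
  "exponent_sum m = (\<Sum>k\<in>Poly_Mapping.keys m. Poly_Mapping.lookup m k)"

lemma finite_odds [simp]: "finite (odds m)"
  by (rule finite_subset[of _ "Poly_Mapping.keys m"]) (auto simp: odds_def in_keys_iff intro!: Nat.gr0I)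

lemma lookup_lower: "Poly_Mapping.lookup (lower i k m) l =
    Poly_Mapping.lookup m l - (if l = k then 1 else 0) + (if l = k - Suc i then 2 ^ Suc i else 0)"
  by (simp add: lower_def lookup_add lookup_minus lookup_single when_def)

lemma odds_lower: "i < 3 \<Longrightarrow> k \<in> odds m \<Longrightarrow> odds (lower i k m) = odds m - {k}"
  by (auto simp: odds_def lookup_lower)

lemma lower_commute:
  assumes "i < 3" "j < 3" "k \<in> odds m" "l \<in> odds m" "k \<noteq> l"
  shows "lower i k (lower j l m) = lower j l (lower i k m)"
proof (rule poly_mapping_eqI)
  fix x
  have "Poly_Mapping.lookup m k \<noteq> 0" "Poly_Mapping.lookup m l \<noteq> 0" "3 \<le> k" "3 \<le> l"
    using assms by (auto simp: odds_def intro!: Nat.gr0I)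
  then show "Poly_Mapping.lookup (lower i k (lower j l m)) x
      = Poly_Mapping.lookup (lower j l (lower i k m)) x"
    using assms(1,2,5) by (auto simp: lookup_lower)
qed

lemma exponent_sum_superset:
  "finite S \<Longrightarrow> Poly_Mapping.keys m \<subseteq> S \<Longrightarrow> exponent_sum m = (\<Sum>k\<in>S. Poly_Mapping.lookup m k)"
  unfolding exponent_sum_def by (rule sum.mono_neutral_left) (auto simp: in_keys_iff)

lemma exponent_sum_add [simp]: "exponent_sum (m + n) = exponent_sum m + exponent_sum n"
proof -
  let ?S = "Poly_Mapping.keys m \<union> Poly_Mapping.keys n"
  have "Poly_Mapping.keys (m + n) \<subseteq> ?S" by (rule keys_add)
  then show ?thesis
    by (simp add: exponent_sum_superset[of ?S] lookup_add sum.distrib)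
qed

lemma exponent_sum_single [simp]: "exponent_sum (Poly_Mapping.single k n) = n"
  by (simp add: exponent_sum_def)

lemma minus_single_add:
  "n \<le> Poly_Mapping.lookup m k \<Longrightarrow> (m :: mono) - Poly_Mapping.single k n + Poly_Mapping.single k n = m"
  by (rule poly_mapping_eqI) (auto simp: lookup_add lookup_minus lookup_single when_def)

lemma exponent_sum_minus_single:
  "n \<le> Poly_Mapping.lookup m k \<Longrightarrow> exponent_sum (m - Poly_Mapping.single k n) + n = exponent_sum m"
  by (metis minus_single_add exponent_sum_add exponent_sum_single)

lemma exponent_sum_lower:
  "k \<in> odds m \<Longrightarrow> exponent_sum (lower i k m) + 1 = exponent_sum m + 2 ^ Suc i"
  using exponent_sum_minus_single[of 1 m k] odd_pos[of "Poly_Mapping.lookup m k"]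
  by (simp add: lower_def odds_def)

text \<open>
  The terms for \<open>(k, l)\<close> and \<open>(l, k)\<close> cancel in characteristic 2. This gives both \<open>Q\<^sub>i Q\<^sub>i = 0\<close> and
  \<open>d d = 0\<close> in the Koszul complex.
\<close>

lemma sum_symmetric_zero:
  fixes f :: "'a \<Rightarrow> 'a \<Rightarrow> ('b \<Rightarrow>\<^sub>0 bit)"
  assumes "finite S" "\<And>k l. k \<in> S \<Longrightarrow> l \<in> S \<Longrightarrow> f k l = f l k" "\<And>k. k \<in> S \<Longrightarrow> f k k = 0"
  shows "(\<Sum>k\<in>S. \<Sum>l\<in>S. f k l) = 0"
  using assms
proof (induction S rule: finite_induct)
  case (insert a S)
  have "(\<Sum>l\<in>S. f l a) = (\<Sum>l\<in>S. f a l)" using insert by (intro sum.cong) auto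
  with insert show ?case by (simp add: sum.distrib ac_simps)
qed simp

lemma lin_Q_Q:
  assumes "i < 3" "j < 3"
  shows "lin (Q i) (Q j m) = (\<Sum>k\<in>odds m. \<Sum>l\<in>odds m. if l = k then 0 else bas (lower i l (lower j k m)))"
proof -
  have "(\<Sum>l\<in>odds m - {k}. bas (lower i l (lower j k m)))
      = (\<Sum>l\<in>odds m. if l = k then 0 else bas (lower i l (lower j k m)))" for k
    by (rule sum.mono_neutral_cong_left) auto
  with assms show ?thesis
    unfolding Q_def by (subst lin_sum) (auto simp: odds_lower Q_def intro!: sum.cong)
qed

lemma Q_commute:
  assumes "i < 3" "j < 3"
  shows "lin (Q i) (Q j m) = lin (Q j) (Q i m)"
  unfolding lin_Q_Q[OF assms] lin_Q_Q[OF assms(2,1)]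
  by (subst sum.swap) (auto intro!: sum.cong simp: lower_commute[OF assms])

lemma Q_Q: "i < 3 \<Longrightarrow> lin (Q i) (Q i m) = 0"
  unfolding lin_Q_Q by (rule sum_symmetric_zero) (auto simp: lower_commute)

lemma supp_Q: "i < 3 \<Longrightarrow> supp (\<lambda>n. Suc (card (odds n)) = card (odds m) \<and>
    exponent_sum n + 1 = exponent_sum m + 2 ^ Suc i) (Q i m)"
  unfolding Q_def
  by (rule supp_sum) (use exponent_sum_lower[of _ m i] in \<open>auto simp: odds_lower card_Suc_Diff1 simp del: card_Diff_insert card_Diff_singleton\<close>)

lemma Q_no_odds: "odds m = {} \<Longrightarrow> Q i m = 0"
  by (simp add: Q_def)

subsection \<open>A contracting homotopy\<close>

text \<open>
  The Koszul complex for \<open>Q\<^sub>i\<close> is a tensor product over \<open>k\<close>, with factor generated by \<open>\<zeta>\<^bsub>k+1\<^esub>\<close> over the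
  polynomials in the square of \<open>\<zeta>\<^bsub>k-i\<^esub>\<close>. A monomial is active at \<open>k\<close> if its component there is not
  in the homology of that factor.
\<close>

definition active :: "nat \<Rightarrow> mono \<Rightarrow> nat \<Rightarrow> bool" where
  "active i m k \<longleftrightarrow> 3 \<le> k \<and>
     (odd (Poly_Mapping.lookup m k) \<or> 2 ^ Suc i \<le> Poly_Mapping.lookup m (k - Suc i))"

definition first_active :: "nat \<Rightarrow> mono \<Rightarrow> nat \<Rightarrow> bool" where
  "first_active i m k \<longleftrightarrow> active i m k \<and> (\<forall>l<k. \<not> active i m l)"

definition upper :: "nat \<Rightarrow> nat \<Rightarrow> mono \<Rightarrow> mono" where
  "upper i k m = m - Poly_Mapping.single (k - Suc i) (2 ^ Suc i) + Poly_Mapping.single k 1"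

text \<open>
  Undo \<open>Q\<^sub>i\<close> in the first factor in which the monomial is active. If the exterior generator is already
  present there, the value is 0.
\<close>

definition homotopy :: "nat \<Rightarrow> mono \<Rightarrow> dual_steenrod" where
  "homotopy i m = (if \<exists>k. active i m k \<and> even (Poly_Mapping.lookup m (LEAST k. active i m k))
     then bas (upper i (LEAST k. active i m k) m) else 0)"

lemma homotopy_eq:
  assumes "first_active i m k"
  shows "homotopy i m = (if odd (Poly_Mapping.lookup m k) then 0 else bas (upper i k m))"
proof -
  have "(LEAST k. active i m k) = k"
    using assms unfolding first_active_def by (intro Least_equality) (auto intro: leI)
  then show ?thesis using assms by (auto simp: homotopy_def first_active_def)
qed

lemma lookup_upper: "Poly_Mapping.lookup (upper i k m) l =
    Poly_Mapping.lookup m l - (if l = k - Suc i then 2 ^ Suc i else 0) + (if l = k then 1 else 0)"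
  by (simp add: upper_def lookup_add lookup_minus lookup_single when_def)

lemma first_active_exists:
  assumes "active i m k"
  obtains l where "first_active i m l"
proof
  show "first_active i m (LEAST l. active i m l)"
    using LeastI[of "active i m", OF assms] not_less_Least[of _ "active i m"]
    unfolding first_active_def by blast
qed

text \<open>
  \<open>Q\<^sub>i\<close> acts within one tensor factor, and an odd exponent makes its own factor active, so the first
  active factor stays the same.
\<close>

lemma first_active_lower:
  assumes "i < 3" "first_active i m k" "l \<in> odds m"
  shows "first_active i (lower i l m) k"
proof -
  have l: "active i m l" "3 \<le> l" using assms(3) by (auto simp: odds_def active_def)
  then have "k \<le> l" using assms(2) by (auto simp: first_active_def not_less[symmetric])
  have "active i (lower i l m) k"
    using assms \<open>k \<le> l\<close> l(2) by (auto simp: first_active_def active_def lookup_lower)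
  moreover have "\<not> active i (lower i l m) j" if "j < k" for j
  proof -
    have "\<not> active i m j" using assms(2) that by (simp add: first_active_def)
    moreover have "j - Suc i \<noteq> l - Suc i" "j \<noteq> l" "j - Suc i \<noteq> l" if "3 \<le> j"
      using that \<open>j < k\<close> \<open>k \<le> l\<close> assms(1) by auto
    ultimately show ?thesis by (auto simp: active_def lookup_lower)
  qed
  ultimately show ?thesis by (simp add: first_active_def)
qed

lemma odds_upper:
  assumes "i < 3" "3 \<le> k" "even (Poly_Mapping.lookup m k)" "2 ^ Suc i \<le> Poly_Mapping.lookup m (k - Suc i)"
  shows "odds (upper i k m) = insert k (odds m)"
  using assms by (auto simp: odds_def lookup_upper split: if_splits)

lemma lower_upper:
  assumes "i < 3" "3 \<le> k" "2 ^ Suc i \<le> Poly_Mapping.lookup m (k - Suc i)"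
  shows "lower i k (upper i k m) = m"
  by (rule poly_mapping_eqI) (use assms in \<open>auto simp: lookup_lower lookup_upper\<close>)

lemma upper_lower:
  assumes "i < 3" "k \<in> odds m"
  shows "upper i k (lower i k m) = m"
proof (rule poly_mapping_eqI)
  fix l
  have "Poly_Mapping.lookup m k \<noteq> 0" "3 \<le> k"
    using assms by (auto simp: odds_def intro!: Nat.gr0I)
  then show "Poly_Mapping.lookup (upper i k (lower i k m)) l = Poly_Mapping.lookup m l"
    using assms(1) by (auto simp: lookup_lower lookup_upper)
qed

lemma upper_lower_commute:
  assumes "i < 3" "3 \<le> k" "l \<in> odds m" "l \<noteq> k" "2 ^ Suc i \<le> Poly_Mapping.lookup m (k - Suc i)" "k < l"
  shows "upper i k (lower i l m) = lower i l (upper i k m)"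
proof (rule poly_mapping_eqI)
  fix x
  have "Poly_Mapping.lookup m l \<noteq> 0" "3 \<le> l"
    using assms by (auto simp: odds_def intro!: Nat.gr0I)
  then show "Poly_Mapping.lookup (upper i k (lower i l m)) x = Poly_Mapping.lookup (lower i l (upper i k m)) x"
    using assms by (auto simp: lookup_lower lookup_upper)
qed

text \<open>
  The terms of \<open>Q\<^sub>i\<close> in the factors after the first active one commute with the homotopy and cancel; in
  that factor the homotopy is a contraction.
\<close>

lemma homotopy_Q:
  assumes i: "i < 3" and "odds m \<noteq> {}"
  shows "lin (Q i) (homotopy i m) + lin (homotopy i) (Q i m) = bas m"
proof -
  obtain k where k: "first_active i m k"
    using assms(2) first_active_exists[of i m] by (auto simp: odds_def active_def)
  then have "3 \<le> k" by (simp add: first_active_def active_def)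
  have hQ: "lin (homotopy i) (Q i m) = (\<Sum>l\<in>odds m. homotopy i (lower i l m))"
    by (simp add: Q_def lin_sum)
  have odds_ge: "k \<le> l" if "l \<in> odds m" for l
    using that k by (auto simp: first_active_def active_def odds_def not_less[symmetric])
  show ?thesis
  proof (cases "odd (Poly_Mapping.lookup m k)")
    case True
    have "homotopy i (lower i l m) = (if l = k then bas m else 0)" if "l \<in> odds m" for l
      using homotopy_eq[OF first_active_lower[OF i k that]] upper_lower[OF i that] True i \<open>3 \<le> k\<close>
      by (auto simp: lookup_lower)
    then have "lin (homotopy i) (Q i m) = (\<Sum>l\<in>odds m. if l = k then bas m else 0)"
      unfolding hQ by (intro sum.cong) auto
    also have "\<dots> = bas m"
      using True \<open>3 \<le> k\<close> by (simp add: odds_def[of m, THEN eqset_imp_iff])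
    finally have "lin (homotopy i) (Q i m) = bas m" .
    with True show ?thesis by (simp add: homotopy_eq[OF k])
  next
    case False
    then have le: "2 ^ Suc i \<le> Poly_Mapping.lookup m (k - Suc i)"
      using k by (simp add: first_active_def active_def)
    have "k \<notin> odds m" using False by (simp add: odds_def)
    have "homotopy i (lower i l m) = bas (lower i l (upper i k m))" if "l \<in> odds m" for l
    proof -
      have "k < l" using odds_ge[OF that] that \<open>k \<notin> odds m\<close> by (cases "k = l") auto
      then show ?thesis
        using homotopy_eq[OF first_active_lower[OF i k that]] False that i \<open>3 \<le> k\<close> le
        by (simp add: lookup_lower upper_lower_commute)
    qed
    then have "lin (homotopy i) (Q i m) = (\<Sum>l\<in>odds m. bas (lower i l (upper i k m)))"
      unfolding hQ by (intro sum.cong) auto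
    moreover have "lin (Q i) (homotopy i m) = bas m + (\<Sum>l\<in>odds m. bas (lower i l (upper i k m)))"
      using False \<open>k \<notin> odds m\<close>
      by (simp add: homotopy_eq[OF k] Q_def odds_upper[OF i \<open>3 \<le> k\<close> _ le] lower_upper[OF i \<open>3 \<le> k\<close> le])
    ultimately show ?thesis by (simp add: ac_simps)
  qed
qed

lemma supp_homotopy:
  assumes "i < 3"
  shows "supp (\<lambda>n. card (odds n) = Suc (card (odds m)) \<and>
    exponent_sum n + 2 ^ Suc i = exponent_sum m + 1) (homotopy i m)"
proof (cases "\<exists>k. active i m k")
  case True
  then obtain k where k: "first_active i m k" using first_active_exists by blast
  show ?thesis
  proof (cases "odd (Poly_Mapping.lookup m k)")
    case False
    with k have *: "3 \<le> k" "2 ^ Suc i \<le> Poly_Mapping.lookup m (k - Suc i)"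
      by (simp_all add: first_active_def active_def)
    have "k \<notin> odds m" using False by (simp add: odds_def)
    with * False assms exponent_sum_minus_single[OF *(2)] show ?thesis
      by (simp add: homotopy_eq[OF k] odds_upper upper_def[THEN arg_cong, of exponent_sum])
  qed (simp add: homotopy_eq[OF k])
qed (simp add: homotopy_def)

section \<open>The Koszul complex\<close>

text \<open>
  \<open>(e, m)\<close> stands for \<open>v\<^sup>e m\<close>. All variables \<open>v\<^sub>i\<close> are present in the type, and \<open>d_koszul r\<close> uses the first
  \<open>r\<close> of them.
\<close>

type_synonym koszul = "mono \<times> mono \<Rightarrow>\<^sub>0 bit"

definition on_coeff :: "(mono \<Rightarrow> dual_steenrod) \<Rightarrow> koszul \<Rightarrow> koszul" where
  "on_coeff F = lin (\<lambda>(e, m). lin (\<lambda>n. bas (e, n)) (F m))"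

definition times_v :: "nat \<Rightarrow> koszul \<Rightarrow> koszul" where
  "times_v i = lin (\<lambda>(e, m). bas (e + Poly_Mapping.single i 1, m))"

definition d_koszul :: "nat \<Rightarrow> koszul \<Rightarrow> koszul" where
  "d_koszul r x = (\<Sum>i<r. times_v i (on_coeff (Q i) x))"

lemma on_coeff_add [simp]: "on_coeff F (x + y) = on_coeff F x + on_coeff F y"
  by (simp add: on_coeff_def)

lemma on_coeff_zero [simp]: "on_coeff F 0 = 0"
  by (simp add: on_coeff_def)

lemma on_coeff_bas: "on_coeff F (bas (e, m)) = lin (\<lambda>n. bas (e, n)) (F m)"
  by (simp add: on_coeff_def)

lemma times_v_add [simp]: "times_v i (x + y) = times_v i x + times_v i y"
  by (simp add: times_v_def)

lemma times_v_zero [simp]: "times_v i 0 = 0"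
  by (simp add: times_v_def)

lemma times_v_bas [simp]: "times_v i (bas (e, m)) = bas (e + Poly_Mapping.single i 1, m)"
  by (simp add: times_v_def)

lemma d_koszul_add [simp]: "d_koszul r (x + y) = d_koszul r x + d_koszul r y"
  by (simp add: d_koszul_def sum.distrib)

lemma d_koszul_zero [simp]: "d_koszul r 0 = 0"
  by (simp add: d_koszul_def)

lemma times_v_sum: "times_v i (sum f I) = (\<Sum>j\<in>I. times_v i (f j))"
  by (induction I rule: infinite_finite_induct) simp_all

lemma on_coeff_sum: "on_coeff F (sum f I) = (\<Sum>j\<in>I. on_coeff F (f j))"
  by (induction I rule: infinite_finite_induct) simp_all

lemma d_koszul_Suc: "d_koszul (Suc r) x = d_koszul r x + times_v r (on_coeff (Q r) x)"
  by (simp add: d_koszul_def)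

lemma on_coeff_times_v: "on_coeff F (times_v i x) = times_v i (on_coeff F x)"
proof (rule additive_eqI_all[where F = "\<lambda>x. on_coeff F (times_v i x)" and x = x])
  fix p :: "mono \<times> mono"
  have "times_v i (lin (\<lambda>n. bas (e, n)) y) = lin (\<lambda>n. bas (e + Poly_Mapping.single i 1, n)) y" for e y
    by (subst additive_lin) simp_all
  then show "on_coeff F (times_v i (bas p)) = times_v i (on_coeff F (bas p))"
    by (cases p) (simp add: on_coeff_bas)
qed simp_all

lemma times_v_commute: "times_v i (times_v j x) = times_v j (times_v i x)"
  by (rule additive_eqI_all[where F = "\<lambda>x. times_v i (times_v j x)" and x = x])
    (auto simp: ac_simps)

lemma d_koszul_times_v: "d_koszul r (times_v i x) = times_v i (d_koszul r x)"
  by (simp add: d_koszul_def on_coeff_times_v times_v_sum times_v_commute[of i])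

lemma on_coeff_on_coeff: "on_coeff F (on_coeff G x) = on_coeff (\<lambda>m. lin F (G m)) x"
proof (rule additive_eqI_all[where F = "\<lambda>x. on_coeff F (on_coeff G x)" and x = x])
  fix p :: "mono \<times> mono"
  show "on_coeff F (on_coeff G (bas p)) = on_coeff (\<lambda>m. lin F (G m)) (bas p)"
  proof (cases p)
    case (Pair e m)
    have "on_coeff F (lin (\<lambda>n. bas (e, n)) y) = lin (\<lambda>n. bas (e, n)) (lin F y)" for y
      by (subst additive_lin) (simp_all add: on_coeff_bas lin_lin)
    then show ?thesis by (simp add: Pair on_coeff_bas)
  qed
qed simp_all

lemma on_coeff_plus: "on_coeff F x + on_coeff G x = on_coeff (\<lambda>m. F m + G m) x"
  unfolding on_coeff_def lin_fun_add[symmetric] by (rule lin_cong) auto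

lemma on_coeff_cong_zero: "(\<And>m. F m = 0) \<Longrightarrow> on_coeff F x = 0"
  by (simp add: on_coeff_def case_prod_unfold)

lemma Q_Q_coeff:
  "i < 3 \<Longrightarrow> on_coeff (Q i) (on_coeff (Q i) x) = 0"
  by (simp add: on_coeff_on_coeff Q_Q on_coeff_cong_zero)

lemma Q_commute_coeff:
  "i < 3 \<Longrightarrow> j < 3 \<Longrightarrow> on_coeff (Q i) (on_coeff (Q j) x) = on_coeff (Q j) (on_coeff (Q i) x)"
  by (simp add: on_coeff_on_coeff Q_commute)

lemma Q_d_koszul:
  assumes "i < 3" "r \<le> 3"
  shows "on_coeff (Q i) (d_koszul r x) = d_koszul r (on_coeff (Q i) x)"
  unfolding d_koszul_def on_coeff_sum on_coeff_times_v
  by (rule sum.cong) (use assms in \<open>simp_all add: Q_commute_coeff\<close>)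

lemma d_koszul_d_koszul:
  assumes "r \<le> 3"
  shows "d_koszul r (d_koszul r x) = 0"
proof -
  have "d_koszul r (d_koszul r x) = (\<Sum>i<r. \<Sum>j<r. times_v i (times_v j (on_coeff (Q i) (on_coeff (Q j) x))))"
    unfolding d_koszul_def on_coeff_sum times_v_sum on_coeff_times_v ..
  also have "\<dots> = 0"
    by (rule sum_symmetric_zero)
      (use assms in \<open>simp_all add: Q_Q_coeff Q_commute_coeff times_v_commute\<close>)
  finally show ?thesis .
qed

lemma supp_on_coeff:
  assumes "supp (\<lambda>(e, m). P e m) x" "\<And>e m. P e m \<Longrightarrow> supp (R e) (F m)"
  shows "supp (\<lambda>(e, m). R e m) (on_coeff F x)"
proof (rule supp_additive[where F = "on_coeff F", OF _ assms(1)])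
  fix p :: "mono \<times> mono" assume p: "case p of (e, m) \<Rightarrow> P e m"
  then show "supp (\<lambda>(e, m). R e m) (on_coeff F (bas p))"
    using assms(2) by (cases p) (auto simp: on_coeff_bas supp_def[of "R _"] intro!: supp_lin)
qed simp

lemma supp_times_v:
  assumes "supp (\<lambda>(e, m). R (e + Poly_Mapping.single i 1) m) x"
  shows "supp (\<lambda>(e, m). R e m) (times_v i x)"
  by (rule supp_additive[where F = "times_v i", OF _ assms]) auto

lemma supp_d_koszul:
  assumes "supp (\<lambda>(e, m). P e m) x" "r \<le> 3"
    and "\<And>i e m n. i < r \<Longrightarrow> P e m \<Longrightarrow> Suc (card (odds n)) = card (odds m) \<Longrightarrow>
      R (e + Poly_Mapping.single i 1) n"
  shows "supp (\<lambda>(e, m). R e m) (d_koszul r x)"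
  unfolding d_koszul_def
proof (rule supp_sum)
  fix i assume i: "i \<in> {..<r}"
  show "supp (\<lambda>(e, m). R e m) (times_v i (on_coeff (Q i) x))"
    by (rule supp_times_v, rule supp_on_coeff[OF assms(1)], rule supp_mono[OF supp_Q])
      (use assms(2,3) i in auto)
qed

lemma times_v_inj:
  assumes "times_v i x = 0"
  shows "x = 0"
proof (rule lin_inj_eq_zero)
  have "lin (\<lambda>p. bas ((\<lambda>(e, m). (e + Poly_Mapping.single i 1, m)) p)) x = times_v i x"
    unfolding times_v_def by (rule lin_cong) auto
  then show "lin (\<lambda>p. bas ((\<lambda>(e, m). (e + Poly_Mapping.single i 1, m)) p)) x = 0"
    using assms by simp
  show "inj_on (\<lambda>(e, m). (e + Poly_Mapping.single i 1, m)) (UNIV :: (mono \<times> mono) set)"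
    by (auto simp: inj_on_def)
qed (simp add: supp_def)

lemma divide_v:
  assumes "supp (\<lambda>(e, m). Poly_Mapping.lookup e i \<noteq> 0) x"
  obtains y where "x = times_v i y"
proof
  let ?f = "\<lambda>(e, m). bas (e - Poly_Mapping.single i 1, m)"
  show "x = times_v i (lin ?f x)"
  proof (rule additive_eqI[where F = "\<lambda>x. x" and G = "\<lambda>x. times_v i (lin ?f x)", OF _ _ assms])
    fix p :: "mono \<times> mono" assume "case p of (e, m) \<Rightarrow> Poly_Mapping.lookup e i \<noteq> 0"
    then show "bas p = times_v i (lin ?f (bas p))"
      by (cases p) (simp add: minus_single_add)
  qed simp_all
qed

subsection \<open>Inverting a generator kills positive exterior degree\<close>

lemma homotopy_coeff:
  assumes "i < 3" "supp (\<lambda>(e, m). odds m \<noteq> {}) x"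
  shows "on_coeff (Q i) (on_coeff (homotopy i) x) + on_coeff (homotopy i) (on_coeff (Q i) x) = x"
  unfolding on_coeff_on_coeff on_coeff_plus
proof (rule additive_eqI[where F = "on_coeff _" and G = "\<lambda>x. x", OF _ _ assms(2)])
  fix p :: "mono \<times> mono" assume "case p of (e, m) \<Rightarrow> odds m \<noteq> {}"
  then show "on_coeff (\<lambda>m. lin (Q i) (homotopy i m) + lin (homotopy i) (Q i m)) (bas p) = bas p"
    by (cases p) (simp add: on_coeff_bas homotopy_Q assms(1))
qed simp_all

lemma supp_on_Q:
  assumes "i < 3" "supp (\<lambda>(e, m). P e (card (odds m)) (exponent_sum m)) x"
    and "\<And>e c n t. P e (Suc c) t \<Longrightarrow> n + 1 = t + 2 ^ Suc i \<Longrightarrow> R e c n"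
  shows "supp (\<lambda>(e, m). R e (card (odds m)) (exponent_sum m)) (on_coeff (Q i) x)"
  by (rule supp_on_coeff[OF assms(2)], rule supp_mono[OF supp_Q[OF assms(1)]])
    (use assms(3) in metis)

lemma supp_on_homotopy:
  assumes "i < 3" "supp (\<lambda>(e, m). P e (card (odds m)) (exponent_sum m)) x"
    and "\<And>e c n t. P e c t \<Longrightarrow> n + 2 ^ Suc i = t + 1 \<Longrightarrow> R e (Suc c) n"
  shows "supp (\<lambda>(e, m). R e (card (odds m)) (exponent_sum m)) (on_coeff (homotopy i) x)"
  by (rule supp_on_coeff[OF assms(2)], rule supp_mono[OF supp_homotopy[OF assms(1)]])
    (use assms(3) in auto)

text \<open>
  This is where \<open>j < i\<close> matters: the homotopy for \<open>Q\<^sub>i\<close> removes a power with exponent \<open>2\<^sup>i\<^sup>+\<^sup>1\<close> and \<open>Q\<^sub>j\<close>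
  puts in one with the smaller exponent \<open>2\<^sup>j\<^sup>+\<^sup>1\<close>.
\<close>

lemma homotopy_error:
  assumes "j < i" "i < 3" "supp (\<lambda>(e, m). 0 < card (odds m) \<and> exponent_sum m < Suc n) x"
  shows "supp (\<lambda>(e, m). 0 < card (odds m) \<and> exponent_sum m < n)
    (on_coeff (Q j) (on_coeff (homotopy i) x) + on_coeff (homotopy i) (on_coeff (Q j) x))"
proof (rule supp_add)
  have "(2::nat) ^ Suc j < 2 ^ Suc i" using assms(1) by simp
  then obtain c :: nat where c: "2 ^ Suc i = Suc (2 ^ Suc j + c)"
    using less_imp_Suc_add by blast
  let ?P = "\<lambda>e c t. 0 < c \<and> t < Suc n"
  show "supp (\<lambda>(e, m). 0 < card (odds m) \<and> exponent_sum m < n) (on_coeff (Q j) (on_coeff (homotopy i) x))"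
    by (rule supp_on_Q[where P = "\<lambda>e c t. 1 < c \<and> t + 2 ^ Suc i < Suc (Suc n)"],
        use assms(1,2) in simp, rule supp_on_homotopy[where P = ?P])
      (use assms c in auto)
  show "supp (\<lambda>(e, m). 0 < card (odds m) \<and> exponent_sum m < n) (on_coeff (homotopy i) (on_coeff (Q j) x))"
    by (rule supp_on_homotopy[where P = "\<lambda>e c t. t + 1 < Suc n + 2 ^ Suc j"],
        use assms(1,2) in simp, rule supp_on_Q[where P = ?P])
      (use assms c in auto)
qed

text \<open>
  For the homotopy \<open>h\<close> of \<open>Q\<^sub>r\<close>, the operator \<open>d h + h d\<close> is multiplication by \<open>v\<^sub>r\<close> plus an error
  \<open>N\<close>. On a cocycle \<open>x\<close> it gives a coboundary, so \<open>v\<^sub>r x\<close> is homologous to the cocycle \<open>N x\<close>, which has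
  smaller total exponent.
\<close>

lemma koszul_torsion:
  assumes "r < 3" "supp (\<lambda>(e, m). odds m \<noteq> {}) x" "d_koszul (Suc r) x = 0"
  obtains k y where "(times_v r ^^ k) x = d_koszul (Suc r) y"
proof -
  have "\<exists>k y. (times_v r ^^ k) x = d_koszul (Suc r) y"
    if "supp (\<lambda>(e, m). 0 < card (odds m) \<and> exponent_sum m < n) x" "d_koszul (Suc r) x = 0" for n x
    using that
  proof (induction n arbitrary: x)
    case 0
    then have "x = 0" by (simp add: case_prod_beta supp_False)
    then have "(times_v r ^^ 0) x = d_koszul (Suc r) 0" by simp
    then show ?case by blast
  next
    case (Suc n)
    let ?h = "on_coeff (homotopy r)" and ?d = "d_koszul (Suc r)"
    let ?N = "\<Sum>j<r. times_v j (on_coeff (Q j) (?h x) + ?h (on_coeff (Q j) x))"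
    have "?h (?d x) = (\<Sum>j<Suc r. times_v j (?h (on_coeff (Q j) x)))"
      by (simp only: d_koszul_def on_coeff_sum on_coeff_times_v)
    then have "?d (?h x) + ?h (?d x) = (\<Sum>j<Suc r. times_v j (on_coeff (Q j) (?h x) + ?h (on_coeff (Q j) x)))"
      by (simp only: d_koszul_def sum.distrib times_v_add)
    also have "\<dots> = ?N + times_v r (on_coeff (Q r) (?h x) + ?h (on_coeff (Q r) x))"
      by (rule sum.lessThan_Suc)
    finally have "?d (?h x) = ?N + times_v r (on_coeff (Q r) (?h x) + ?h (on_coeff (Q r) x))"
      by (simp only: Suc.prems(2) on_coeff_zero add_0_right)
    moreover have "on_coeff (Q r) (?h x) + ?h (on_coeff (Q r) x) = x"
      by (rule homotopy_coeff) (use assms(1) Suc.prems(1) in \<open>auto elim: supp_mono\<close>)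
    ultimately have "?d (?h x) = ?N + times_v r x" by (simp only:)
    from f2_eq_swap[OF this] have N: "?N = times_v r x + ?d (?h x)" by (simp only: add.commute)
    have "supp (\<lambda>(e, m). 0 < card (odds m) \<and> exponent_sum m < n) ?N"
      by (intro supp_sum supp_times_v homotopy_error) (use assms(1) Suc.prems(1) in auto)
    moreover have "?d ?N = 0"
      unfolding N using assms(1) Suc.prems(2) by (simp add: d_koszul_d_koszul d_koszul_times_v)
    ultimately obtain k y where "(times_v r ^^ k) ?N = ?d y" using Suc.IH by blast
    moreover have "(times_v r ^^ k) (a + ?d b) = (times_v r ^^ k) a + ?d ((times_v r ^^ k) b)" for a b
      by (induction k) (simp_all add: d_koszul_times_v)
    ultimately have "(times_v r ^^ Suc k) x + ?d ((times_v r ^^ k) (?h x)) = ?d y"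
      unfolding N by (simp add: funpow_swap1)
    from f2_eq_swap[OF this[symmetric]]
    have "(times_v r ^^ Suc k) x = ?d (y + (times_v r ^^ k) (?h x))"
      by (simp only: d_koszul_add)
    then show ?case by blast
  qed
  moreover have "supp (\<lambda>(e, m). 0 < card (odds m) \<and>
      exponent_sum m < Suc (\<Sum>(e, m)\<in>Poly_Mapping.keys x. exponent_sum m)) x"
    unfolding supp_def
  proof (clarify, intro conjI)
    fix e m assume "(e, m) \<in> Poly_Mapping.keys x"
    then show "0 < card (odds m)"
      and "exponent_sum m < Suc (\<Sum>(e, m)\<in>Poly_Mapping.keys x. exponent_sum m)"
      using assms(2) member_le_sum[of "(e, m)" "Poly_Mapping.keys x" "\<lambda>(e, m). exponent_sum m"]
      by (auto simp: supp_def card_gt_0_iff)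
  qed
  ultimately show thesis using assms(3) that by blast
qed

subsection \<open>Adjoining the generators one at a time\<close>

definition positive :: "nat \<Rightarrow> mono \<Rightarrow> bool" where
  "positive r e \<longleftrightarrow> Poly_Mapping.keys e \<subseteq> {..<r} \<and> 0 < exponent_sum e"

definition positive_acyclic :: "nat \<Rightarrow> bool" where
  "positive_acyclic r \<longleftrightarrow> (\<forall>x. supp (\<lambda>(e, m). positive r e \<and> odds m \<noteq> {}) x \<longrightarrow>
     d_koszul r x = 0 \<longrightarrow> (\<exists>y. x = d_koszul r y))"

lemma keys_add_mono: "Poly_Mapping.keys (e + f :: mono) = Poly_Mapping.keys e \<union> Poly_Mapping.keys f"
  by (auto simp: in_keys_iff lookup_add)

text \<open>
  The connecting homomorphism of reduction modulo \<open>v\<^sub>r\<close>, made explicit. The boundary \<open>v\<^sub>r x\<close> of \<open>y\<close> shows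
  that \<open>y\<close> modulo \<open>v\<^sub>r\<close> is a cocycle for the first \<open>r\<close> variables. As \<open>d\<close> lowers the exterior degree
  and raises the filtration, only the part of \<open>y\<close> of positive exterior degree and positive filtration
  counts, and there the cocycle is a boundary by assumption.
\<close>

lemma times_v_cancel:
  assumes r: "r < 3" "positive_acyclic r"
    and x: "supp (\<lambda>(e, m). positive (Suc r) e) x" and y: "times_v r x = d_koszul (Suc r) y"
  obtains z where "x = d_koszul (Suc r) z"
proof -
  let ?d = "d_koszul (Suc r)"
  let ?P = "\<lambda>(e, m :: mono). positive (Suc r) e"
    and ?P' = "\<lambda>(e, m :: mono). Poly_Mapping.keys e \<subseteq> {..<Suc r} \<and> 1 < exponent_sum e"
  have "restr ?P' (?d y) = ?d (restr ?P y)"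
  proof (rule restr_additive[where R = "\<lambda>_. True"])
    fix p :: "mono \<times> mono"
    show "supp ?P' (?d (bas p))" if "?P p"
      by (rule supp_d_koszul[where P = "\<lambda>e m. positive (Suc r) e"])
        (use that r(1) in \<open>auto simp: positive_def keys_add_mono\<close>)
    have "supp (\<lambda>(e, m). \<not> (Poly_Mapping.keys e \<subseteq> {..<Suc r} \<and> 1 < exponent_sum e)) (?d (bas p))"
      if "\<not> ?P p"
      by (rule supp_d_koszul[where P = "\<lambda>e m. \<not> positive (Suc r) e"])
        (use that r(1) in \<open>auto simp: positive_def keys_add_mono\<close>)
    then show "supp (\<lambda>p. \<not> ?P' p) (?d (bas p))" if "\<not> ?P p"
      using that by (simp add: case_prod_unfold)
  qed (simp_all add: supp_def)
  moreover have "supp ?P' (times_v r x)"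
    by (rule supp_times_v, rule supp_mono[OF x]) (auto simp: positive_def keys_add_mono)
  ultimately have d1: "?d (restr ?P y) = times_v r x"
    by (simp only: y[symmetric] restr_ident)
  define y1 where "y1 = restr (\<lambda>(e, m). odds m \<noteq> {}) (restr ?P y)"
  have "?d (restr (\<lambda>p. \<not> (\<lambda>(e, m). odds m \<noteq> {}) p) z) = 0" for z
  proof -
    have "supp (\<lambda>(e, m). False) (?d (restr (\<lambda>p. \<not> (\<lambda>(e, m). odds m \<noteq> {}) p) z))"
      by (rule supp_d_koszul[where P = "\<lambda>e m. odds m = {}"], rule supp_mono[OF supp_restr])
        (use r(1) in auto)
    then show ?thesis by (simp add: case_prod_unfold supp_False)
  qed
  then have y1: "?d y1 = times_v r x"
    unfolding y1_def d1[symmetric]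
    by (subst (2) restr_split[symmetric, where P = "\<lambda>(e, m). odds m \<noteq> {}"])
      (simp only: d_koszul_add add_0_right)
  have y1': "supp (\<lambda>(e, m). positive (Suc r) e \<and> odds m \<noteq> {}) y1"
    unfolding y1_def by (rule supp_mono[OF supp_restr_both[OF supp_restr]]) auto
  \<comment> \<open>\<open>y1 = a + v\<^sub>r y2\<close>, where \<open>a\<close> does not involve \<open>v\<^sub>r\<close>.\<close>
  define a where "a = restr (\<lambda>(e, m). Poly_Mapping.lookup e r = 0) y1"
  have "supp (\<lambda>(e, m). Poly_Mapping.lookup e r \<noteq> 0) (restr (\<lambda>p. \<not> (\<lambda>(e, m). Poly_Mapping.lookup e r = 0) p) y1)"
    using supp_restr by (rule supp_mono) auto
  then obtain y2 where "restr (\<lambda>p. \<not> (\<lambda>(e, m). Poly_Mapping.lookup e r = 0) p) y1 = times_v r y2"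
    by (rule divide_v)
  then have y1_eq: "y1 = a + times_v r y2"
    using restr_split[of "\<lambda>(e, m). Poly_Mapping.lookup e r = 0" y1] by (simp add: a_def)
  have a: "supp (\<lambda>(e, m). positive r e \<and> odds m \<noteq> {}) a"
    using supp_restr_both[OF y1', of "\<lambda>(e, m). Poly_Mapping.lookup e r = 0"] unfolding a_def
  proof (rule supp_mono, clarify)
    fix e m
    assume "Poly_Mapping.lookup e r = 0" "positive (Suc r) e"
    moreover from this have "r \<notin> Poly_Mapping.keys e" by (simp add: in_keys_iff)
    ultimately show "positive r e" by (auto simp: positive_def less_Suc_eq)
  qed
  let ?w = "x + on_coeff (Q r) a + ?d y2"
  have "d_koszul r a + times_v r ?w = ?d y1 + times_v r x"
    by (simp only: y1_eq d_koszul_add d_koszul_Suc[of r a] d_koszul_times_v times_v_add ac_simps)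
  then have eq: "d_koszul r a = times_v r ?w"
    unfolding y1 f2_add_self f2_eq_iff .
  \<comment> \<open>One side does not involve \<open>v\<^sub>r\<close> and the other is a multiple of it, so both vanish.\<close>
  have "supp (\<lambda>(e, m). Poly_Mapping.lookup e r = 0) (d_koszul r a)"
  proof (rule supp_d_koszul[where P = "\<lambda>e m. positive r e"])
    fix i e assume "i < r" "positive r e"
    then show "Poly_Mapping.lookup (e + Poly_Mapping.single i 1) r = 0"
      by (auto simp: positive_def lookup_add lookup_single in_keys_iff subset_iff)
  qed (use a r(1) in \<open>auto elim: supp_mono\<close>)
  moreover have "supp (\<lambda>(e, m). Poly_Mapping.lookup e r \<noteq> 0) (times_v r ?w)"
    by (rule supp_times_v) (simp add: supp_def lookup_add)
  ultimately have "supp (\<lambda>_. False) (d_koszul r a)"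
    unfolding eq by (fastforce simp: supp_def)
  then have "d_koszul r a = 0" by (simp add: supp_False)
  with r(2) a obtain u where u: "a = d_koszul r u"
    unfolding positive_acyclic_def by blast
  have "?w = 0"
    by (rule times_v_inj[of r]) (simp only: eq[symmetric] \<open>d_koszul r a = 0\<close>)
  moreover have "on_coeff (Q r) a = ?d (on_coeff (Q r) u)"
    using r(1) by (simp add: u Q_d_koszul d_koszul_Suc Q_Q_coeff)
  ultimately have "x = ?d (on_coeff (Q r) u + y2)"
    by (simp only: add.assoc f2_eq_iff d_koszul_add)
  then show thesis by (rule that)
qed

text \<open>
  A cocycle of positive filtration and exterior degree is \<open>v\<^sub>r\<close>-power torsion, and the powers of \<open>v\<^sub>r\<close> can
  be cancelled one by one.
\<close>

lemma positive_acyclic: "r \<le> 3 \<Longrightarrow> positive_acyclic r"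
proof (induction r)
  case 0
  have "\<not> positive 0 e" for e by (auto simp: positive_def exponent_sum_def)
  then show ?case by (auto simp: positive_acyclic_def case_prod_unfold supp_False intro: exI[of _ 0])
next
  case (Suc r)
  show ?case
    unfolding positive_acyclic_def
  proof (intro allI impI)
    fix x assume x: "supp (\<lambda>(e, m). positive (Suc r) e \<and> odds m \<noteq> {}) x" "d_koszul (Suc r) x = 0"
    obtain k y where "(times_v r ^^ k) x = d_koszul (Suc r) y"
      by (rule koszul_torsion[of r x]) (use Suc.prems x in \<open>auto elim: supp_mono\<close>)
    then show "\<exists>y. x = d_koszul (Suc r) y"
    proof (induction k arbitrary: y)
      case (Suc k)
      have "supp (\<lambda>(e, m). positive (Suc r) e) ((times_v r ^^ j) x)" for j
      proof (induction j)
        case 0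
        show ?case using x(1) by (auto elim: supp_mono)
      next
        case (Suc j)
        then show ?case
          by (auto intro!: supp_times_v elim!: supp_mono simp: positive_def keys_add_mono)
      qed
      with Suc.prems obtain z where "(times_v r ^^ k) x = d_koszul (Suc r) z"
        using times_v_cancel[of r "(times_v r ^^ k) x" y] \<open>Suc r \<le> 3\<close> \<open>r \<le> 3 \<Longrightarrow> positive_acyclic r\<close>
        by auto
      then show ?case by (rule Suc.IH)
    qed auto
  qed
qed

section \<open>The cobar complex with coefficients\<close>

type_synonym word_cobar = "word \<times> mono \<Rightarrow>\<^sub>0 bit"

text \<open>
  The letter with factors \<open>\<zeta>\<^bsub>i+1\<^esub>\<close> acts by the product of the \<open>Q\<^sub>i\<close>; the coaction of \<open>x\<close> is the sum of
  \<open>a \<otimes> a x\<close> over all letters \<open>a\<close>.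
\<close>

fun act :: "letter \<Rightarrow> dual_steenrod \<Rightarrow> dual_steenrod" where
  "act L0 x = lin (Q 0) x"
| "act L1 x = lin (Q 1) x"
| "act L2 x = lin (Q 2) x"
| "act L10 x = lin (Q 1) (lin (Q 0) x)"
| "act L20 x = lin (Q 2) (lin (Q 0) x)"
| "act L21 x = lin (Q 2) (lin (Q 1) x)"
| "act L210 x = lin (Q 2) (lin (Q 1) (lin (Q 0) x))"

definition letters :: "letter list" where
  "letters = [L0, L1, L2, L10, L20, L21, L210]"

definition attach :: "word \<Rightarrow> dual_steenrod \<Rightarrow> word_cobar" where
  "attach w = lin (\<lambda>m. bas (w, m))"

definition prefix :: "letter \<Rightarrow> word_cobar \<Rightarrow> word_cobar" where
  "prefix a = lin (\<lambda>(w, m). bas (a # w, m))"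

definition prefix_split :: "letter \<Rightarrow> word_cobar \<Rightarrow> word_cobar" where
  "prefix_split a x = (\<Sum>(b, c)\<leftarrow>splits a. prefix b (prefix c x))"

definition coact :: "dual_steenrod \<Rightarrow> word_cobar" where
  "coact x = (\<Sum>a\<leftarrow>letters. attach [a] (act a x))"

fun d_cobar_basis :: "word \<Rightarrow> mono \<Rightarrow> word_cobar" where
  "d_cobar_basis [] m = coact (bas m)"
| "d_cobar_basis (a # w) m = prefix_split a (bas (w, m)) + prefix a (d_cobar_basis w m)"

definition d_cobar :: "word_cobar \<Rightarrow> word_cobar" where
  "d_cobar = lin (\<lambda>(w, m). d_cobar_basis w m)"

lemma act_add [simp]: "act a (x + y) = act a x + act a y"
  by (cases a) simp_all

lemma attach_add [simp]: "attach w (x + y) = attach w x + attach w y"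
  by (simp add: attach_def)

lemma attach_zero [simp]: "attach w 0 = 0"
  by (simp add: attach_def)

lemma attach_bas [simp]: "attach w (bas m) = bas (w, m)"
  by (simp add: attach_def)

lemma prefix_add [simp]: "prefix a (x + y) = prefix a x + prefix a y"
  by (simp add: prefix_def)

lemma prefix_zero [simp]: "prefix a 0 = 0"
  by (simp add: prefix_def)

lemma prefix_bas [simp]: "prefix a (bas (w, m)) = bas (a # w, m)"
  by (simp add: prefix_def)

lemma prefix_split_add [simp]: "prefix_split a (x + y) = prefix_split a x + prefix_split a y"
  by (cases a) (simp_all add: prefix_split_def ac_simps)

lemma coact_add [simp]: "coact (x + y) = coact x + coact y"
  by (simp add: coact_def letters_def ac_simps)

lemma d_cobar_add [simp]: "d_cobar (x + y) = d_cobar x + d_cobar y"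
  by (simp add: d_cobar_def)

lemma d_cobar_zero [simp]: "d_cobar 0 = 0"
  by (simp add: d_cobar_def)

lemma d_cobar_bas [simp]: "d_cobar (bas (w, m)) = d_cobar_basis w m"
  by (simp add: d_cobar_def)

lemma prefix_attach [simp]: "prefix a (attach w x) = attach (a # w) x"
  by (rule additive_eqI_all[where F = "\<lambda>x. prefix a (attach w x)" and x = x]) simp_all

lemma d_cobar_attach_Nil: "d_cobar (attach [] x) = coact x"
  by (rule additive_eqI_all[where F = "\<lambda>x. d_cobar (attach [] x)" and x = x]) simp_all

lemma d_cobar_prefix: "d_cobar (prefix a x) = prefix_split a x + prefix a (d_cobar x)"
  by (rule additive_eqI_all[where F = "\<lambda>x. d_cobar (prefix a x)" and x = x])
    (auto simp: ac_simps)

lemma d_cobar_prefix_split: "d_cobar (prefix_split a x) = prefix_split a (d_cobar x)"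
  by (cases a) (simp_all add: prefix_split_def d_cobar_prefix ac_simps)

lemma lin_Q_lin_Q:
  assumes "i < 3" "j < 3"
  shows "lin (Q i) (lin (Q j) x) = lin (Q j) (lin (Q i) x)"
    and "lin (Q i) (lin (Q i) x) = 0"
  using assms by (simp_all add: lin_lin Q_Q Q_commute)

lemma act_act:
  "lin (Q 0) (lin (Q 1) x) = lin (Q 1) (lin (Q 0) x)"
  "lin (Q 0) (lin (Q 2) x) = lin (Q 2) (lin (Q 0) x)"
  "lin (Q 1) (lin (Q 2) x) = lin (Q 2) (lin (Q 1) x)"
  "lin (Q 0) (lin (Q 0) x) = 0" "lin (Q 1) (lin (Q 1) x) = 0" "lin (Q 2) (lin (Q 2) x) = 0"
  using lin_Q_lin_Q(1)[of 0 1] lin_Q_lin_Q(1)[of 0 2] lin_Q_lin_Q(1)[of 1 2]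
    lin_Q_lin_Q(2)[of 0 0] lin_Q_lin_Q(2)[of 1 1] lin_Q_lin_Q(2)[of 2 2]
  by simp_all

text \<open>
  Two letters act by the letter that splits into them, or by 0 if they have a factor in common. So the
  terms of the iterated coaction are those of the coproduct applied to the coaction.
\<close>

lemma d_cobar_coact: "d_cobar (coact x) = 0"
proof -
  have "d_cobar (attach [a] y) = prefix_split a (attach [] y) + prefix a (coact y)" for a y
    using d_cobar_prefix[of a "attach [] y"] by (simp add: d_cobar_attach_Nil)
  then show ?thesis
    by (simp add: coact_def letters_def prefix_split_def act_act del: One_nat_def)
      (simp add: ac_simps)
qed

lemma d_cobar_d_cobar: "d_cobar (d_cobar x) = 0"
proof -
  have "d_cobar (d_cobar_basis w m) = 0" for w m
    by (induction w) (simp_all add: d_cobar_coact d_cobar_prefix d_cobar_prefix_split ac_simps)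
  then show ?thesis
    by (intro additive_eqI_all[where F = "\<lambda>x. d_cobar (d_cobar x)" and G = "\<lambda>_. 0" and x = x]) auto
qed

subsection \<open>The projection to the Koszul complex\<close>

definition with_coeff :: "mono \<Rightarrow> ('a \<Rightarrow>\<^sub>0 bit) \<Rightarrow> ('a \<times> mono \<Rightarrow>\<^sub>0 bit)" where
  "with_coeff m = lin (\<lambda>u. bas (u, m))"

definition to_koszul :: "word_cobar \<Rightarrow> koszul" where
  "to_koszul = lin (\<lambda>(w, m). with_coeff m (v_word w))"

fun times_letter :: "letter \<Rightarrow> koszul \<Rightarrow> koszul" where
  "times_letter L0 x = times_v 0 x"
| "times_letter L1 x = times_v 1 x"
| "times_letter L2 x = times_v 2 x"
| "times_letter _ x = 0"

lemma with_coeff_add [simp]: "with_coeff m (x + y) = with_coeff m x + with_coeff m y"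
  by (simp add: with_coeff_def)

lemma with_coeff_zero [simp]: "with_coeff m 0 = 0"
  by (simp add: with_coeff_def)

lemma with_coeff_bas [simp]: "with_coeff m (bas u) = bas (u, m)"
  by (simp add: with_coeff_def)

lemma to_koszul_add [simp]: "to_koszul (x + y) = to_koszul x + to_koszul y"
  by (simp add: to_koszul_def)

lemma to_koszul_zero [simp]: "to_koszul 0 = 0"
  by (simp add: to_koszul_def)

lemma to_koszul_bas [simp]: "to_koszul (bas (w, m)) = with_coeff m (v_word w)"
  by (simp add: to_koszul_def)

lemma times_letter_add [simp]: "times_letter a (x + y) = times_letter a x + times_letter a y"
  by (cases a) simp_all

lemma with_coeff_letter: "with_coeff m (v_letter a * x) = times_letter a (with_coeff m x)"
proof (rule additive_eqI_all[where F = "\<lambda>x. with_coeff m (v_letter a * x)" and x = x])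
  show "with_coeff m (v_letter a * bas e) = times_letter a (with_coeff m (bas e))" for e
    by (cases a) (simp_all add: mult_single add.commute)
qed (simp_all add: distrib_left)

lemma to_koszul_prefix: "to_koszul (prefix a x) = times_letter a (to_koszul x)"
  by (rule additive_eqI_all[where F = "\<lambda>x. to_koszul (prefix a x)" and x = x])
    (auto simp: with_coeff_letter)

lemma to_koszul_prefix_split: "to_koszul (prefix_split a x) = 0"
  by (cases a) (simp_all add: prefix_split_def to_koszul_prefix times_v_commute ac_simps)

lemma d_koszul_times_letter: "d_koszul r (times_letter a x) = times_letter a (d_koszul r x)"
  by (cases a) (simp_all add: d_koszul_times_v)

lemma to_koszul_attach: "to_koszul (attach [a] x) = times_letter a (lin (\<lambda>m. bas (0, m)) x)"
  by (rule additive_eqI_all[where F = "\<lambda>x. to_koszul (attach [a] x)" and x = x])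
    (simp_all add: with_coeff_letter flip: single_one)

text \<open>
  Splits map to 0, and of the coaction only the three generators survive; they give
  \<open>v\<^sub>0 Q\<^sub>0 + v\<^sub>1 Q\<^sub>1 + v\<^sub>2 Q\<^sub>2\<close>.
\<close>

lemma to_koszul_d_cobar: "to_koszul (d_cobar x) = d_koszul 3 (to_koszul x)"
proof (rule additive_eqI_all[where F = "\<lambda>x. to_koszul (d_cobar x)" and x = x])
  fix p :: "word \<times> mono"
  have "to_koszul (d_cobar_basis w m) = d_koszul 3 (to_koszul (bas (w, m)))" for w m
  proof (induction w)
    case Nil
    show ?case
      by (simp add: coact_def letters_def to_koszul_attach d_koszul_def numeral_3_eq_3 numeral_2_eq_2
          on_coeff_bas ac_simps flip: single_one)
  next
    case (Cons a w)
    then show ?case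
      by (simp add: to_koszul_prefix to_koszul_prefix_split with_coeff_letter d_koszul_times_letter)
  qed
  then show "to_koszul (d_cobar (bas p)) = d_koszul 3 (to_koszul (bas p))"
    by (cases p) simp
qed simp_all

subsection \<open>The differential of words as the leading part\<close>

definition on_word :: "(word \<Rightarrow> (word \<Rightarrow>\<^sub>0 bit)) \<Rightarrow> word_cobar \<Rightarrow> word_cobar" where
  "on_word F = lin (\<lambda>(w, m). lin (\<lambda>u. bas (u, m)) (F w))"

definition slice :: "mono \<Rightarrow> ('a \<times> mono \<Rightarrow>\<^sub>0 bit) \<Rightarrow> ('a \<Rightarrow>\<^sub>0 bit)" where
  "slice m = lin (\<lambda>(u, n). if n = m then bas u else 0)"

lemma slice_add [simp]: "slice m (x + y) = slice m x + slice m y"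
  by (simp add: slice_def)

lemma slice_zero [simp]: "slice m 0 = 0"
  by (simp add: slice_def)

lemma slice_bas: "slice m (bas (u, n)) = (if n = m then bas u else 0)"
  by (simp add: slice_def)

lemma on_word_add [simp]: "on_word F (x + y) = on_word F x + on_word F y"
  by (simp add: on_word_def)

lemma on_word_zero [simp]: "on_word F 0 = 0"
  by (simp add: on_word_def)

lemma on_word_bas: "on_word F (bas (w, m)) = with_coeff m (F w)"
  by (simp add: on_word_def with_coeff_def)

lemma slice_with_coeff: "slice m (with_coeff n x) = (if n = m then x else 0)"
  by (rule additive_eqI_all[where F = "\<lambda>x. slice m (with_coeff n x)" and x = x])
    (simp_all add: slice_bas)

lemma slice_on_word: "slice m (on_word d_word x) = d_words (slice m x)"
  by (rule additive_eqI_all[where F = "\<lambda>x. slice m (on_word d_word x)" and x = x])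
    (auto simp: on_word_bas slice_with_coeff slice_bas)

lemma slice_to_koszul: "slice m (to_koszul x) = v_words (slice m x)"
  by (rule additive_eqI_all[where F = "\<lambda>x. slice m (to_koszul x)" and x = x])
    (auto simp: slice_bas slice_with_coeff)

lemma on_word_with_coeff: "on_word d_word (with_coeff m x) = with_coeff m (d_words x)"
  by (rule additive_eqI_all[where F = "\<lambda>x. on_word d_word (with_coeff m x)" and x = x])
    (simp_all add: on_word_bas)

lemma sum_slices: "(\<Sum>m\<in>snd ` Poly_Mapping.keys x. with_coeff m (slice m x)) = x"
proof -
  have "(\<Sum>m\<in>snd ` Poly_Mapping.keys x. with_coeff m (slice m y)) = y"
    if "supp (\<lambda>p. p \<in> Poly_Mapping.keys x) y" for y
  proof (rule additive_eqI[where F = "\<lambda>y. \<Sum>m\<in>snd ` Poly_Mapping.keys x. with_coeff m (slice m y)"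
        and G = "\<lambda>y. y", OF _ _ that])
    fix p assume p: "p \<in> Poly_Mapping.keys x"
    have "(\<Sum>m\<in>snd ` Poly_Mapping.keys x. with_coeff m (slice m (bas p)))
        = (\<Sum>m\<in>snd ` Poly_Mapping.keys x. if m = snd p then bas p else 0)"
      by (rule sum.cong) (auto simp: slice_def case_prod_unfold)
    then show "(\<Sum>m\<in>snd ` Poly_Mapping.keys x. with_coeff m (slice m (bas p))) = bas p"
      using p by simp
  qed (simp_all add: sum.distrib)
  then show ?thesis by (simp add: supp_def)
qed

lemma to_koszul_with_coeff: "to_koszul (with_coeff m x) = with_coeff m (v_words x)"
  by (rule additive_eqI_all[where F = "\<lambda>x. to_koszul (with_coeff m x)" and x = x]) simp_all

text \<open>
  The complex of words with trivial coefficients is contracted for each coefficient monomial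
  separately.
\<close>

lemma word_kernel_acyclic:
  assumes "on_word d_word x = 0" "to_koszul x = 0"
  obtains z where "x = on_word d_word z" "to_koszul z = 0"
proof -
  have "\<exists>z. slice m x = d_words z \<and> v_words z = 0" for m
    by (rule v_words_kernel_acyclic[of "slice m x"])
      (auto simp: assms simp flip: slice_on_word slice_to_koszul)
  then obtain z where z: "slice m x = d_words (z m)" "v_words (z m) = 0" for m by metis
  let ?z = "\<Sum>m\<in>snd ` Poly_Mapping.keys x. with_coeff m (z m)"
  have sum: "on_word d_word (sum f I) = (\<Sum>i\<in>I. on_word d_word (f i))"
    "to_koszul (sum f I) = (\<Sum>i\<in>I. to_koszul (f i))" for f and I :: "mono set"
    by (induction I rule: infinite_finite_induct) simp_all
  have "x = on_word d_word ?z"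
    by (simp add: sum on_word_with_coeff sum_slices flip: z)
  moreover have "to_koszul ?z = 0"
    by (simp add: sum to_koszul_with_coeff z)
  ultimately show thesis by (rule that)
qed

lemma supp_act_less: "supp (\<lambda>n. card (odds n) < card (odds m)) (act a (bas m))"
proof -
  have Q: "supp (\<lambda>n. card (odds n) < c) (lin (Q i) x)"
    if "supp (\<lambda>n. card (odds n) < c \<or> card (odds n) = c) x" "i < 3" for c i x
    by (rule supp_additive[where F = "lin (Q i)", OF _ that(1)])
      (auto intro: supp_mono[OF supp_Q[OF that(2)]])
  have "supp (\<lambda>n. card (odds n) < card (odds m) \<or> card (odds n) = card (odds m)) x"
    if "supp (\<lambda>n. card (odds n) < card (odds m)) x" for x
    using that by (rule supp_mono) simp
  note * = Q[OF this]
  have "supp (\<lambda>n. card (odds n) < card (odds m)) (lin (Q i) (bas m))" if "i < 3" for i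
    using Q[of "card (odds m)" "bas m" i] that by simp
  then show ?thesis by (cases a) (simp_all add: * del: lin_single)
qed

lemma supp_prefix:
  assumes "supp (\<lambda>(w, m). P m) x"
  shows "supp (\<lambda>(w, m). P m) (prefix a x)"
  by (rule supp_additive[where F = "prefix a", OF _ assms]) auto

lemma supp_sum_list: "(\<And>a. supp P (f a)) \<Longrightarrow> supp P (\<Sum>a\<leftarrow>as. f a)"
  by (induction as) (auto intro: supp_add)

text \<open>
  With respect to the exterior degree of the coefficients, the differential of words is the leading
  part of \<open>d_cobar\<close>.
\<close>

lemma d_cobar_leading:
  "supp (\<lambda>(u, n). card (odds n) < card (odds m)) (d_cobar_basis w m + with_coeff m (d_word w))"
proof (induction w)
  case Nil
  have "supp (\<lambda>(u, n). card (odds n) < card (odds m)) (attach [a] (act a (bas m)))" for a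
    by (rule supp_additive[where F = "attach [a]", OF _ supp_act_less]) simp_all
  then show ?case by (simp add: coact_def supp_sum_list)
next
  case (Cons a w)
  have "with_coeff m (cons b x) = prefix b (with_coeff m x)" for b x
    by (rule additive_eqI_all[where F = "\<lambda>x. with_coeff m (cons b x)" and x = x]) simp_all
  note cons = this
  have "with_coeff m (cons_split a (bas w)) = prefix_split a (bas (w, m))"
    by (cases a) (simp_all add: cons_split_def prefix_split_def)
  then have "d_cobar_basis (a # w) m + with_coeff m (d_word (a # w))
    = prefix a (d_cobar_basis w m + with_coeff m (d_word w))"
    by (simp add: cons ac_simps)
  with supp_prefix[OF Cons] show ?case by (simp only:)
qed

lemma supp_d_cobar_leading:
  assumes "supp (\<lambda>(w, m). card (odds m) \<le> c) x"
  shows "supp (\<lambda>(w, m). card (odds m) < c) (d_cobar x + on_word d_word x)"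
proof (rule supp_additive[where F = "\<lambda>x. d_cobar x + on_word d_word x", OF _ assms])
  fix p :: "word \<times> mono" assume "case p of (w, m) \<Rightarrow> card (odds m) \<le> c"
  then show "supp (\<lambda>(w, m). card (odds m) < c) (d_cobar (bas p) + on_word d_word (bas p))"
    by (cases p) (auto simp: on_word_bas intro: supp_mono[OF d_cobar_leading])
qed (simp add: ac_simps)

lemma restr_coeff:
  assumes "\<And>x y. F (x + y) = F x + (F y :: 'b \<times> mono \<Rightarrow>\<^sub>0 bit)"
    and "\<And>u m. supp (\<lambda>(v, n). n = m) (F (bas (u :: 'a, m)))"
  shows "restr (\<lambda>(v, n). P n) (F x) = F (restr (\<lambda>(u, m). P m) x)"
proof (rule restr_additive[where R = "\<lambda>_. True" and F = F])
  fix p :: "'a \<times> mono"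
  show "supp (\<lambda>(v, n). P n) (F (bas p))" if "case p of (u, m) \<Rightarrow> P m"
    using that by (cases p) (auto intro: supp_mono[OF assms(2)])
  show "supp (\<lambda>q. \<not> (case q of (v, n) \<Rightarrow> P n)) (F (bas p))" if "\<not> (case p of (u, m) \<Rightarrow> P m)"
    using that by (cases p) (auto intro: supp_mono[OF assms(2)])
qed (simp_all add: assms(1) supp_def)

lemma supp_with_coeff: "supp (\<lambda>(v, n). n = m) (with_coeff m x)"
  unfolding with_coeff_def by (rule supp_lin) simp

lemma restr_on_word:
  "restr (\<lambda>(w, m). P m) (on_word d_word x) = on_word d_word (restr (\<lambda>(w, m). P m) x)"
  by (rule restr_coeff) (simp_all add: on_word_bas supp_with_coeff)

lemma restr_to_koszul:
  "restr (\<lambda>(w, m). P m) (to_koszul x) = to_koszul (restr (\<lambda>(w, m). P m) x)"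
  by (rule restr_coeff) (simp_all add: supp_with_coeff)

text \<open>
  The top part of a cocycle in the kernel, with respect to the exterior degree of the coefficients, is a
  cocycle for the differential of words, hence a boundary there. Subtracting the full boundary of the
  same primitive lowers the exterior degree.
\<close>

lemma to_koszul_kernel_acyclic:
  assumes "d_cobar x = 0" "to_koszul x = 0"
  obtains z where "x = d_cobar z"
proof -
  have "\<exists>z. x = d_cobar z"
    if "supp (\<lambda>(w, m). card (odds m) < c) x" "d_cobar x = 0" "to_koszul x = 0" for c x
    using that
  proof (induction c arbitrary: x)
    case 0
    then have "x = d_cobar 0" by (simp add: case_prod_unfold supp_False)
    then show ?case by blast
  next
    case (Suc c)
    let ?P = "\<lambda>(w :: word, m). card (odds m) = c" and ?d = "on_word d_word"
    have le: "supp (\<lambda>(w, m). card (odds m) \<le> c) x"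
      using Suc.prems(1) by (rule supp_mono) auto
    have "supp (\<lambda>(w, m). card (odds m) < c) (?d x)"
      using supp_d_cobar_leading[OF le] Suc.prems(2) by simp
    then have "restr ?P (?d x) = 0" by (intro restr_eq_zero) (auto elim: supp_mono)
    then have "?d (restr ?P x) = 0" by (simp only: restr_on_word)
    moreover have "to_koszul (restr ?P x) = 0"
      by (simp only: restr_to_koszul[symmetric] Suc.prems(3) restr_zero)
    ultimately obtain z0 where z0: "restr ?P x = ?d z0" "to_koszul z0 = 0" by (rule word_kernel_acyclic)
    from z0(1) have "restr ?P (restr ?P x) = ?d (restr ?P z0)" by (simp only: restr_on_word)
    moreover define z where "z = restr ?P z0"
    ultimately have z: "restr ?P x = ?d z" by (simp only: restr_ident[OF supp_restr])
    have "x + d_cobar z = restr (\<lambda>p. \<not> ?P p) x + (d_cobar z + ?d z)"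
      by (subst restr_split[of ?P x, symmetric]) (simp only: z ac_simps)
    moreover have "supp (\<lambda>(w, m). card (odds m) < c) (restr (\<lambda>p. \<not> ?P p) x)"
      using supp_restr_both[OF le] by (rule supp_mono) auto
    moreover have "supp (\<lambda>(w, m). card (odds m) < c) (d_cobar z + ?d z)"
      unfolding z_def by (rule supp_d_cobar_leading, rule supp_mono[OF supp_restr]) auto
    ultimately have "supp (\<lambda>(w, m). card (odds m) < c) (x + d_cobar z)"
      by (simp only: supp_add)
    moreover have "to_koszul z = 0"
      by (simp only: z_def restr_to_koszul[symmetric] z0(2) restr_zero)
    then have "d_cobar (x + d_cobar z) = 0" "to_koszul (x + d_cobar z) = 0"
      by (simp_all add: Suc.prems d_cobar_d_cobar to_koszul_d_cobar)
    ultimately obtain u where "x + d_cobar z = d_cobar u" using Suc.IH by blast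
    then have "x = d_cobar (u + z)"
      by (metis add.commute d_cobar_add f2_add_cancel)
    then show ?case by blast
  qed
  moreover have "supp (\<lambda>(w, m). card (odds m) < Suc (\<Sum>(w, m)\<in>Poly_Mapping.keys x. card (odds m))) x"
    unfolding supp_def
  proof clarify
    fix w m assume "(w, m) \<in> Poly_Mapping.keys x"
    then show "card (odds m) < Suc (\<Sum>(w, m)\<in>Poly_Mapping.keys x. card (odds m))"
      using member_le_sum[of "(w, m)" "Poly_Mapping.keys x" "\<lambda>(w, m). card (odds m)"] by simp
  qed
  ultimately show thesis using assms that by blast
qed


text \<open>
  A right inverse on monomials of the projection from words to polynomials.
\<close>

definition sorted_word :: "mono \<Rightarrow> word" where
  "sorted_word e = replicate (Poly_Mapping.lookup e 0) L0 @ replicate (Poly_Mapping.lookup e 1) L1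
     @ replicate (Poly_Mapping.lookup e 2) L2"

lemma v_word_sorted_word:
  assumes "Poly_Mapping.keys e \<subseteq> {..<3}"
  shows "v_word (sorted_word e) = bas e"
proof -
  have "Poly_Mapping.single 0 (Poly_Mapping.lookup e 0) + (Poly_Mapping.single 1 (Poly_Mapping.lookup e 1)
      + Poly_Mapping.single 2 (Poly_Mapping.lookup e 2)) = e"
  proof (rule poly_mapping_eqI)
    fix k
    have "Poly_Mapping.lookup e k = 0" if "3 \<le> k"
      using assms that by (auto simp: in_keys_iff subset_iff)
    moreover have "k = 0 \<or> k = 1 \<or> k = 2 \<or> 3 \<le> k" by linarith
    ultimately show "Poly_Mapping.lookup (Poly_Mapping.single 0 (Poly_Mapping.lookup e 0)
      + (Poly_Mapping.single 1 (Poly_Mapping.lookup e 1)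
      + Poly_Mapping.single 2 (Poly_Mapping.lookup e 2))) k = Poly_Mapping.lookup e k"
      by (auto simp: lookup_add lookup_single)
  qed
  then show ?thesis
    by (simp add: sorted_word_def v_word_append v_word_replicate[of _ 0] v_word_replicate[of _ 1]
        v_word_replicate[of _ 2] mult_single)
qed

lemma supp_v_word: "supp (\<lambda>e. Poly_Mapping.keys e \<subseteq> {..<3}) (v_word w)"
proof (induction w)
  case (Cons a w)
  have "supp (\<lambda>e. Poly_Mapping.keys e \<subseteq> {..<3}) (v_letter a * bas e)"
    if "Poly_Mapping.keys e \<subseteq> {..<3}" for e
    using that by (cases a) (simp_all add: mult_single keys_add_mono)
  then have "supp (\<lambda>e. Poly_Mapping.keys e \<subseteq> {..<3}) (v_letter a * v_word w)"
    by (intro supp_additive[where F = "\<lambda>x. v_letter a * x", OF _ Cons]) (simp_all add: distrib_left)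
  then show ?case by simp
qed (simp flip: single_one)

lemma supp_to_koszul: "supp (\<lambda>(e, m). Poly_Mapping.keys e \<subseteq> {..<3}) (to_koszul x)"
  unfolding to_koszul_def with_coeff_def
  by (rule supp_lin) (use supp_v_word in \<open>auto intro!: supp_lin simp: supp_def[of _ "v_word _"]\<close>)

lemma to_koszul_boundary:
  assumes "d_cobar x = 0" "to_koszul x = d_koszul 3 y"
  obtains z where "x = d_cobar z"
proof -
  let ?P = "\<lambda>(e :: mono, m :: mono). Poly_Mapping.keys e \<subseteq> {..<3}"
  let ?s = "lin (\<lambda>(e, m :: mono). bas (sorted_word e, m))"
  have "restr ?P (d_koszul 3 y) = d_koszul 3 (restr ?P y)"
  proof (rule restr_additive[where R = "\<lambda>_. True"])
    fix p :: "mono \<times> mono"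
    show "supp ?P (d_koszul 3 (bas p))" if "?P p"
      by (rule supp_d_koszul[where P = "\<lambda>e m. Poly_Mapping.keys e \<subseteq> {..<3}"])
        (use that in \<open>auto simp: keys_add_mono\<close>)
    have "supp (\<lambda>(e, m). \<not> Poly_Mapping.keys e \<subseteq> {..<3}) (d_koszul 3 (bas p))" if "\<not> ?P p"
      by (rule supp_d_koszul[where P = "\<lambda>e m. \<not> Poly_Mapping.keys e \<subseteq> {..<3}"])
        (use that in \<open>auto simp: keys_add_mono\<close>)
    then show "supp (\<lambda>p. \<not> ?P p) (d_koszul 3 (bas p))" if "\<not> ?P p"
      using that by (simp add: case_prod_unfold)
  qed (simp_all add: supp_def)
  then have y: "to_koszul x = d_koszul 3 (restr ?P y)"
    using restr_ident[OF supp_to_koszul[of x]] unfolding assms(2) by (simp only:)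
  have s: "to_koszul (?s (restr ?P y)) = restr ?P y"
  proof (rule additive_eqI[where F = "\<lambda>y. to_koszul (?s y)" and G = "\<lambda>y. y", OF _ _ supp_restr])
    fix p assume "?P p"
    then show "to_koszul (?s (bas p)) = bas p"
      by (cases p) (simp add: v_word_sorted_word)
  qed simp_all
  let ?x = "x + d_cobar (?s (restr ?P y))"
  have "to_koszul ?x = 0"
    by (simp only: to_koszul_add to_koszul_d_cobar s y f2_add_self)
  moreover have "d_cobar ?x = 0" by (simp only: d_cobar_add d_cobar_d_cobar assms(1) add_0_right)
  ultimately obtain z where z: "?x = d_cobar z" using to_koszul_kernel_acyclic by blast
  have "x = d_cobar (z + ?s (restr ?P y))"
    using f2_eq_swap[OF z[symmetric]] by (simp add: z[symmetric] ac_simps)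
  then show thesis by (rule that)
qed

section \<open>The coaction in terms of the Milnor primitives\<close>

text \<open>
  The basis elements outside \<open>P\<close> span an ideal, so products may be computed modulo it. For
  \<open>E2_left\<close> and \<open>E2_both\<close> this is the passage to the quotients \<open>E(2)\<^sub>* \<otimes> A\<^sub>*\<close> and \<open>E(2)\<^sub>* \<otimes> E(2)\<^sub>*\<close>.
\<close>

lemma restr_mult:
  fixes x y :: "'a :: comm_monoid_add \<Rightarrow>\<^sub>0 bit"
  assumes "\<And>a b. P (a + b) \<Longrightarrow> P a \<and> P b"
  shows "restr P (restr P x * restr P y) = restr P (x * y)"
proof (rule additive_eqI_all[where F = "\<lambda>x. restr P (restr P x * restr P y)" and x = x])
  fix a
  show "restr P (restr P (bas a) * restr P y) = restr P (bas a * y)"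
  proof (rule additive_eqI_all[where F = "\<lambda>y. restr P (restr P (bas a) * restr P y)" and x = y])
    show "restr P (restr P (bas a) * restr P (bas b)) = restr P (bas a * bas b)" for b
      using assms[of a b] by (auto simp: restr_single mult_single)
  qed (simp_all add: distrib_left)
qed (simp_all add: distrib_right)

lemma sum_symmetric_difference:
  fixes f :: "'a \<Rightarrow> ('b \<Rightarrow>\<^sub>0 bit)"
  assumes "finite A" "finite B"
  shows "sum f A + sum f B = sum f (A - B \<union> (B - A))"
proof -
  have "sum f A = sum f (A - B) + sum f (A \<inter> B)" "sum f B = sum f (B - A) + sum f (A \<inter> B)"
    using assms sum.Int_Diff[of A f B] sum.Int_Diff[of B f A] by (simp_all add: add.commute Int_commute)
  moreover have "sum f (A - B \<union> (B - A)) = sum f (A - B) + sum f (B - A)"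
    using assms by (intro sum.union_disjoint) auto
  ultimately show ?thesis by (simp add: ac_simps)
qed

lemma Q_add: "Q i (m + n) = Q i m * bas n + bas m * Q i n"
proof -
  have pos: "Poly_Mapping.lookup p k \<noteq> 0" if "k \<in> odds p" for p k
    using that by (auto simp: odds_def intro!: Nat.gr0I)
  have l: "lower i k p + q = lower i k (p + q)" if "k \<in> odds p" for k p q
    by (rule poly_mapping_eqI) (use pos[OF that] in \<open>auto simp: lookup_lower lookup_add\<close>)
  have "Q i m * bas n = (\<Sum>k\<in>odds m. bas (lower i k (m + n)))"
    unfolding Q_def sum_distrib_right by (rule sum.cong) (simp_all add: mult_single l)
  moreover have "bas m * Q i n = (\<Sum>k\<in>odds n. bas (lower i k (m + n)))"
    unfolding Q_def sum_distrib_left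
    by (rule sum.cong) (use l[of _ n m] in \<open>simp_all add: mult_single add.commute\<close>)
  moreover have "odds (m + n) = odds m - odds n \<union> (odds n - odds m)"
    by (auto simp: odds_def lookup_add)
  ultimately show ?thesis
    unfolding Q_def by (simp add: sum_symmetric_difference)
qed

lemma on_coeff_mult: "on_coeff (Q i) (x * y) = on_coeff (Q i) x * y + x * on_coeff (Q i) y"
proof (rule additive_eqI_all[where F = "\<lambda>x. on_coeff (Q i) (x * y)" and x = x])
  fix p :: "mono \<times> mono"
  show "on_coeff (Q i) (bas p * y) = on_coeff (Q i) (bas p) * y + bas p * on_coeff (Q i) y"
  proof (rule additive_eqI_all[where F = "\<lambda>y. on_coeff (Q i) (bas p * y)" and x = y])
    fix q :: "mono \<times> mono"
    obtain a m b n where pq: "p = (a, m)" "q = (b, n)" by (cases p; cases q)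
    have 1: "lin (\<lambda>n. bas (a, n)) x * bas (b, n) = lin (\<lambda>n. bas (a + b, n)) (x * bas n)" for x n
      by (rule additive_eqI_all[where F = "\<lambda>x. lin (\<lambda>n. bas (a, n)) x * bas (b, n)" and x = x])
        (simp_all add: distrib_right mult_single)
    have 2: "bas (a, m) * lin (\<lambda>n. bas (b, n)) x = lin (\<lambda>n. bas (a + b, n)) (bas m * x)" for x m
      by (rule additive_eqI_all[where F = "\<lambda>x. bas (a, m) * lin (\<lambda>n. bas (b, n)) x" and x = x])
        (simp_all add: distrib_left mult_single)
    show "on_coeff (Q i) (bas p * bas q) = on_coeff (Q i) (bas p) * bas q + bas p * on_coeff (Q i) (bas q)"
      by (simp add: pq mult_single on_coeff_bas Q_add 1 2)
  qed (simp_all add: distrib_left add_ac)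
qed (simp_all add: distrib_right add_ac)

definition E2_left :: "mono \<times> mono \<Rightarrow> bool" where
  "E2_left = (\<lambda>(a, n). E2_mono a)"

text \<open>
  The map \<open>1 + \<zeta>\<^bsub>i+1\<^esub> \<otimes> Q\<^sub>i\<close> on \<open>A\<^sub>* \<otimes> A\<^sub>*\<close>, which carries the same monoid algebra as the Koszul complex: the
  left factor \<open>\<zeta>\<^bsub>i+1\<^esub>\<close> is \<open>v\<^sub>i\<close>.
\<close>

definition twist :: "nat \<Rightarrow> koszul \<Rightarrow> koszul" where
  "twist i x = x + times_v i (on_coeff (Q i) x)"

lemma E2_mono_add: "E2_mono (a + b) \<Longrightarrow> E2_mono a \<and> E2_mono b"
  unfolding E2_mono_def lookup_add by (meson add_leD1 add_leD2)

lemma E2_left_add: "E2_left (p + q) \<Longrightarrow> E2_left p \<and> E2_left q"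
  by (cases p; cases q) (auto simp: E2_left_def dest: E2_mono_add)

lemma twist_add [simp]: "twist i (x + y) = twist i x + twist i y"
  by (simp add: twist_def ac_simps)

lemma times_v_eq: "times_v i x = bas (Poly_Mapping.single i 1, 0) * x"
  by (rule additive_eqI_all[where F = "times_v i" and x = x])
    (auto simp: distrib_left mult_single add.commute)

text \<open>
  Since \<open>Q\<^sub>i\<close> is a derivation and the square of \<open>\<zeta>\<^bsub>i+1\<^esub>\<close> vanishes in \<open>E(2)\<^sub>*\<close>, the map \<open>twist i\<close> is
  multiplicative there.
\<close>

lemma restr_twist_mult:
  "restr E2_left (twist i (x * y)) = restr E2_left (twist i x * twist i y)"
proof -
  let ?e = "bas (Poly_Mapping.single i 1 :: mono, 0 :: mono)" and ?D = "on_coeff (Q i)"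
  have "?e * ?e = bas (Poly_Mapping.single i (1 + 1), 0)"
    by (simp only: mult_single single_add add_Pair mult_1 add_0)
  moreover have "\<not> E2_mono (Poly_Mapping.single i (1 + 1))"
    unfolding E2_mono_def by (metis lookup_single_eq nat_1_add_1 not_numeral_le_zero numeral_le_one_iff semiring_norm(69))
  ultimately have "restr E2_left (?e * ?e) = 0" by (simp only: restr_single E2_left_def prod.case if_False)
  then have zero: "restr E2_left ((?e * ?e) * (?D x * ?D y)) = 0"
    by (subst restr_mult[OF E2_left_add, symmetric]) (simp_all only: restr_zero mult_zero_left)
  have "(x + e * a) * (y + e * b) = x * y + e * (a * y + x * b) + (e * e) * (a * b)"
    for x y e a b :: "'c :: comm_ring_1" by (simp add: algebra_simps)
  then have "twist i x * twist i y = twist i (x * y) + (?e * ?e) * (?D x * ?D y)"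
    by (simp only: twist_def times_v_eq on_coeff_mult)
  then show ?thesis by (simp only: restr_add zero add_0_right)
qed

lemma restr_twist: "restr E2_left (twist i (restr E2_left x)) = restr E2_left (twist i x)"
proof (rule additive_eqI_all[where F = "\<lambda>x. restr E2_left (twist i (restr E2_left x))" and x = x])
  fix p
  have "supp (\<lambda>q. \<not> E2_left q) (twist i (bas p))" if "\<not> E2_left p"
  proof -
    have "supp (\<lambda>(a, n). \<not> E2_mono a) (bas p)" using that by (cases p) (simp add: E2_left_def)
    then have "supp (\<lambda>(a, n). \<not> E2_mono a) (on_coeff (Q i) (bas p))"
      by (rule supp_on_coeff) (simp add: supp_def)
    then have "supp (\<lambda>(a, n). \<not> E2_mono (a + Poly_Mapping.single i 1)) (on_coeff (Q i) (bas p))"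
      by (rule supp_mono) (auto dest: E2_mono_add)
    then have "supp (\<lambda>(a, n). \<not> E2_mono a) (times_v i (on_coeff (Q i) (bas p)))"
      by (rule supp_times_v)
    with that show ?thesis
      unfolding twist_def by (intro supp_add) (simp_all add: E2_left_def case_prod_unfold)
  qed
  then show "restr E2_left (twist i (restr E2_left (bas p))) = restr E2_left (twist i (bas p))"
    using restr_eq_zero[of E2_left "twist i (bas p)"] additive_zero[of "twist i"]
    by (cases "E2_left p") (simp_all only: restr_single if_True if_False twist_add not_False_eq_True restr_zero)
qed simp_all

definition twists :: "koszul \<Rightarrow> koszul" where
  "twists x = twist 2 (twist 1 (twist 0 x))"

lemma restr_twists_mult:
  "restr E2_left (twists (x * y)) = restr E2_left (twists x * twists y)"
  unfolding twists_def
  by (metis restr_twist restr_twist_mult)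

lemma psi_mono_add: "psi_mono (m + n) = psi_mono m * psi_mono n"
proof -
  have *: "psi_mono p = (\<Prod>k\<in>S. psi_zeta (Suc k) ^ Poly_Mapping.lookup p k)"
    if "finite S" "Poly_Mapping.keys p \<subseteq> S" for p S
    unfolding psi_mono_def by (rule prod.mono_neutral_left) (use that in \<open>auto simp: in_keys_iff\<close>)
  let ?S = "Poly_Mapping.keys m \<union> Poly_Mapping.keys n"
  have "psi_mono (m + n) = (\<Prod>k\<in>?S. psi_zeta (Suc k) ^ Poly_Mapping.lookup (m + n) k)"
    by (rule *) (simp_all add: keys_add)
  then show ?thesis
    by (simp add: *[of ?S m] *[of ?S n] lookup_add power_add prod.distrib)
qed

lemma square_eq: "x * x = lin (\<lambda>a. bas (a + a)) (x :: 'a :: comm_monoid_add \<Rightarrow>\<^sub>0 bit)"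
  by (induction x rule: f2_induct) (simp_all add: mult_single distrib_left distrib_right ac_simps)

lemma sum_const_mono: "(\<Sum>i<n. zeta_mono (Suc k)) = Poly_Mapping.single k n"
  by (induction n) (simp_all add: zeta_mono_def add.commute del: sum_constant flip: single_add)

lemma odds_even: "(\<And>k. 3 \<le> k \<Longrightarrow> even (Poly_Mapping.lookup m k)) \<Longrightarrow> odds m = {}"
  by (auto simp: odds_def)

text \<open>
  In characteristic 2, squaring the coproduct squares each term, and the square of a positive-degree
  element vanishes in \<open>E(2)\<^sub>*\<close>.
\<close>

lemma psi_square:
  "restr E2_left (psi_mono (Poly_Mapping.single k 2)) = bas (0, Poly_Mapping.single k 2)"
proof -
  let ?r = "\<lambda>j. \<Sum>i<(2::nat) ^ j. zeta_mono (Suc k - j)"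
  have "psi_mono (Poly_Mapping.single k 2) = psi_zeta (Suc k) * psi_zeta (Suc k)"
    by (simp add: psi_mono_def power2_eq_square)
  also have "\<dots> = (\<Sum>j\<le>Suc k. bas (zeta_mono j + zeta_mono j, ?r j + ?r j))"
    unfolding square_eq psi_zeta_eq by (subst lin_sum) (simp_all del: sum_constant)
  also have "restr E2_left \<dots> = (\<Sum>j\<le>Suc k. if j = 0 then bas (0, Poly_Mapping.single k 2) else 0)"
    unfolding restr_def
  proof (subst lin_sum, simp, rule sum.cong, simp)
    fix j
    have "\<not> E2_mono (zeta_mono j + zeta_mono j)" if "j \<noteq> 0"
      using that by (cases j) (auto simp: E2_mono_def lookup_add lookup_zeta_mono intro: exI[of _ "j - 1"])
    moreover have "?r 0 + ?r 0 = Poly_Mapping.single k 2"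
      by (simp add: zeta_mono_def numeral_2_eq_2 flip: single_add)
    moreover have "E2_mono 0" by (simp add: E2_mono_def)
    ultimately show "lin (\<lambda>a. if E2_left a then bas a else 0) (bas (zeta_mono j + zeta_mono j, ?r j + ?r j))
        = (if j = 0 then bas (0, Poly_Mapping.single k 2) else 0)"
      by (cases "j = 0") (simp_all only: lin_single E2_left_def prod.case if_True if_False not_False_eq_True
          zeta_mono_0 add_0_left simp_thms)
  qed
  also have "\<dots> = bas (0, Poly_Mapping.single k 2)" by simp
  finally show ?thesis .
qed

lemma psi_generator:
  assumes "3 \<le> k"
  shows "restr E2_left (psi_mono (Poly_Mapping.single k 1)) =
    bas (0, Poly_Mapping.single k 1)
    + bas (Poly_Mapping.single 0 1, Poly_Mapping.single (k - 1) 2)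
    + bas (Poly_Mapping.single 1 1, Poly_Mapping.single (k - 2) 4)
    + bas (Poly_Mapping.single 2 1, Poly_Mapping.single (k - 3) 8)"
proof -
  let ?r = "\<lambda>j. \<Sum>i<(2::nat) ^ j. zeta_mono (Suc k - j)"
  have "psi_mono (Poly_Mapping.single k 1) = (\<Sum>j\<le>Suc k. bas (zeta_mono j, ?r j))"
    by (simp add: psi_mono_def psi_zeta_eq)
  then have "restr E2_left (psi_mono (Poly_Mapping.single k 1))
      = (\<Sum>j\<le>Suc k. restr E2_left (bas (zeta_mono j, ?r j)))"
    unfolding restr_def by (simp only: lin_sum finite_atMost)
  also have "\<dots> = (\<Sum>j\<in>{0,1,2,3}. bas (zeta_mono j, ?r j))"
  proof (rule sum.mono_neutral_cong_right)
    show "\<forall>j\<in>{..Suc k} - {0, 1, 2, 3}. restr E2_left (bas (zeta_mono j, ?r j)) = 0"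
    proof
      fix j assume "j \<in> {..Suc k} - {0, 1, 2, 3}"
      then have "3 < j" by auto
      then have "\<not> E2_mono (zeta_mono j)"
        by (cases j) (auto simp: E2_mono_def lookup_zeta_mono intro: exI[of _ "j - 1"])
      then show "restr E2_left (bas (zeta_mono j, ?r j)) = 0"
        by (simp add: restr_single E2_left_def)
    qed
    show "restr E2_left (bas (zeta_mono j, ?r j)) = bas (zeta_mono j, ?r j)"
      if "j \<in> {0, 1, 2, 3}" for j
      using that E2_mono_zeta[of j] by (auto simp: restr_single E2_left_def)
  qed (use assms in auto)
  also have "\<dots> = bas (0, Poly_Mapping.single k 1)
    + bas (Poly_Mapping.single 0 1, Poly_Mapping.single (k - 1) 2)
    + bas (Poly_Mapping.single 1 1, Poly_Mapping.single (k - 2) 4)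
    + bas (Poly_Mapping.single 2 1, Poly_Mapping.single (k - 3) 8)"
  proof -
    have *: "?r j = Poly_Mapping.single (k - j) (2 ^ j)" if "j \<le> k" for j
      using that sum_const_mono[of "k - j" "2 ^ j"] by (simp add: Suc_diff_le del: sum_constant)
    have "(2::nat) ^ 0 = 1" "(2::nat) ^ 1 = 2" "(2::nat) ^ 2 = 4" "(2::nat) ^ 3 = 8"
      by simp_all
    note r = *[of 0, unfolded this diff_zero] *[of 1, unfolded this] *[of 2, unfolded this] *[of 3, unfolded this]
    have "(\<Sum>j\<in>{0, 1, 2, 3}. g j) = g 0 + g 1 + g 2 + g 3" for g :: "nat \<Rightarrow> koszul"
      by (simp add: ac_simps)
    moreover have "zeta_mono 1 = Poly_Mapping.single 0 1" "zeta_mono 2 = Poly_Mapping.single 1 1"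
      "zeta_mono 3 = Poly_Mapping.single 2 1"
      by (simp_all add: zeta_mono_def numeral_2_eq_2 numeral_3_eq_3)
    moreover have "0 \<le> k" "1 \<le> k" "2 \<le> k" using assms by simp_all
    ultimately show ?thesis
      by (simp only: r zeta_mono_0 assms diff_zero power_0 power_one_right
          \<open>2 ^ 0 = (1::nat)\<close> \<open>2 ^ 1 = (2::nat)\<close> \<open>2 ^ 2 = (4::nat)\<close> \<open>2 ^ 3 = (8::nat)\<close>)
  qed
  finally show ?thesis .
qed

text \<open>
  Both sides are multiplicative modulo the ideal, so it is enough to compare them on the generators of
  \<open>(A//E(2))\<^sub>*\<close> and on the remaining squares.
\<close>

lemma restr_psi:
  assumes "AE2_mono m"
  shows "restr E2_left (psi_mono m) = restr E2_left (twists (bas (0, m)))"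
  using assms
proof (induction "exponent_sum m" arbitrary: m rule: less_induct)
  case less
  note restr_mult = restr_mult[OF E2_left_add]
  have step: ?case if "m = m' + g" "AE2_mono m'" "exponent_sum g \<noteq> 0"
    "restr E2_left (psi_mono g) = restr E2_left (twists (bas (0, g)))" for m' g
  proof -
    have "restr E2_left (psi_mono m') = restr E2_left (twists (bas (0, m')))"
      by (rule less.hyps) (use that in auto)
    note IH = this
    have "restr E2_left (psi_mono m)
        = restr E2_left (restr E2_left (psi_mono m') * restr E2_left (psi_mono g))"
      by (simp only: that(1) psi_mono_add restr_mult)
    also have "\<dots> = restr E2_left (twists (bas (0, m')) * twists (bas (0, g)))"
      unfolding IH that(4) by (rule restr_mult)
    also have "\<dots> = restr E2_left (twists (bas (0, m)))"
      by (simp only: that(1) mult_single add_Pair add_0_left mult_1_left flip: restr_twists_mult)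
    finally show ?thesis .
  qed
  show ?case
  proof (cases "m = 0")
    case True
    then show ?thesis
      by (simp add: psi_mono_def twists_def twist_def on_coeff_bas Q_no_odds odds_even zero_prod_def flip: single_one)
  next
    case False
    then obtain k where k: "Poly_Mapping.lookup m k \<noteq> 0"
      by (metis poly_mapping_eqI lookup_zero)
    show ?thesis
    proof (cases "2 \<le> Poly_Mapping.lookup m k")
      case True
      have "odds (Poly_Mapping.single k 2) = {}"
        by (rule odds_even) (simp add: lookup_single when_def)
      then have "twists (bas (0, Poly_Mapping.single k 2)) = bas (0, Poly_Mapping.single k 2)"
        by (simp add: twists_def twist_def on_coeff_bas Q_no_odds)
      moreover have "AE2_mono (m - Poly_Mapping.single k 2)"
        using less.prems True by (auto simp: AE2_mono_def lookup_minus lookup_single when_def)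
      ultimately show ?thesis
        using True psi_square[of k]
        by (intro step[of "m - Poly_Mapping.single k 2" "Poly_Mapping.single k 2"])
          (simp_all add: minus_single_add restr_single E2_left_def E2_mono_def)
    next
      case False
      with k have one: "Poly_Mapping.lookup m k = 1" by simp
      with less.prems have "3 \<le> k" by (auto simp: AE2_mono_def not_less[symmetric])
      have "odds (Poly_Mapping.single k 1) = {k}"
        using \<open>3 \<le> k\<close> by (auto simp: odds_def lookup_single when_def)
      then have Q: "Q i (Poly_Mapping.single k 1) = bas (Poly_Mapping.single (k - Suc i) (2 ^ Suc i))" for i
        by (simp add: Q_def lower_def)
      have twist_generator: "twist i (bas (0, Poly_Mapping.single k 1)) = bas (0, Poly_Mapping.single k 1)
          + bas (Poly_Mapping.single i 1, Poly_Mapping.single (k - Suc i) (2 ^ Suc i))" for i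
        by (simp only: twist_def on_coeff_bas Q lin_single times_v_bas add_0_left)
      have "Q i (Poly_Mapping.single j (2 ^ Suc n)) = 0" for i j n
        by (rule Q_no_odds, rule odds_even) (simp add: lookup_single when_def)
      then have twist_even: "twist i (bas (a, Poly_Mapping.single j (2 ^ Suc n)))
          = bas (a, Poly_Mapping.single j (2 ^ Suc n))" for a i j n
        by (simp only: twist_def on_coeff_bas lin_zero times_v_zero add_0_right)
      have nums: "Suc 0 = 1" "Suc 1 = 2" "Suc 2 = 3" "(2::nat) ^ 1 = 2" "(2::nat) ^ 2 = 4" "(2::nat) ^ 3 = 8"
        by simp_all
      have "twists (bas (0, Poly_Mapping.single k 1)) = restr E2_left (psi_mono (Poly_Mapping.single k 1))"
        unfolding psi_generator[OF \<open>3 \<le> k\<close>] twists_def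
        by (simp only: twist_generator twist_add twist_even) (simp only: nums ac_simps)
      moreover have "AE2_mono (m - Poly_Mapping.single k 1)"
        using less.prems \<open>3 \<le> k\<close> by (auto simp: AE2_mono_def lookup_minus lookup_single when_def)
      ultimately show ?thesis
        using one by (intro step[of "m - Poly_Mapping.single k 1" "Poly_Mapping.single k 1"])
          (simp_all add: minus_single_add restr_ident supp_restr)
    qed
  qed
qed

section \<open>Letters as monomials\<close>

fun letter_mono :: "letter \<Rightarrow> mono" where
  "letter_mono L0 = Poly_Mapping.single 0 1"
| "letter_mono L1 = Poly_Mapping.single 1 1"
| "letter_mono L2 = Poly_Mapping.single 2 1"
| "letter_mono L10 = Poly_Mapping.single 0 1 + Poly_Mapping.single 1 1"
| "letter_mono L20 = Poly_Mapping.single 0 1 + Poly_Mapping.single 2 1"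
| "letter_mono L21 = Poly_Mapping.single 1 1 + Poly_Mapping.single 2 1"
| "letter_mono L210 = Poly_Mapping.single 0 1 + Poly_Mapping.single 1 1 + Poly_Mapping.single 2 1"

lemma lookup_letter_mono:
  "Poly_Mapping.lookup (letter_mono a) k =
    (if k = 0 \<and> a \<in> {L0, L10, L20, L210} \<or> k = 1 \<and> a \<in> {L1, L10, L21, L210}
       \<or> k = 2 \<and> a \<in> {L2, L20, L21, L210} then 1 else 0)"
  by (cases a) (auto simp: lookup_add lookup_single)

lemma E2_mono_letter: "E2_mono (letter_mono a)"
  by (auto simp: E2_mono_def lookup_letter_mono)

lemma E2_mono_zero: "E2_mono 0"
  by (simp add: E2_mono_def)

lemma letter_mono_nonzero: "letter_mono a \<noteq> 0"
proof
  assume *: "letter_mono a = 0"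
  have "Poly_Mapping.lookup (letter_mono a) 0 = 0" "Poly_Mapping.lookup (letter_mono a) 1 = 0"
    "Poly_Mapping.lookup (letter_mono a) 2 = 0"
    unfolding * by simp_all
  then show False unfolding lookup_letter_mono by (cases a) simp_all
qed

lemma inj_letter_mono: "inj letter_mono"
proof (rule injI)
  fix a b assume *: "letter_mono a = letter_mono b"
  have "Poly_Mapping.lookup (letter_mono a) k = Poly_Mapping.lookup (letter_mono b) k" for k
    unfolding * ..
  from this[of 0] this[of 1] this[of 2] show "a = b"
    unfolding lookup_letter_mono by (cases a; cases b) simp_all
qed

lemma letter_mono_surj:
  assumes "E2_mono a" "a \<noteq> 0"
  obtains b where "a = letter_mono b"
proof -
  have le: "Poly_Mapping.lookup a k \<le> 1" "3 \<le> k \<Longrightarrow> Poly_Mapping.lookup a k = 0" for k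
    using assms(1) unfolding E2_mono_def by (metis (full_types) le_zero_eq zero_le_one le_trans le_refl,
      metis le_zero_eq not_less)
  have eq: "a = letter_mono b"
    if "\<And>k. k < 3 \<Longrightarrow> Poly_Mapping.lookup a k = Poly_Mapping.lookup (letter_mono b) k" for b
  proof (rule poly_mapping_eqI)
    fix k
    show "Poly_Mapping.lookup a k = Poly_Mapping.lookup (letter_mono b) k"
      using that le(2)[of k] by (cases "k < 3") (auto simp: lookup_letter_mono)
  qed
  have three: "k < 3 \<longleftrightarrow> k = 0 \<or> k = 1 \<or> k = (2::nat)" for k by auto
  have cases: "Poly_Mapping.lookup a k = 0 \<or> Poly_Mapping.lookup a k = 1" for k
    using le(1)[of k] by auto
  have nz: "Poly_Mapping.lookup a 0 \<noteq> 0 \<or> Poly_Mapping.lookup a 1 \<noteq> 0 \<or> Poly_Mapping.lookup a 2 \<noteq> 0"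
  proof (rule ccontr)
    assume *: "\<not> ?thesis"
    have "a = 0"
    proof (rule poly_mapping_eqI)
      fix k show "Poly_Mapping.lookup a k = Poly_Mapping.lookup 0 k"
        using * le(2)[of k] three[of k] by (cases "k < 3") auto
    qed
    then show False using assms(2) by simp
  qed
  define b where "b = (case (Poly_Mapping.lookup a 0, Poly_Mapping.lookup a 1, Poly_Mapping.lookup a 2) of
      (0, 0, _) \<Rightarrow> L2 | (0, _, 0) \<Rightarrow> L1 | (0, _, _) \<Rightarrow> L21
    | (_, 0, 0) \<Rightarrow> L0 | (_, 0, _) \<Rightarrow> L20 | (_, _, 0) \<Rightarrow> L10 | _ \<Rightarrow> L210)"
  have "a = letter_mono b"
    by (rule eq) (use cases[of 0] cases[of 1] cases[of 2] nz in \<open>auto simp: three b_def lookup_letter_mono\<close>)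
  then show thesis by (rule that)
qed

lemma lin_attach_twist:
  "twist i (lin (\<lambda>n. bas (a, n)) x)
    = lin (\<lambda>n. bas (a, n)) x + lin (\<lambda>n. bas (Poly_Mapping.single i 1 + a, n)) (lin (Q i) x)"
proof (rule additive_eqI_all[where F = "\<lambda>x. twist i (lin (\<lambda>n. bas (a, n)) x)" and x = x])
  have "times_v i (lin (\<lambda>n. bas (a, n)) y) = lin (\<lambda>n. bas (Poly_Mapping.single i 1 + a, n)) y" for y
    by (subst additive_lin) (simp_all add: add.commute)
  then show "twist i (lin (\<lambda>n. bas (a, n)) (bas m))
    = lin (\<lambda>n. bas (a, n)) (bas m) + lin (\<lambda>n. bas (Poly_Mapping.single i 1 + a, n)) (lin (Q i) (bas m))" for m
    by (simp only: twist_def on_coeff_bas lin_single)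
qed (simp_all add: ac_simps)

definition tensor_letter :: "letter \<Rightarrow> dual_steenrod \<Rightarrow> dual_steenrod2" where
  "tensor_letter a = lin (\<lambda>n. bas (letter_mono a, n))"

lemma twists_eq:
  "twists (bas (0, m)) = bas (0, m) + (\<Sum>a\<leftarrow>letters. tensor_letter a (act a (bas m)))"
proof -
  have "bas (0, m) = lin (\<lambda>n. bas (0 :: mono, n)) (bas m)" by simp
  then show ?thesis
    by (simp only: twists_def lin_attach_twist twist_add letters_def list.map sum_list.Cons sum_list.Nil
        tensor_letter_def act.simps letter_mono.simps add_0_left add_0_right ac_simps)
qed

lemma red_coaction_eq:
  assumes "AE2_mono m"
  shows "red_coaction m = (\<Sum>a\<leftarrow>letters. tensor_letter a (act a (bas m)))"
proof -
  let ?T = "\<Sum>a\<leftarrow>letters. tensor_letter a (act a (bas m))"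
  let ?P = "\<lambda>(a, n :: mono). E2_mono a \<and> a \<noteq> 0"
  have T: "supp ?P ?T"
    unfolding tensor_letter_def
    by (intro supp_sum_list supp_lin) (simp add: E2_mono_letter letter_mono_nonzero)
  then have T': "supp E2_left ?T" by (rule supp_mono) (auto simp: E2_left_def)
  have restr_restr: "restr ?P x = restr ?P (restr E2_left x)" for x
    by (rule poly_mapping_eqI) (auto simp: lookup_restr E2_left_def)
  have "red_coaction m = restr ?P (restr E2_left (psi_mono m))"
    by (simp only: red_coaction_def psi_single flip: restr_restr)
  also have "\<dots> = restr ?P (bas (0, m) + ?T)"
    by (simp only: restr_psi[OF assms] twists_eq flip: restr_restr)
  also have "\<dots> = ?T"
    by (simp only: restr_add restr_single restr_ident[OF T]) simp
  finally show ?thesis .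
qed

definition E2_both :: "mono \<times> mono \<Rightarrow> bool" where
  "E2_both = (\<lambda>(b, c). E2_mono b \<and> E2_mono c)"

lemma E2_both_add: "E2_both (p + q) \<Longrightarrow> E2_both p \<and> E2_both q"
  by (cases p; cases q) (auto simp: E2_both_def dest: E2_mono_add)

lemma restr_psi_primitive:
  assumes "k < 3"
  shows "restr E2_both (psi_mono (Poly_Mapping.single k 1)) =
    bas (Poly_Mapping.single k 1, 0) + bas (0, Poly_Mapping.single k 1)"
proof -
  let ?r = "\<lambda>j. \<Sum>i<(2::nat) ^ j. zeta_mono (Suc k - j)"
  have z: "zeta_mono (Suc k) = Poly_Mapping.single k 1" by (simp add: zeta_mono_def)
  have "psi_mono (Poly_Mapping.single k 1) = (\<Sum>j\<le>Suc k. bas (zeta_mono j, ?r j))"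
    by (simp add: psi_mono_def psi_zeta_eq)
  then have "restr E2_both (psi_mono (Poly_Mapping.single k 1))
      = (\<Sum>j\<le>Suc k. restr E2_both (bas (zeta_mono j, ?r j)))"
    unfolding restr_def by (simp only: lin_sum finite_atMost)
  also have "\<dots> = (\<Sum>j\<in>{0, Suc k}. restr E2_both (bas (zeta_mono j, ?r j)))"
  proof (rule sum.mono_neutral_right)
    show "\<forall>j\<in>{..Suc k} - {0, Suc k}. restr E2_both (bas (zeta_mono j, ?r j)) = 0"
    proof
      fix j assume "j \<in> {..Suc k} - {0, Suc k}"
      then have "\<not> E2_mono (?r j)" using not_E2_mono_psi[of j "Suc k" 0] by (simp del: sum_constant)
      then show "restr E2_both (bas (zeta_mono j, ?r j)) = 0"
        by (simp add: restr_single E2_both_def del: sum_constant)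
    qed
  qed auto
  also have "\<dots> = bas (Poly_Mapping.single k 1, 0) + bas (0, Poly_Mapping.single k 1)"
    using assms E2_mono_zeta[of "Suc k"]
    by (simp add: restr_single E2_both_def E2_mono_zero z add.commute)
  finally show ?thesis .
qed

text \<open>
  Modulo the ideal of \<open>E2_both\<close> each \<open>\<zeta>\<^sub>k\<close>, \<open>k \<le> 3\<close>, is primitive, and the coproduct is
  multiplicative.
\<close>

lemma red_coproduct_letter:
  "red_coproduct (letter_mono a) = (\<Sum>(b, c)\<leftarrow>splits a. bas (letter_mono b, letter_mono c))"
proof -
  let ?P = "\<lambda>(b, c). E2_mono b \<and> b \<noteq> 0 \<and> E2_mono c \<and> c \<noteq> 0"
  let ?e = "\<lambda>k. bas (Poly_Mapping.single k 1 :: mono, 0 :: mono) + bas (0, Poly_Mapping.single k 1)"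
  have restr_restr: "restr ?P x = restr ?P (restr E2_both x)" for x
    by (rule poly_mapping_eqI) (auto simp: lookup_restr E2_both_def)
  have mult: "restr E2_both (x * y) = restr E2_both (x' * y')"
    if "restr E2_both x = restr E2_both x'" "restr E2_both y = restr E2_both y'" for x y x' y'
    using restr_mult[where P = E2_both and x = x and y = y, OF E2_both_add]
      restr_mult[where P = E2_both and x = x' and y = y', OF E2_both_add] that by simp
  have e: "restr E2_both (psi_mono (Poly_Mapping.single k 1)) = restr E2_both (?e k)" if "k < 3" for k
    using restr_psi_primitive[OF that] restr_ident[OF supp_restr] by metis
  have e0: "restr E2_both (psi_mono (Poly_Mapping.single 0 1)) = restr E2_both (?e 0)"
    and e1: "restr E2_both (psi_mono (Poly_Mapping.single 1 1)) = restr E2_both (?e 1)"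
    and e2: "restr E2_both (psi_mono (Poly_Mapping.single 2 1)) = restr E2_both (?e 2)"
    by (rule e; simp)+
  note eqs = e0 e1 e2 mult[OF e0 e1] mult[OF e0 e2] mult[OF e1 e2] mult[OF mult[OF e0 e1] e2]
  note E2 = E2_mono_letter[of L0, unfolded letter_mono.simps] E2_mono_letter[of L1, unfolded letter_mono.simps]
    E2_mono_letter[of L2, unfolded letter_mono.simps] E2_mono_letter[of L10, unfolded letter_mono.simps]
    E2_mono_letter[of L20, unfolded letter_mono.simps] E2_mono_letter[of L21, unfolded letter_mono.simps]
    E2_mono_letter[of L210, unfolded letter_mono.simps] E2_mono_zero
  have E2_both: "E2_both (b, c) \<longleftrightarrow> E2_mono b \<and> E2_mono c" for b c
    by (simp add: E2_both_def)
  note nz = letter_mono_nonzero[of L0, unfolded letter_mono.simps] letter_mono_nonzero[of L1, unfolded letter_mono.simps]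
    letter_mono_nonzero[of L2, unfolded letter_mono.simps] letter_mono_nonzero[of L10, unfolded letter_mono.simps]
    letter_mono_nonzero[of L20, unfolded letter_mono.simps] letter_mono_nonzero[of L21, unfolded letter_mono.simps]
    letter_mono_nonzero[of L210, unfolded letter_mono.simps]
  have "red_coproduct (letter_mono a) = restr ?P (restr E2_both (psi_mono (letter_mono a)))"
    by (simp only: red_coproduct_def psi_single flip: restr_restr)
  also have "\<dots> = (\<Sum>(b, c)\<leftarrow>splits a. bas (letter_mono b, letter_mono c))"
    by (cases a; simp only: letter_mono.simps psi_mono_add eqs splits.simps list.map sum_list.Cons sum_list.Nil
        prod.case restr_restr[symmetric] distrib_left distrib_right mult_single add_Pair add_0_left add_0_right
        mult_1_left restr_add restr_single restr_zero E2_both E2 nz simp_thms if_True if_False; simp only: ac_simps)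
  finally show ?thesis .
qed

section \<open>Transfer to the cobar complex of monomials\<close>

definition to_cobar :: "word_cobar \<Rightarrow> cobar" where
  "to_cobar = lin (\<lambda>(w, m). bas (map letter_mono w, m))"

definition AE2 :: "'a \<times> mono \<Rightarrow> bool" where
  "AE2 = (\<lambda>(w, m). AE2_mono m)"

lemma to_cobar_add [simp]: "to_cobar (x + y) = to_cobar x + to_cobar y"
  by (simp add: to_cobar_def)

lemma to_cobar_zero [simp]: "to_cobar 0 = 0"
  by (simp add: to_cobar_def)

lemma to_cobar_bas [simp]: "to_cobar (bas (w, m)) = bas (map letter_mono w, m)"
  by (simp add: to_cobar_def)

lemma to_cobar_prefix: "to_cobar (prefix a x) = cobar_prefix (letter_mono a) (to_cobar x)"
  by (rule additive_eqI_all[where F = "\<lambda>x. to_cobar (prefix a x)" and x = x])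
    (auto simp: cobar_prefix_def)

lemma to_cobar_attach:
  "to_cobar (attach [a] x) = lin (\<lambda>(b, n). bas ([b], n)) (tensor_letter a x)"
  by (rule additive_eqI_all[where F = "\<lambda>x. to_cobar (attach [a] x)" and x = x])
    (simp_all add: tensor_letter_def)

lemma lin_sum_list: "lin f (\<Sum>a\<leftarrow>as. g a) = (\<Sum>a\<leftarrow>as. (lin f (g a) :: 'b \<Rightarrow>\<^sub>0 bit))"
  by (induction as) simp_all

lemma to_cobar_sum_list: "to_cobar (\<Sum>a\<leftarrow>as. g a) = (\<Sum>a\<leftarrow>as. to_cobar (g a))"
  by (induction as) simp_all

lemma cobar_d_to_cobar:
  assumes "supp AE2 x"
  shows "cobar_d (to_cobar x) = to_cobar (d_cobar x)"
proof (rule additive_eqI[where F = "\<lambda>x. cobar_d (to_cobar x)" and G = "\<lambda>x. to_cobar (d_cobar x)", OF _ _ assms])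
  fix p :: "word \<times> mono" assume p: "AE2 p"
  have "cobar_d_basis (map letter_mono w) m = to_cobar (d_cobar_basis w m)" if "AE2_mono m" for w m
  proof (induction w)
    case Nil
    show ?case
      by (simp add: red_coaction_eq[OF that] lin_sum_list coact_def to_cobar_sum_list to_cobar_attach)
  next
    case (Cons a w)
    have "lin (\<lambda>(b, c). bas (b # c # map letter_mono w, m)) (red_coproduct (letter_mono a))
        = to_cobar (prefix_split a (bas (w, m)))"
      by (simp add: red_coproduct_letter prefix_split_def lin_sum_list to_cobar_sum_list case_prod_unfold)
    with Cons show ?case by (simp add: to_cobar_prefix)
  qed
  with p show "cobar_d (to_cobar (bas p)) = to_cobar (d_cobar (bas p))"
    by (cases p) (simp add: AE2_def cobar_d_def)
qed simp_all

lemma to_cobar_inj: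
  assumes "to_cobar x = 0"
  shows "x = 0"
proof (rule lin_inj_eq_zero)
  have "inj (map letter_mono)" using inj_letter_mono by simp
  then show "inj_on (\<lambda>(w, m). (map letter_mono w, m)) (UNIV :: (word \<times> mono) set)"
    by (auto simp: inj_on_def)
  have "lin (\<lambda>p. bas ((\<lambda>(w, m). (map letter_mono w, m)) p)) x = to_cobar x"
    unfolding to_cobar_def by (rule lin_cong) auto
  then show "lin (\<lambda>p. bas ((\<lambda>(w, m). (map letter_mono w, m)) p)) x = 0"
    using assms by simp
qed (simp add: supp_def)

lemma supp_to_cobar:
  assumes "supp (\<lambda>(w, m). P (map letter_mono w) m) x"
  shows "supp (\<lambda>(w, m). P w m) (to_cobar x)"
  by (rule supp_additive[where F = to_cobar, OF _ assms]) auto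

lemma to_cobar_cochains: "supp AE2 x \<Longrightarrow> to_cobar x \<in> cobar_cochains"
  using supp_to_cobar[of "\<lambda>w m. (\<forall>a\<in>set w. E2_mono a \<and> a \<noteq> 0) \<and> AE2_mono m" x]
  by (simp add: cobar_cochains_def supp_def AE2_def E2_mono_letter letter_mono_nonzero)

lemma cochains_to_cobar:
  assumes "x \<in> cobar_cochains" "supp (\<lambda>(as, m). P as m) x"
  obtains y where "x = to_cobar y" "supp AE2 y" "supp (\<lambda>(w, m). P (map letter_mono w) m) y"
proof
  let ?f = "\<lambda>(as, m). bas (map (inv letter_mono) as, m)"
  have x: "supp (\<lambda>(as, m). (\<forall>a\<in>set as. E2_mono a \<and> a \<noteq> 0) \<and> AE2_mono m) x"
    using assms(1) by (simp add: cobar_cochains_def supp_def)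
  have inv: "letter_mono (inv letter_mono a) = a" if "E2_mono a" "a \<noteq> 0" for a
    using letter_mono_surj[OF that] by (metis f_inv_into_f rangeI)
  show "x = to_cobar (lin ?f x)"
  proof (rule additive_eqI[where F = "\<lambda>x. x" and G = "\<lambda>x. to_cobar (lin ?f x)", OF _ _ x])
    fix p :: "mono list \<times> mono"
    assume p: "case p of (as, m) \<Rightarrow> (\<forall>a\<in>set as. E2_mono a \<and> a \<noteq> 0) \<and> AE2_mono m"
    with inv show "bas p = to_cobar (lin ?f (bas p))"
      by (cases p) (simp add: map_idI)
  qed simp_all
  show "supp AE2 (lin ?f x)"
    by (rule supp_additive[where F = "lin ?f", OF _ x]) (auto simp: AE2_def)
  show "supp (\<lambda>(w, m). P (map letter_mono w) m) (lin ?f x)"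
    by (rule supp_additive[where F = "lin ?f", OF _ supp_conj[OF x assms(2)]])
      (auto simp: inv map_idI)
qed

lemma AE2_lower: "i < 3 \<Longrightarrow> k \<in> odds m \<Longrightarrow> AE2_mono (lower i k m) \<longleftrightarrow> AE2_mono m"
  unfolding AE2_mono_def odds_def by (intro all_cong) (auto simp: lookup_lower)

lemma supp_d_cobar_basis:
  "supp (\<lambda>(u, n). AE2_mono n = AE2_mono m) (d_cobar_basis w m)"
proof (induction w)
  case Nil
  have Q: "supp (\<lambda>n. AE2_mono n = AE2_mono m) (lin (Q i) x)"
    if "supp (\<lambda>n. AE2_mono n = AE2_mono m) x" "i < 3" for i x
    by (rule supp_additive[where F = "lin (Q i)", OF _ that(1)])
      (use AE2_lower[OF that(2)] in \<open>auto simp: Q_def intro!: supp_sum\<close>)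
  have "supp (\<lambda>n. AE2_mono n = AE2_mono m) (act a (bas m))" for a
    by (cases a) (simp_all add: Q del: lin_single)
  then have "supp (\<lambda>(u, n). AE2_mono n = AE2_mono m) (attach [a] (act a (bas m)))" for a
    by (rule supp_additive[where F = "attach [a]", rotated]) simp_all
  then show ?case by (simp add: coact_def supp_sum_list)
next
  case (Cons a w)
  have "supp (\<lambda>(u, n). AE2_mono n = AE2_mono m) (prefix_split a (bas (w, m)))"
    unfolding prefix_split_def by (rule supp_sum_list) auto
  with supp_prefix[OF Cons, of a] show ?case by (simp add: supp_add)
qed

lemma restr_AE2_d_cobar: "restr AE2 (d_cobar x) = d_cobar (restr AE2 x)"
proof (rule restr_additive[where R = "\<lambda>_. True"])
  fix p :: "word \<times> mono"
  obtain w m where p: "p = (w, m)" by (cases p)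
  show "supp AE2 (d_cobar (bas p))" if "AE2 p"
    using that supp_d_cobar_basis[of m w] by (auto simp: p AE2_def elim: supp_mono)
  show "supp (\<lambda>p. \<not> AE2 p) (d_cobar (bas p))" if "\<not> AE2 p"
    using that supp_d_cobar_basis[of m w] by (auto simp: p AE2_def elim: supp_mono)
qed (simp_all add: supp_def)

lemma cobar_boundary:
  assumes "supp AE2 x" "d_cobar x = 0" "to_koszul x = d_koszul 3 y"
  obtains z where "z \<in> cobar_cochains" "to_cobar x = cobar_d z"
proof -
  obtain z where "x = d_cobar z" using to_koszul_boundary[OF assms(2,3)] .
  then have "x = d_cobar (restr AE2 z)"
    using restr_AE2_d_cobar[of z] restr_ident[OF assms(1)] by simp
  then show thesis
    using that[of "to_cobar (restr AE2 z)"]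
    by (simp add: to_cobar_cochains cobar_d_to_cobar supp_restr)
qed

lemma d_cobar_zero_iff:
  assumes "supp AE2 x" "cobar_d (to_cobar x) = 0"
  shows "d_cobar x = 0"
  using assms to_cobar_inj by (simp add: cobar_d_to_cobar)

lemma supp_v_word_length: "supp (\<lambda>e. exponent_sum e = length w) (v_word w)"
proof (induction w)
  case (Cons a w)
  have "supp (\<lambda>e. exponent_sum e = Suc (length w)) (v_letter a * bas e)"
    if "exponent_sum e = length w" for e
    using that by (cases a) (simp_all add: mult_single)
  then have "supp (\<lambda>e. exponent_sum e = Suc (length w)) (v_letter a * v_word w)"
    by (intro supp_additive[where F = "\<lambda>x. v_letter a * x", OF _ Cons]) (simp_all add: distrib_left)
  then show ?case by simp
qed (simp add: exponent_sum_def flip: single_one)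

lemma supp_to_koszul_length:
  assumes "supp (\<lambda>(w, m). P (length w) m) x"
  shows "supp (\<lambda>(e, m). P (exponent_sum e) m) (to_koszul x)"
proof (rule supp_additive[where F = to_koszul, OF _ assms])
  fix p :: "word \<times> mono" assume p: "case p of (w, m) \<Rightarrow> P (length w) m"
  obtain w m where "p = (w, m)" by (cases p)
  with p show "supp (\<lambda>(e, m). P (exponent_sum e) m) (to_koszul (bas p))"
    by (auto simp: with_coeff_def intro!: supp_lin dest: supp_v_word_length[unfolded supp_def, rule_format])
qed simp

lemma letter_mono_L2: "letter_mono L2 = zeta_mono 3"
  by (simp add: zeta_mono_def numeral_3_eq_3 numeral_2_eq_2)

text \<open>
  The projection to the Koszul complex carries the relation \<open>v\<^sub>2 x = d y\<close> to one that \<open>times_v_cancel\<close>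
  solves, and its injectivity in homology carries the solution back.
\<close>

lemma v2_cancel:
  assumes "x \<in> cobar_cochains" "cobar_d x = 0" "supp (\<lambda>(as, m). 0 < length as) x"
    and "y \<in> cobar_cochains" "cobar_prefix (zeta_mono 3) x = cobar_d y"
  obtains z where "z \<in> cobar_cochains" "x = cobar_d z"
proof -
  obtain u where u: "x = to_cobar u" "supp AE2 u" "supp (\<lambda>(w, m). 0 < length w) u"
    using cochains_to_cobar[OF assms(1), of "\<lambda>as m. 0 < length as"] assms(3) by auto
  obtain w where w: "y = to_cobar w" "supp AE2 w"
    using cochains_to_cobar[OF assms(4), of "\<lambda>n m. True"] by (auto simp: supp_def)
  have u0: "d_cobar u = 0" using d_cobar_zero_iff u assms(2) by simp
  have "to_cobar (prefix L2 u + d_cobar w) = 0"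
    using assms(5) w(2) by (simp add: u(1) w(1) to_cobar_prefix letter_mono_L2 cobar_d_to_cobar del: letter_mono.simps)
  then have "prefix L2 u = d_cobar w" using to_cobar_inj f2_eq_iff by blast
  then have "times_v 2 (to_koszul u) = d_koszul 3 (to_koszul w)"
    by (metis to_koszul_prefix to_koszul_d_cobar times_letter.simps(3))
  moreover have "supp (\<lambda>(e, m). positive (Suc 2) e) (to_koszul u)"
    using supp_conj[OF supp_to_koszul[of u] supp_to_koszul_length[of "\<lambda>n m. 0 < n", OF u(3)]]
    by (rule supp_mono) (auto simp: positive_def)
  ultimately obtain z where "to_koszul u = d_koszul 3 z"
    using times_v_cancel[of 2 "to_koszul u" "to_koszul w"] positive_acyclic[of 2]
    by (auto simp: numeral_3_eq_3 numeral_2_eq_2)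
  from cobar_boundary[OF u(2) u0 this] that show thesis unfolding u(1) by blast
qed

lemma odd_mono_degree:
  assumes "AE2_mono m" "odd (mono_degree m)"
  shows "odds m \<noteq> {}"
proof
  assume *: "odds m = {}"
  have "even (Poly_Mapping.lookup m k)" for k
    using assms(1) * by (cases "k < 3") (auto simp: AE2_mono_def odds_def)
  then have "even (mono_degree m)" unfolding mono_degree_def by (intro dvd_sum) simp
  with assms(2) show False by simp
qed

lemma mono_degree_generator: "generator a \<Longrightarrow> odd (mono_degree (letter_mono a))"
  by (auto simp: generator_def mono_degree_def)

lemma v_word_not_generator: "\<not> (\<forall>a\<in>set w. generator a) \<Longrightarrow> v_word w = 0"
proof (induction w)
  case (Cons a w)
  then show ?case by (cases a) (auto simp: generator_def)
qed simp

text \<open>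
  A generator has odd degree, so it contributes an even number to \<open>t - s\<close>. Therefore the parity of
  \<open>t - s\<close> is that of the coefficient degree on the words that survive in the Koszul complex.
\<close>

lemma odd_generators:
  assumes "\<forall>a\<in>set w. generator a"
  shows "even (sum_list (map mono_degree (map letter_mono w)) + length w)"
  using assms by (induction w) (auto simp: mono_degree_generator)

lemma v2_torsion:
  assumes "x \<in> cobar_cochains" "cobar_d x = 0"
    and "supp (\<lambda>(as, m). odd (sum_list (map mono_degree as) + mono_degree m + length as)) x"
  obtains k z where "z \<in> cobar_cochains" "(cobar_prefix (zeta_mono 3) ^^ k) x = cobar_d z"
proof -
  let ?P = "\<lambda>as m. odd (sum_list (map mono_degree as) + mono_degree m + length as)"
  obtain u where u: "x = to_cobar u" "supp AE2 u" "supp (\<lambda>(w, m). ?P (map letter_mono w) m) u"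
    by (rule cochains_to_cobar[OF assms(1), of ?P, OF assms(3)])
  have u0: "d_cobar u = 0" using d_cobar_zero_iff u assms(2) by simp
  have "supp (\<lambda>(e, m). odds m \<noteq> {}) (to_koszul u)"
  proof (rule supp_additive[where F = to_koszul, OF _ supp_conj[OF u(2,3)]])
    fix p :: "word \<times> mono"
    assume p: "AE2 p \<and> (case p of (w, m) \<Rightarrow> ?P (map letter_mono w) m)"
    obtain w m where wm: "p = (w, m)" by (cases p)
    show "supp (\<lambda>(e, m). odds m \<noteq> {}) (to_koszul (bas p))"
    proof (cases "\<forall>a\<in>set w. generator a")
      case True
      then have "odd (mono_degree m)"
        using p odd_generators[OF True] by (cases "even (length w)") (auto simp: wm)
      then have "odds m \<noteq> {}" using p by (intro odd_mono_degree) (simp_all add: wm AE2_def)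
      then show ?thesis by (auto simp: wm with_coeff_def intro!: supp_lin)
    next
      case False
      then show ?thesis by (simp add: wm v_word_not_generator)
    qed
  qed simp
  moreover have "d_koszul (Suc 2) (to_koszul u) = 0"
    using to_koszul_d_cobar[of u] u0 by simp
  ultimately obtain k y where "(times_v 2 ^^ k) (to_koszul u) = d_koszul (Suc 2) y"
    using koszul_torsion[of 2 "to_koszul u"] by auto
  moreover have "to_koszul ((prefix L2 ^^ k) u) = (times_v 2 ^^ k) (to_koszul u)"
    by (induction k) (simp_all add: to_koszul_prefix)
  ultimately have "to_koszul ((prefix L2 ^^ k) u) = d_koszul 3 y" by simp
  moreover have "d_cobar ((prefix L2 ^^ k) u) = 0"
    by (induction k) (simp_all add: u0 d_cobar_prefix prefix_split_def)
  moreover have "supp AE2 ((prefix L2 ^^ k) u)"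
    by (induction k) (use u(2) supp_prefix[of AE2_mono] in \<open>simp_all add: AE2_def\<close>)
  ultimately obtain z where z: "z \<in> cobar_cochains" "to_cobar ((prefix L2 ^^ k) u) = cobar_d z"
    using cobar_boundary by blast
  have "to_cobar ((prefix L2 ^^ k) u) = (cobar_prefix (zeta_mono 3) ^^ k) x"
    by (induction k) (simp_all add: u(1) to_cobar_prefix letter_mono_L2 del: letter_mono.simps)
  with z that show thesis by metis
qed

section \<open>The bigrading\<close>

lemma mono_degree_add [simp]: "mono_degree (m + n) = mono_degree m + mono_degree n"
proof -
  have *: "mono_degree p = (\<Sum>k\<in>S. Poly_Mapping.lookup p k * (2 ^ Suc k - 1))"
    if "finite S" "Poly_Mapping.keys p \<subseteq> S" for p S
    unfolding mono_degree_def by (rule sum.mono_neutral_left) (use that in \<open>auto simp: in_keys_iff\<close>)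
  let ?S = "Poly_Mapping.keys m \<union> Poly_Mapping.keys n"
  have "mono_degree (m + n) = (\<Sum>k\<in>?S. Poly_Mapping.lookup (m + n) k * (2 ^ Suc k - 1))"
    by (rule *) (simp_all add: keys_add)
  then show ?thesis
    by (simp add: *[of ?S m] *[of ?S n] lookup_add distrib_right sum.distrib)
qed

lemma mono_degree_zero [simp]: "mono_degree 0 = 0"
  by (simp add: mono_degree_def)

lemma mono_degree_zeta: "mono_degree (zeta_mono j) = 2 ^ j - 1"
  by (cases j) (simp_all add: zeta_mono_def mono_degree_def)

definition homogeneous :: "nat \<Rightarrow> dual_steenrod2 \<Rightarrow> bool" where
  "homogeneous d = supp (\<lambda>(a, n). mono_degree a + mono_degree n = d)"

lemma homogeneous_mult:
  assumes "homogeneous d x" "homogeneous e y"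
  shows "homogeneous (d + e) (x * y)"
  unfolding homogeneous_def
proof (rule supp_additive[where F = "\<lambda>x. x * y", OF _ assms(1)[unfolded homogeneous_def]])
  fix p :: "mono \<times> mono" assume p: "case p of (a, n) \<Rightarrow> mono_degree a + mono_degree n = d"
  show "supp (\<lambda>(a, n). mono_degree a + mono_degree n = d + e) (bas p * y)"
    by (rule supp_additive[where F = "\<lambda>y. bas p * y", OF _ assms(2)[unfolded homogeneous_def]])
      (use p in \<open>auto simp: mult_single distrib_left\<close>)
qed (simp add: distrib_right)

lemma homogeneous_one: "homogeneous 0 1"
  by (simp add: homogeneous_def zero_prod_def flip: single_one)

lemma homogeneous_psi_zeta: "homogeneous (2 ^ n - 1) (psi_zeta n)"
  unfolding homogeneous_def psi_zeta_eq
proof (rule supp_sum)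
  fix j assume j: "j \<in> {..n}"
  have "mono_degree (\<Sum>i<N. zeta_mono k) = N * (2 ^ k - 1)" for N :: nat and k
    by (induction N) (simp_all add: mono_degree_zeta del: sum_constant)
  moreover have "(2::nat) ^ j - 1 + 2 ^ j * (2 ^ (n - j) - 1) = 2 ^ n - 1"
    using j by (simp add: diff_mult_distrib2 flip: power_add)
  ultimately show "supp (\<lambda>(a, m). mono_degree a + mono_degree m = 2 ^ n - 1)
      (bas (zeta_mono j, \<Sum>i<(2::nat) ^ j. zeta_mono (n - j)))"
    by (simp add: mono_degree_zeta del: sum_constant)
qed

lemma homogeneous_psi_mono: "homogeneous (mono_degree m) (psi_mono m)"
proof -
  have pow: "homogeneous (n * d) (x ^ n)" if "homogeneous d x" for n d x
    by (induction n) (simp_all add: homogeneous_one homogeneous_mult that)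
  have "homogeneous (\<Sum>k\<in>S. Poly_Mapping.lookup m k * (2 ^ Suc k - 1))
      (\<Prod>k\<in>S. psi_zeta (Suc k) ^ Poly_Mapping.lookup m k)" if "finite S" for S
    using that
  proof (induction S rule: finite_induct)
    case (insert k S)
    then show ?case
      using homogeneous_mult[OF pow[OF homogeneous_psi_zeta[of "Suc k"]]] by simp
  qed (simp add: homogeneous_one)
  then show ?thesis by (simp add: mono_degree_def psi_mono_def)
qed

lemma supp_restr_keep: "supp R x \<Longrightarrow> supp R (restr P x)"
  by (drule supp_restr_both) (erule supp_mono, simp)

definition total_degree :: "mono list \<Rightarrow> mono \<Rightarrow> nat" where
  "total_degree as m = sum_list (map mono_degree as) + mono_degree m"

lemma total_degree_Cons [simp]: "total_degree (a # as) m = mono_degree a + total_degree as m"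
  by (simp add: total_degree_def)

lemma total_degree_Nil [simp]: "total_degree [] m = mono_degree m"
  by (simp add: total_degree_def)

lemma supp_cobar_prefix:
  assumes "supp (\<lambda>(as, m). R (a # as) m) x"
  shows "supp (\<lambda>(as, m). R as m) (cobar_prefix a x)"
  by (rule supp_additive[where F = "cobar_prefix a", OF _ assms]) (auto simp: cobar_prefix_def)

lemma cobar_d_basis_degree:
  "supp (\<lambda>(bs, n). length bs = Suc (length as) \<and> total_degree bs n = total_degree as m)
     (cobar_d_basis as m)"
proof (induction as)
  case Nil
  have "supp (\<lambda>(a, n). mono_degree a + mono_degree n = mono_degree m) (red_coaction m)"
    unfolding red_coaction_def psi_single
    by (rule supp_restr_keep) (use homogeneous_psi_mono in \<open>simp add: homogeneous_def\<close>)
  then show ?case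
    unfolding cobar_d_basis.simps by (intro supp_lin) (auto simp: supp_def[of _ "red_coaction m"])
next
  case (Cons a as)
  have "supp (\<lambda>(b, c). mono_degree b + mono_degree c = mono_degree a) (red_coproduct a)"
    unfolding red_coproduct_def psi_single
    by (rule supp_restr_keep) (use homogeneous_psi_mono in \<open>simp add: homogeneous_def\<close>)
  then have "supp (\<lambda>(bs, n). length bs = Suc (length (a # as)) \<and> total_degree bs n = total_degree (a # as) m)
      (lin (\<lambda>(b, c). bas (b # c # as, m)) (red_coproduct a))"
    by (intro supp_lin) (auto simp: supp_def[of _ "red_coproduct a"])
  moreover have "supp (\<lambda>(bs, n). length bs = Suc (length (a # as)) \<and> total_degree bs n = total_degree (a # as) m)
      (cobar_prefix a (cobar_d_basis as m))"
    by (rule supp_cobar_prefix) (use Cons in simp)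
  ultimately show ?case unfolding cobar_d_basis.simps by (rule supp_add)
qed

definition cobar_component :: "(nat \<Rightarrow> nat \<Rightarrow> bool) \<Rightarrow> cobar \<Rightarrow> cobar" where
  "cobar_component P = restr (\<lambda>(as, m). P (length as) (total_degree as m))"

lemma cobar_component_d:
  "cobar_component P (cobar_d x) = cobar_d (cobar_component (\<lambda>s. P (Suc s)) x)"
  unfolding cobar_component_def
proof (rule restr_additive[where R = "\<lambda>_. True"])
  fix p :: "mono list \<times> mono"
  obtain as m where p: "p = (as, m)" by (cases p)
  note d = supp_mono[OF cobar_d_basis_degree[of as m]]
  show "supp (\<lambda>(as, m). P (length as) (total_degree as m)) (cobar_d (bas p))"
    if "case p of (as, m) \<Rightarrow> P (Suc (length as)) (total_degree as m)"
    using that by (auto simp: p cobar_d_def intro: d)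
  show "supp (\<lambda>q. \<not> (case q of (as, m) \<Rightarrow> P (length as) (total_degree as m))) (cobar_d (bas p))"
    if "\<not> (case p of (as, m) \<Rightarrow> P (Suc (length as)) (total_degree as m))"
    using that by (auto simp: p cobar_d_def intro: d)
qed (simp_all add: supp_def)

text \<open>
  The auxiliary condition shifts \<open>P\<close> up by one filtration, so that \<open>cobar_component_d\<close> applies.
\<close>

lemma cobar_component_cocycle:
  assumes "cobar_d x = 0"
  shows "cobar_d (cobar_component P x) = 0"
  using cobar_component_d[of "\<lambda>s t. case s of 0 \<Rightarrow> False | Suc s \<Rightarrow> P s t" x] assms
  by (simp add: cobar_component_def)

lemma cobar_component_cochains:
  "x \<in> cobar_cochains \<Longrightarrow> cobar_component P x \<in> cobar_cochains"
  using supp_restr_keep[of "\<lambda>(as, m). (\<forall>a\<in>set as. E2_mono a \<and> a \<noteq> 0) \<and> AE2_mono m" x]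
  by (simp add: cobar_cochains_def cobar_component_def supp_def)

lift_definition component :: "(nat \<Rightarrow> nat \<Rightarrow> bool) \<Rightarrow> E2_page \<Rightarrow> E2_page" is cobar_component
proof -
  fix P x y assume "E2_rel x y"
  then show "E2_rel (cobar_component P x) (cobar_component P y)"
  proof (rule E2_relE)
    fix z
    assume z: "x \<in> cobar_cochains" "y \<in> cobar_cochains" "cobar_d x = 0" "cobar_d y = 0"
      "z \<in> cobar_cochains" "x + y = cobar_d z"
    have "cobar_component P x + cobar_component P y = cobar_component P (cobar_d z)"
      unfolding z(6)[symmetric] by (simp add: cobar_component_def)
    also have "\<dots> = cobar_d (cobar_component (\<lambda>s. P (Suc s)) z)"
      by (rule cobar_component_d)
    finally show ?thesis
      by (rule E2_relI[rotated 5])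
        (simp_all add: z cobar_component_cocycle cobar_component_cochains)
  qed
qed

lemma E2_page_cases:
  obtains c where "x = abs_E2_page c" "c \<in> cobar_cochains" "cobar_d c = 0"
proof -
  have "E2_rel (rep_E2_page x) (rep_E2_page x)" using Quotient_E2_page by (simp add: Quotient_rep_reflp)
  moreover have "x = abs_E2_page (rep_E2_page x)" using Quotient_E2_page by (simp add: Quotient_abs_rep)
  ultimately show thesis using that by (auto elim: E2_relE)
qed

lemma abs_E2_page_eq_iff:
  assumes "x \<in> cobar_cochains" "cobar_d x = 0" "y \<in> cobar_cochains" "cobar_d y = 0"
  shows "abs_E2_page x = abs_E2_page y \<longleftrightarrow> (\<exists>z\<in>cobar_cochains. x + y = cobar_d z)"
  using Quotient_rel[OF Quotient_E2_page, of x y] assms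
  by (simp add: E2_rel_refl) (metis E2_relI E2_relE)

lemma component_abs:
  "c \<in> cobar_cochains \<Longrightarrow> cobar_d c = 0 \<Longrightarrow>
     component P (abs_E2_page c) = abs_E2_page (cobar_component P c)"
  by (rule component.abs_eq) (rule E2_rel_refl)

lemma v_mult_abs:
  "c \<in> cobar_cochains \<Longrightarrow> cobar_d c = 0 \<Longrightarrow> i < 3 \<Longrightarrow>
     v_mult i (abs_E2_page c) = abs_E2_page (cobar_prefix (zeta_mono (Suc i)) c)"
  using v_mult.abs_eq[of c i, OF E2_rel_refl] by simp

lemma plus_abs:
  "c \<in> cobar_cochains \<Longrightarrow> cobar_d c = 0 \<Longrightarrow> d \<in> cobar_cochains \<Longrightarrow> cobar_d d = 0 \<Longrightarrow>
     abs_E2_page c + abs_E2_page d = abs_E2_page (c + d)"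
  by (rule plus_E2_page.abs_eq) (simp_all add: E2_rel_refl)

lemma component_add: "component P (x + y) = component P x + component P y"
  by (cases x rule: E2_page_cases; cases y rule: E2_page_cases)
    (simp add: component_abs plus_abs cobar_component_cocycle cobar_component_cochains;
     simp add: cobar_component_def)

lemma component_component: "component P (component R x) = component (\<lambda>s t. P s t \<and> R s t) x"
proof (cases x rule: E2_page_cases)
  case (1 c)
  have "cobar_component P (cobar_component R c) = cobar_component (\<lambda>s t. P s t \<and> R s t) c"
    by (rule poly_mapping_eqI) (auto simp: cobar_component_def lookup_restr)
  with 1 show ?thesis by (simp add: component_abs cobar_component_cocycle cobar_component_cochains)
qed

lemma component_split: "component P x + component (\<lambda>s t. \<not> P s t) x = x"
proof (cases x rule: E2_page_cases)
  case (1 c)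
  have "cobar_component P c + cobar_component (\<lambda>s t. \<not> P s t) c = c"
    by (rule poly_mapping_eqI) (auto simp: cobar_component_def lookup_restr lookup_add)
  with 1 show ?thesis
    by (simp add: component_abs plus_abs cobar_component_cocycle cobar_component_cochains)
qed

lemma component_False: "component (\<lambda>s t. False) x = 0"
proof (cases x rule: E2_page_cases)
  case (1 c)
  have "cobar_component (\<lambda>s t. False) c = 0"
    by (rule poly_mapping_eqI) (auto simp: cobar_component_def lookup_restr)
  with 1 show ?thesis by (simp add: component_abs flip: zero_E2_page.abs_eq zero_E2_page_def)
qed

lemma component_v_mult:
  "component P (v_mult i x) =
     v_mult i (component (\<lambda>s t. P (Suc s) (mono_degree (zeta_mono (Suc i)) + t)) x)"
proof (cases "i < 3")
  case True
  show ?thesis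
  proof (cases x rule: E2_page_cases)
    case (1 c)
    let ?a = "zeta_mono (Suc i)"
    have "cobar_component P (cobar_prefix ?a c)
        = cobar_prefix ?a (cobar_component (\<lambda>s t. P (Suc s) (mono_degree ?a + t)) c)"
      unfolding cobar_component_def
      by (rule restr_additive[where R = "\<lambda>_. True"]) (auto simp: cobar_prefix_def supp_def)
    moreover have "cobar_prefix ?a c \<in> cobar_cochains" "cobar_d (cobar_prefix ?a c) = 0"
      using 1 True by (auto intro!: cobar_cochains_prefix E2_mono_zeta simp: cobar_d_prefix_zeta)
    ultimately show ?thesis
      using 1 True
      by (simp add: v_mult_abs component_abs cobar_component_cocycle cobar_component_cochains)
  qed
next
  case False
  then have z: "v_mult i y = 0" for y by transfer (simp add: E2_rel_refl)
  show ?thesis using component_False[of 0] component_add[of P 0 0] by (simp add: z E2_page_add_self)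
qed

lemma bidegree_iff: "x \<in> E2_bidegree s t \<longleftrightarrow> component (\<lambda>s' t'. s' = s \<and> t' = t) x = x"
proof
  let ?P = "\<lambda>s' t'. s' = s \<and> t' = t"
  assume "x \<in> E2_bidegree s t"
  then obtain c where c: "x = abs_E2_page c" "c \<in> cobar_cochains" "cobar_d c = 0"
    "supp (\<lambda>(as, m). ?P (length as) (total_degree as m)) c"
    by (auto simp: E2_bidegree_def supp_def total_degree_def)
  then show "component ?P x = x"
    by (simp add: component_abs cobar_component_def restr_ident)
next
  let ?P = "\<lambda>s' t'. s' = s \<and> t' = t"
  assume x: "component ?P x = x"
  obtain c where c: "x = abs_E2_page c" "c \<in> cobar_cochains" "cobar_d c = 0"
    by (rule E2_page_cases)
  with x have "x = abs_E2_page (cobar_component ?P c)" by (simp add: component_abs)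
  moreover have "supp (\<lambda>(as, m). ?P (length as) (total_degree as m)) (cobar_component ?P c)"
    unfolding cobar_component_def by (rule supp_restr)
  ultimately show "x \<in> E2_bidegree s t"
    using c unfolding E2_bidegree_def supp_def total_degree_def
    by (auto intro!: exI[of _ "cobar_component ?P c"] simp: cobar_component_cocycle cobar_component_cochains)
qed

lemma component_finite:
  "finite F \<Longrightarrow> component (\<lambda>s t. (s, t) \<in> F) x = (\<Sum>(s, t)\<in>F. component (\<lambda>s' t'. s' = s \<and> t' = t) x)"
proof (induction F rule: finite_induct)
  case empty
  show ?case by (simp add: component_False)
next
  case (insert p F)
  obtain s t where p: "p = (s, t)" by (cases p)
  let ?R = "\<lambda>s t. (s, t) \<in> insert p F" and ?P = "\<lambda>s' t'. s' = s \<and> t' = t"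
  have "component ?R x = component ?P (component ?R x) + component (\<lambda>s t. \<not> ?P s t) (component ?R x)"
    by (simp only: component_split)
  also have "component ?P (component ?R x) = component ?P x"
    unfolding component_component by (rule arg_cong[where f = "\<lambda>P. component P x"]) (auto simp: p)
  also have "component (\<lambda>s t. \<not> ?P s t) (component ?R x) = component (\<lambda>s t. (s, t) \<in> F) x"
    unfolding component_component
    by (rule arg_cong[where f = "\<lambda>P. component P x"]) (use insert.hyps(2) p in \<open>auto simp: fun_eq_iff\<close>)
  finally show ?case using insert by (simp add: p)
qed

lemma component_decomposition:
  obtains F where "finite F" "x = (\<Sum>(s, t)\<in>F. component (\<lambda>s' t'. s' = s \<and> t' = t) x)"
proof (cases x rule: E2_page_cases)
  case (1 c)
  let ?F = "(\<lambda>(as, m). (length as, total_degree as m)) ` Poly_Mapping.keys c"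
  have "cobar_component (\<lambda>s t. (s, t) \<in> ?F) c = c"
    unfolding cobar_component_def by (rule restr_ident) (force simp: supp_def)
  then have "component (\<lambda>s t. (s, t) \<in> ?F) x = x"
    using 1 by (simp only: component_abs)
  then show thesis
    using that[of ?F] component_finite[of ?F x] by simp
qed

section \<open>The decomposition\<close>

abbreviation filtration_zero :: "E2_page \<Rightarrow> E2_page" where
  "filtration_zero \<equiv> component (\<lambda>s t. s = 0)"

definition positive_filtration :: "E2_page set" where
  "positive_filtration = {x. filtration_zero x = 0}"

lemma filtration_zero_v_mult [simp]: "filtration_zero (v_mult i x) = 0"
  using component_False[of x] v_mult_add[of i 0 0] by (simp add: component_v_mult component_False)

lemma v_mult_zero [simp]: "v_mult i 0 = 0"
  using v_mult_add[of i 0 0] by simp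

lemma component_zero [simp]: "component P 0 = 0"
  using component_add[of P 0 0] by simp

lemma v_mult_positive [simp]: "v_mult i x \<in> positive_filtration"
  by (simp add: positive_filtration_def)

lemma v2_injective:
  assumes "x \<in> positive_filtration" "v_mult 2 x = 0"
  shows "x = 0"
proof -
  obtain c0 where c0: "x = abs_E2_page c0" "c0 \<in> cobar_cochains" "cobar_d c0 = 0"
    by (rule E2_page_cases)
  define c where "c = cobar_component (\<lambda>s t. \<not> s = 0) c0"
  have "x = component (\<lambda>s t. \<not> s = 0) x"
    using component_split[of "\<lambda>s t. s = 0" x] assms(1) by (simp add: positive_filtration_def)
  then have x: "x = abs_E2_page c" using c0 by (simp add: c_def component_abs)
  have c: "c \<in> cobar_cochains" "cobar_d c = 0"
    using c0 by (simp_all add: c_def cobar_component_cochains cobar_component_cocycle)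
  have len: "supp (\<lambda>(as, m). 0 < length as) c"
    unfolding c_def cobar_component_def by (rule supp_mono[OF supp_restr]) auto
  have zc: "cobar_prefix (zeta_mono (Suc 2)) c \<in> cobar_cochains"
    "cobar_d (cobar_prefix (zeta_mono (Suc 2)) c) = 0"
    by (rule cobar_cochains_prefix; simp add: c E2_mono_zeta)
      (simp only: cobar_d_prefix_zeta c(2) cobar_prefix_zero)
  have "abs_E2_page (cobar_prefix (zeta_mono (Suc 2)) c) = abs_E2_page 0"
    using assms(2) c by (simp add: x v_mult_abs zero_E2_page_def)
  then obtain y where "y \<in> cobar_cochains" "cobar_prefix (zeta_mono (Suc 2)) c + 0 = cobar_d y"
    using abs_E2_page_eq_iff[OF zc, of 0] by auto
  then obtain z where "z \<in> cobar_cochains" "c = cobar_d z"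
    using v2_cancel[OF c len] by auto
  then show "x = 0"
    using c abs_E2_page_eq_iff[OF c, of 0] by (auto simp: x zero_E2_page_def)
qed

lemma v2_power_injective:
  assumes "x \<in> positive_filtration" "(v_mult 2 ^^ n) x = 0"
  shows "x = 0"
  using assms
proof (induction n arbitrary: x)
  case (Suc n)
  then have "v_mult 2 x = 0" by (simp add: funpow_swap1)
  with Suc.prems(1) show ?case by (rule v2_injective)
qed simp

lemma odd_v2_torsion:
  assumes "x \<in> E2_bidegree s t" "odd (int t - int s)"
  obtains n where "(v_mult 2 ^^ n) x = 0"
proof -
  obtain c where c: "x = abs_E2_page c" "c \<in> cobar_cochains" "cobar_d c = 0"
    "supp (\<lambda>(as, m). length as = s \<and> total_degree as m = t) c"
    using assms(1) by (auto simp: E2_bidegree_def supp_def total_degree_def)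
  have "odd (t + s)" using assms(2) by presburger
  then have "supp (\<lambda>(as, m). odd (sum_list (map mono_degree as) + mono_degree m + length as)) c"
    using c(4) by (auto simp: total_degree_def elim!: supp_mono)
  from v2_torsion[OF c(2,3) this] obtain k z
    where z: "z \<in> cobar_cochains" "(cobar_prefix (zeta_mono 3) ^^ k) c = cobar_d z" .
  have k: "(cobar_prefix (zeta_mono 3) ^^ j) c \<in> cobar_cochains \<and>
      cobar_d ((cobar_prefix (zeta_mono 3) ^^ j) c) = 0 \<and>
      (v_mult 2 ^^ j) x = abs_E2_page ((cobar_prefix (zeta_mono 3) ^^ j) c)" for j
    using c cobar_d_prefix_zeta[of 2] v_mult_abs[of _ 2] E2_mono_zeta[of 3]
    by (induction j) (simp_all add: cobar_cochains_prefix)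
  have "abs_E2_page ((cobar_prefix (zeta_mono 3) ^^ k) c) = abs_E2_page 0"
    using k[of k] z by (subst abs_E2_page_eq_iff) auto
  then have "(v_mult 2 ^^ k) x = 0" using k[of k] by (simp add: zero_E2_page_def)
  then show thesis by (rule that)
qed

interpretation F2: vector_space "\<lambda>(b :: bit) (x :: E2_page). if b = 1 then x else 0"
proof
  fix a b :: bit and x y :: E2_page
  show "(if a + b = 1 then x else 0) = (if a = 1 then x else 0) + (if b = 1 then x else 0)"
    by (cases a; cases b) (simp_all add: E2_page_add_self)
qed auto

definition v2_annihilator :: "E2_page set" where
  "v2_annihilator = {x. filtration_zero x = x \<and> v_mult 2 x = 0}"

lemma v_mult_v2_annihilator: "x \<in> v2_annihilator \<Longrightarrow> v_mult i x = 0"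
  by (rule v2_injective) (simp_all add: v2_annihilator_def v_mult_commute[of 2])

lemma E2_scale_closed:
  assumes "0 \<in> S" "\<And>x y. x \<in> S \<Longrightarrow> y \<in> S \<Longrightarrow> x + y \<in> S" "x \<in> S" "\<And>i y. y \<in> S \<Longrightarrow> v_mult i y \<in> S"
  shows "E2_scale p x \<in> S"
proof (induction p rule: f2_induct)
  case (single u)
  obtain a b c where u: "u = (a, b, c)" by (cases u)
  have "(v_mult i ^^ n) y \<in> S" if "y \<in> S" for i n y
    using that by (induction n) (simp_all add: assms(4))
  with assms(3) show ?case by (simp add: u)
qed (simp_all add: assms(1,2) E2_scale_add_left)

lemma v2_power: "E2_scale (v2 ^ n) x = (v_mult 2 ^^ n) x"
proof -
  have "v2 ^ n = Poly_Mapping.single (0, 0, n) 1"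
    by (induction n) (simp_all add: v2_def mult_single zero_prod_def flip: single_one)
  then show ?thesis by simp
qed

lemma bigraded_submoduleI:
  assumes "0 \<in> S" "\<And>x y. x \<in> S \<Longrightarrow> y \<in> S \<Longrightarrow> x + y \<in> S" "\<And>i x. x \<in> S \<Longrightarrow> v_mult i x \<in> S"
    and "\<And>x. x \<in> S \<Longrightarrow> x \<in> E2.span (\<Union>s t. S \<inter> E2_bidegree s t)"
  shows "bigraded_submodule S"
proof -
  have sub: "E2.subspace S"
    by (rule E2.subspaceI) (use assms E2_scale_closed[of S] in auto)
  then have "E2.span (\<Union>s t. S \<inter> E2_bidegree s t) \<subseteq> S"
    by (intro E2.span_minimal) auto
  with sub assms(4) show ?thesis by (auto simp: bigraded_submodule_def)
qed

lemma component_bidegree: "component (\<lambda>s' t'. s' = s \<and> t' = t) x \<in> E2_bidegree s t"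
  unfolding bidegree_iff component_component
  by (rule arg_cong[where f = "\<lambda>P. component P x"]) auto

lemma span_components:
  assumes "\<And>s t. component (\<lambda>s' t'. s' = s \<and> t' = t) x \<in> S"
  shows "x \<in> E2.span (\<Union>s t. S \<inter> E2_bidegree s t)"
proof -
  obtain F where F: "finite F" "x = (\<Sum>(s, t)\<in>F. component (\<lambda>s' t'. s' = s \<and> t' = t) x)"
    by (rule component_decomposition)
  have "component (\<lambda>s' t'. s' = s \<and> t' = t) x \<in> (\<Union>s t. S \<inter> E2_bidegree s t)" for s t
    using assms[of s t] component_bidegree by blast
  then have "(\<Sum>(s, t)\<in>F. component (\<lambda>s' t'. s' = s \<and> t' = t) x)
      \<in> E2.span (\<Union>s t. S \<inter> E2_bidegree s t)"
    by (intro E2.span_sum) (auto intro: E2.span_base)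
  with F(2) show ?thesis by simp
qed

lemma v2_annihilator_component:
  assumes "x \<in> v2_annihilator"
  shows "component P x \<in> v2_annihilator"
proof -
  have "filtration_zero (component P x) = component P (filtration_zero x)"
    unfolding component_component by (rule arg_cong[where f = "\<lambda>P. component P x"]) auto
  moreover have "v_mult 2 (component P x) = component (\<lambda>s t. P (s - 1) (t - mono_degree (zeta_mono (Suc 2)))) (v_mult 2 x)"
    unfolding component_v_mult by simp
  ultimately show ?thesis using assms by (simp add: v2_annihilator_def)
qed

text \<open>
  Everything in filtration 0 that \<open>v\<^sub>2\<close> kills is killed by all \<open>v\<^sub>i\<close>, so this subspace is a submodule.
\<close>

lemma bigraded_v2_annihilator: "bigraded_submodule v2_annihilator"
proof (rule bigraded_submoduleI)
  show zero: "0 \<in> v2_annihilator" by (simp add: v2_annihilator_def)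
  show "x + y \<in> v2_annihilator" if "x \<in> v2_annihilator" "y \<in> v2_annihilator" for x y
    using that by (simp add: v2_annihilator_def component_add v_mult_add)
  show "v_mult i x \<in> v2_annihilator" if "x \<in> v2_annihilator" for i x
    using that zero by (simp add: v_mult_v2_annihilator)
  show "x \<in> E2.span (\<Union>s t. v2_annihilator \<inter> E2_bidegree s t)" if "x \<in> v2_annihilator" for x
    using that by (intro span_components v2_annihilator_component)
qed

lemma bidegree_nonzero_filtration:
  assumes "x \<in> E2_bidegree s t" "s \<noteq> 0"
  shows "filtration_zero x = 0"
proof -
  have "filtration_zero x = filtration_zero (component (\<lambda>s' t'. s' = s \<and> t' = t) x)"
    using assms(1) by (simp add: bidegree_iff)
  also have "\<dots> = component (\<lambda>s t. False) x"
    unfolding component_component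
    by (rule arg_cong[where f = "\<lambda>P. component P x"]) (use assms(2) in \<open>auto simp: fun_eq_iff\<close>)
  finally show ?thesis by (simp add: component_False)
qed

lemma bidegree_zero_filtration: "x \<in> E2_bidegree 0 t \<Longrightarrow> filtration_zero x = x"
proof -
  assume x: "x \<in> E2_bidegree 0 t"
  have "filtration_zero (component (\<lambda>s' t'. s' = 0 \<and> t' = t) x) = component (\<lambda>s' t'. s' = 0 \<and> t' = t) x"
    unfolding component_component by (rule arg_cong[where f = "\<lambda>P. component P x"]) auto
  with x show ?thesis by (simp add: bidegree_iff)
qed

lemma filtration_zero_idem [simp]: "filtration_zero (filtration_zero x) = filtration_zero x"
  by (simp add: component_component)

text \<open>
  A basis of the homogeneous elements of the annihilator extends to a basis of homogeneous elements of
  all of filtration 0; the added vectors span the complement. It is graded because its basis is.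
\<close>

lemma homogeneous_complement:
  "\<exists>B. B \<subseteq> (\<Union>t. E2_bidegree 0 t) \<and> F2.span B \<inter> v2_annihilator = {0} \<and>
    (\<forall>x. filtration_zero x = x \<longrightarrow> (\<exists>u\<in>F2.span B. \<exists>v\<in>v2_annihilator. x = u + v))"
proof -
  let ?H = "\<Union>t. E2_bidegree 0 t"
  have sub: "F2.subspace v2_annihilator"
    unfolding F2.subspace_def
    by (auto simp: v2_annihilator_def component_add v_mult_add)
  obtain A where A: "A \<subseteq> v2_annihilator \<inter> ?H" "F2.independent A" "v2_annihilator \<inter> ?H \<subseteq> F2.span A"
    by (rule F2.maximal_independent_subset)
  obtain A' where A': "A \<subseteq> A'" "A' \<subseteq> ?H" "F2.independent A'" "?H \<subseteq> F2.span A'"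
    by (rule F2.maximal_independent_subset_extend[of A ?H]) (use A(1,2) in auto)
  have decomposition: "x \<in> F2.span S"
    if "filtration_zero x = x" "\<And>t. component (\<lambda>s' t'. s' = 0 \<and> t' = t) x \<in> F2.span S" for x S
  proof -
    obtain F where F: "finite F" "x = (\<Sum>(s, t)\<in>F. component (\<lambda>s' t'. s' = s \<and> t' = t) x)"
      by (rule component_decomposition)
    have "component (\<lambda>s' t'. s' = s \<and> t' = t) x \<in> F2.span S" for s t
    proof (cases "s = 0")
      case False
      have "component (\<lambda>s' t'. s' = s \<and> t' = t) (filtration_zero x) = component (\<lambda>s t. False) x"
        unfolding component_component
        by (rule arg_cong[where f = "\<lambda>P. component P x"]) (use False in \<open>auto simp: fun_eq_iff\<close>)
      then show ?thesis using that(1) by (simp add: component_False F2.span_zero)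
    qed (use that(2) in simp)
    then have "(\<Sum>(s, t)\<in>F. component (\<lambda>s' t'. s' = s \<and> t' = t) x) \<in> F2.span S"
      by (intro F2.span_sum) auto
    with F(2) show ?thesis by simp
  qed
  have homogeneous: "component (\<lambda>s' t'. s' = 0 \<and> t' = t) x \<in> ?H" for t x
    using component_bidegree by blast
  have V: "v2_annihilator = F2.span A"
  proof
    show "v2_annihilator \<subseteq> F2.span A"
    proof
      fix x assume x: "x \<in> v2_annihilator"
      show "x \<in> F2.span A"
      proof (rule decomposition)
        show "filtration_zero x = x" using x by (simp add: v2_annihilator_def)
        show "component (\<lambda>s' t'. s' = 0 \<and> t' = t) x \<in> F2.span A" for t
          by (rule subsetD[OF A(3)], rule IntI[OF v2_annihilator_component[OF x] homogeneous])
      qed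
    qed
    show "F2.span A \<subseteq> v2_annihilator" using A(1) sub by (intro F2.span_minimal) auto
  qed
  have total: "x \<in> F2.span A'" if "filtration_zero x = x" for x
    by (rule decomposition[OF that], rule subsetD[OF A'(4) homogeneous])
  show ?thesis
  proof (intro exI conjI)
    show "A' - A \<subseteq> ?H" using A'(2) by auto
    show "F2.span (A' - A) \<inter> v2_annihilator = {0}"
    proof -
      have "x = 0" if "x \<in> F2.span (A' - A)" "x \<in> F2.span A" for x
      proof -
        have "F2.representation A' x = F2.representation A x"
          "F2.representation A' x = F2.representation (A' - A) x"
          using F2.representation_extend[OF A'(3) that(2) A'(1)]
            F2.representation_extend[OF A'(3) that(1) Diff_subset] by simp_all
        then have "F2.representation A' x b = 0" for b
          using F2.representation_ne_zero[of A x b] F2.representation_ne_zero[of "A' - A" x b] by fastforce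
        moreover have "x \<in> F2.span A'"
          using that(2) F2.span_mono[OF A'(1)] by blast
        ultimately show ?thesis
          using F2.sum_nonzero_representation_eq[OF A'(3), of x] by simp
      qed
      then show ?thesis by (auto simp: V F2.span_zero)
    qed
    show "\<forall>x. filtration_zero x = x \<longrightarrow> (\<exists>u\<in>F2.span (A' - A). \<exists>v\<in>v2_annihilator. x = u + v)"
    proof (intro allI impI)
      fix x assume "filtration_zero x = x"
      then have "x \<in> F2.span ((A' - A) \<union> A)" using total A'(1) by (simp add: Un_absorb2)
      then show "\<exists>u\<in>F2.span (A' - A). \<exists>v\<in>v2_annihilator. x = u + v"
        unfolding F2.span_Un V by auto
    qed
  qed
qed

theorem theorem2p1:
  shows "\<exists>C V :: E2_page set.
    bigraded_submodule C \<and> bigraded_submodule V \<and>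
    C \<inter> V = {0} \<and> (\<forall>x. \<exists>c\<in>C. \<exists>v\<in>V. x = c + v) \<and>
    v2_torsion_free C \<and>
    (\<forall>s t. C \<inter> E2_bidegree s t \<noteq> {0} \<longrightarrow> even (int t - int s)) \<and>
    (\<forall>s t. V \<inter> E2_bidegree s t \<noteq> {0} \<longrightarrow> s = 0)"
proof -
  obtain B where "B \<subseteq> (\<Union>t. E2_bidegree 0 t) \<and> F2.span B \<inter> v2_annihilator = {0} \<and>
    (\<forall>x. filtration_zero x = x \<longrightarrow> (\<exists>u\<in>F2.span B. \<exists>v\<in>v2_annihilator. x = u + v))"
    using homogeneous_complement ..
  note B = this[THEN conjunct1] this[THEN conjunct2, THEN conjunct1] this[THEN conjunct2, THEN conjunct2]
  \<comment> \<open>The complement in filtration 0 together with all of positive filtration.\<close>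
  define C where "C = {x. filtration_zero x \<in> F2.span B}"
  have B_fixed: "filtration_zero x = x" if "x \<in> F2.span B" for x
  proof -
    have "F2.subspace {x. filtration_zero x = x}"
      unfolding F2.subspace_def by (auto simp: component_add)
    moreover have "B \<subseteq> {x. filtration_zero x = x}"
    proof
      fix b assume "b \<in> B"
      then obtain t where "b \<in> E2_bidegree 0 t" using B(1) by auto
      then show "b \<in> {x. filtration_zero x = x}" by (simp add: bidegree_zero_filtration)
    qed
    ultimately have "F2.span B \<subseteq> {x. filtration_zero x = x}" by (rule F2.span_minimal[rotated])
    then have "x \<in> {x. filtration_zero x = x}" using that by (rule subsetD)
    then show ?thesis by simp
  qed
  have zero_C: "0 \<in> C" by (simp add: C_def F2.span_zero)
  have zero_bidegree: "0 \<in> E2_bidegree s t" for s t by (simp add: bidegree_iff)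
  have bigraded: "bigraded_submodule C"
  proof (rule bigraded_submoduleI)
    show "x + y \<in> C" if "x \<in> C" "y \<in> C" for x y
      using that by (simp add: C_def component_add F2.span_add)
    show "v_mult i x \<in> C" for i x by (simp add: C_def F2.span_zero)
    fix x assume x: "x \<in> C"
    let ?S = "E2.span (\<Union>s t. C \<inter> E2_bidegree s t)"
    have "F2.subspace ?S"
      unfolding F2.subspace_def by (simp add: E2.span_zero E2.span_add)
    moreover have "B \<subseteq> ?S"
    proof
      fix b assume b: "b \<in> B"
      then have "b \<in> C" using B_fixed F2.span_base[OF b] by (simp add: C_def)
      moreover obtain t where "b \<in> E2_bidegree 0 t" using b B(1) by auto
      ultimately show "b \<in> ?S" by (intro E2.span_base) blast
    qed
    ultimately have "F2.span B \<subseteq> ?S" by (rule F2.span_minimal[rotated])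
    moreover have "filtration_zero x \<in> F2.span B" using x by (simp add: C_def)
    ultimately have "filtration_zero x \<in> ?S" by (rule subsetD)
    moreover have "component (\<lambda>s t. \<not> s = 0) x \<in> ?S"
    proof (rule span_components)
      fix s t
      have "filtration_zero (component (\<lambda>s' t'. s' = s \<and> t' = t) (component (\<lambda>s t. \<not> s = 0) x)) = component (\<lambda>s t. False) x"
        unfolding component_component
        by (rule arg_cong[where f = "\<lambda>P. component P x"]) (auto simp: fun_eq_iff)
      then show "component (\<lambda>s' t'. s' = s \<and> t' = t) (component (\<lambda>s t. \<not> s = 0) x) \<in> C"
        by (simp add: C_def component_False F2.span_zero)
    qed
    ultimately have "filtration_zero x + component (\<lambda>s t. \<not> s = 0) x \<in> ?S"
      by (rule E2.span_add)
    then show "x \<in> ?S" by (simp only: component_split)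
  qed (rule zero_C)
  have torsion_free: "x = 0" if "x \<in> C" "(v_mult 2 ^^ n) x = 0" for x n
  proof -
    let ?u = "filtration_zero x"
    \<comment> \<open>The filtration-0 part of \<open>x\<close> is torsion by itself, since \<open>v\<^sub>2\<close> shifts the filtration by exactly 1.\<close>
    have "(v_mult 2 ^^ n) (component (\<lambda>s t. s = 0) x) = component (\<lambda>s t. s = n) ((v_mult 2 ^^ n) x)" for n
      by (induction n) (simp_all add: component_v_mult)
    then have "(v_mult 2 ^^ n) ?u = 0" using that(2) by simp
    then have "(v_mult 2 ^^ Suc n) ?u = 0" by simp
    then have "v_mult 2 ?u = 0"
      using v2_power_injective[of "v_mult 2 ?u" n] by (simp add: funpow_swap1)
    then have "?u \<in> v2_annihilator" by (simp add: v2_annihilator_def)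
    with that(1) have "?u \<in> F2.span B \<inter> v2_annihilator" by (simp add: C_def)
    then have "?u = 0" unfolding B(2) by simp
    then show ?thesis
      using that(2) by (intro v2_power_injective[of x n]) (simp_all add: positive_filtration_def)
  qed
  show ?thesis
  proof (intro exI conjI allI impI)
    show "bigraded_submodule C" "bigraded_submodule v2_annihilator"
      by (fact bigraded, fact bigraded_v2_annihilator)
    show "C \<inter> v2_annihilator = {0}"
    proof
      show "C \<inter> v2_annihilator \<subseteq> {0}"
      proof
        fix x assume x: "x \<in> C \<inter> v2_annihilator"
        then have "filtration_zero x = x" by (simp add: v2_annihilator_def)
        with x have "x \<in> F2.span B \<inter> v2_annihilator" by (simp add: C_def)
        then show "x \<in> {0}" unfolding B(2) .
      qed
      show "{0} \<subseteq> C \<inter> v2_annihilator" using zero_C by (simp add: v2_annihilator_def)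
    qed
    show "\<exists>c\<in>C. \<exists>v\<in>v2_annihilator. x = c + v" for x
    proof -
      obtain u v where uv: "u \<in> F2.span B" "v \<in> v2_annihilator" "filtration_zero x = u + v"
        using B(3)[rule_format, OF filtration_zero_idem[of x]] by blast
      have "filtration_zero v = v" using uv(2) by (simp add: v2_annihilator_def)
      then have "filtration_zero (x + v) = u + (v + v)"
        by (simp only: component_add uv(3) add.assoc)
      then have "x + v \<in> C" using uv(1) by (simp add: C_def E2_page_add_self)
      moreover have "x = (x + v) + v" by (simp add: add.assoc E2_page_add_self)
      ultimately show ?thesis using uv(2) by blast
    qed
    show "v2_torsion_free C"
      unfolding v2_torsion_free_def v2_power using torsion_free by blast
    show "even (int t - int s)" if "C \<inter> E2_bidegree s t \<noteq> {0}" for s t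
    proof (rule ccontr)
      assume odd: "odd (int t - int s)"
      have "x = 0" if "x \<in> C" "x \<in> E2_bidegree s t" for x
        by (rule odd_v2_torsion[OF that(2) odd], rule torsion_free[OF that(1)])
      then have "C \<inter> E2_bidegree s t = {0}" using zero_C zero_bidegree by blast
      with that show False by simp
    qed
    show "s = 0" if "v2_annihilator \<inter> E2_bidegree s t \<noteq> {0}" for s t
    proof (rule ccontr)
      assume "s \<noteq> 0"
      have "x = 0" if "x \<in> v2_annihilator" "x \<in> E2_bidegree s t" for x
        using that(1) bidegree_nonzero_filtration[OF that(2) \<open>s \<noteq> 0\<close>] by (simp add: v2_annihilator_def)
      moreover have "0 \<in> v2_annihilator" by (simp add: v2_annihilator_def)
      ultimately have "v2_annihilator \<inter> E2_bidegree s t = {0}"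
        using zero_bidegree by blast
      with that show False by simp
    qed
  qed
qed

end
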